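(* Let $B\subset A$ be an inclusion of simple unital $C^*$-algebras equipped with a conditional expectation of index-finite type. Equip $B'\cap A_1$ with the inner product $\langle x,y\rangle=\operatorname{tr}(x^*y)$, and define a linear map $\Delta: B'\cap A_1\to (B'\cap A_1)\otimes(B'\cap A_1)$ by $$\langle \Delta(x), y\otimes z\rangle=\tau^{1/2}\langle x, y\star z\rangle,\qquad x,y,z\in B'\cap A_1,$$ where $\star$ is the convolution product and $\tau=[A:B]_0^{-1}$. Then $\Delta$ is completely positive.
   Context: Setting: $B\subset A$ is a unital inclusion of simple unital $C^*$-algebras with a conditional expectation of index-finite type (i.e. one admitting a finite quasi-basis). $E_0:A\to B$ is the unique minimal conditional expectation, with quasi-basis $\{\lambda_i\}_{i=1}^n\subset A$, i.e. $x=\sum_i\lambda_iE_0(\lambda_i^*x)$ for all $x\in A$; $[A:B]_0=\sum_i\lambda_i\lambda_i^*$ is its (scalar) Watatani index. Put $A_{-1}=B$, $A_0=A$. $B\subset A\subset A_1\subset A_2\subset\cdots$ is the tower of Watatani's $C^*$-basic constructions: $A_n$ is generated by $A_{n-1}$ and the Jones projection $e_n$, with $e_nxe_n=E_{n-1}(x)e_n$ for $x\in A_{n-1}$ and $e_n$ commuting with $A_{n-2}$; $E_n:A_n\to A_{n-1}$ is the dual (minimal) conditional expectation, with $E_n(xe_ny)=\tau xy$ for $x,y\in A_{n-1}$. For $C\subset D$, $C'\cap D$ is the relative commutant; $B'\cap A_n$, $A'\cap A_n$ are finite-dimensional $C^*$-algebras. $\operatorname{tr}=E_0\circ E_1\circ\cdots\circ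 E_n$ restricted to $B'\cap A_n$ is a faithful tracial state, compatible with inclusions. The trace-preserving conditional expectation from $B'\cap A_n$ onto $A'\cap A_n$ is $E^{B'\cap A_n}_{A'\cap A_n}(x)=\tau\sum_i\lambda_ix\lambda_i^*$. The Fourier transform $\mathcal F_1:B'\cap A_1\to A'\cap A_2$ is $\mathcal F_1(x)=\tau^{-3/2}E^{B'\cap A_2}_{A'\cap A_2}(xe_2e_1)$; it is bijective with inverse $\mathcal F_1^{-1}(w)=\tau^{-3/2}E_2(we_1e_2)$. The convolution product on $B'\cap A_1$ is $x\star y=\mathcal F_1^{-1}(\mathcal F_1(y)\mathcal F_1(x))$. The inner product on the tensor product is $\langle a\otimes b,c\otimes d\rangle=\langle a,c\rangle\langle b,d\rangle$ (inner products are linear in the second variable). *)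

theory Defs
  imports "HOL-Analysis.Analysis"
begin

class scaleC =
  fixes scaleC :: "complex \<Rightarrow> 'a \<Rightarrow> 'a"  (infixr \<open>*\<^sub>C\<close> 75)

class star =
  fixes star :: "'a \<Rightarrow> 'a"

class complex_star_algebra = ring + scaleC + star +
  assumes scaleC_add_right: "c *\<^sub>C (x + y) = c *\<^sub>C x + c *\<^sub>C y"
    and scaleC_add_left: "(c + d) *\<^sub>C x = c *\<^sub>C x + d *\<^sub>C x"
    and scaleC_scaleC: "c *\<^sub>C d *\<^sub>C x = (c * d) *\<^sub>C x"
    and scaleC_one: "1 *\<^sub>C x = x"
    and mult_scaleC_left: "(c *\<^sub>C x) * y = c *\<^sub>C (x * y)"
    and mult_scaleC_right: "x * (c *\<^sub>C y) = c *\<^sub>C (x * y)"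
    and star_star: "star (star x) = x"
    and star_add: "star (x + y) = star x + star y"
    and star_mult: "star (x * y) = star y * star x"
    and star_scaleC: "star (c *\<^sub>C x) = cnj c *\<^sub>C star x"

interpretation complex_vector:
  vector_space "scaleC :: complex \<Rightarrow> 'a \<Rightarrow> 'a::complex_star_algebra"
  by unfold_locales
    (simp_all add: scaleC_add_right scaleC_add_left scaleC_scaleC scaleC_one)

class cstar_algebra = complex_star_algebra + real_normed_algebra_1 + banach +
  assumes scaleR_scaleC: "r *\<^sub>R x = complex_of_real r *\<^sub>C x"
    and norm_scaleC: "norm (c *\<^sub>C x) = cmod c * norm x"
    and cstar_identity: "norm (star x * x) = (norm x)\<^sup>2"

text \<open>All C*-algebras of the tower are unital C*-subalgebras (with the same unit) of one
  ambient unital C*-algebra, namely the type \<open>'a\<close>. Linear maps between them are functions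
  on \<open>'a\<close> of which only the values on the subalgebra matter.\<close>

definition cstar_subalgebra :: "'a::cstar_algebra set \<Rightarrow> bool" where
  "cstar_subalgebra S \<longleftrightarrow> closed S \<and> 1 \<in> S \<and>
     (\<forall>x\<in>S. \<forall>y\<in>S. x + y \<in> S \<and> x * y \<in> S) \<and>
     (\<forall>c. \<forall>x\<in>S. c *\<^sub>C x \<in> S) \<and> (\<forall>x\<in>S. star x \<in> S)"

definition closed_ideal :: "'a::cstar_algebra set \<Rightarrow> 'a set \<Rightarrow> bool" where
  "closed_ideal A I \<longleftrightarrow> I \<subseteq> A \<and> closed I \<and> 0 \<in> I \<and>
     (\<forall>x\<in>I. \<forall>y\<in>I. x + y \<in> I) \<and> (\<forall>c. \<forall>x\<in>I. c *\<^sub>C x \<in> I) \<and>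
     (\<forall>a\<in>A. \<forall>x\<in>I. a * x \<in> I \<and> x * a \<in> I)"

definition simple_cstar_subalgebra :: "'a::cstar_algebra set \<Rightarrow> bool" where
  "simple_cstar_subalgebra A \<longleftrightarrow> cstar_subalgebra A \<and>
     (\<forall>I. closed_ideal A I \<longrightarrow> I = {0} \<or> I = A)"

definition rel_commutant :: "'a::cstar_algebra set \<Rightarrow> 'a set \<Rightarrow> 'a set" where
  "rel_commutant C D = {x \<in> D. \<forall>c\<in>C. c * x = x * c}"

definition positive_in :: "'a::complex_star_algebra set \<Rightarrow> 'a \<Rightarrow> bool" where
  "positive_in S x \<longleftrightarrow> (\<exists>y\<in>S. x = star y * y)"

definition linear_onC ::
    "'a::complex_star_algebra set \<Rightarrow> ('a \<Rightarrow> 'b::complex_star_algebra) \<Rightarrow> bool" where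
  "linear_onC S f \<longleftrightarrow> (\<forall>x\<in>S. \<forall>y\<in>S. f (x + y) = f x + f y) \<and>
     (\<forall>c. \<forall>x\<in>S. f (c *\<^sub>C x) = c *\<^sub>C f x)"


definition cond_exp :: "'a::cstar_algebra set \<Rightarrow> 'a set \<Rightarrow> ('a \<Rightarrow> 'a) \<Rightarrow> bool" where
  "cond_exp A B E \<longleftrightarrow> linear_onC A E \<and> E ` A \<subseteq> B \<and> (\<forall>b\<in>B. E b = b) \<and>
     (\<forall>x\<in>A. \<forall>b\<in>B. E (b * x) = b * E x \<and> E (x * b) = E x * b) \<and>
     (\<forall>x\<in>A. positive_in A x \<longrightarrow> positive_in B (E x))"

definition quasi_basis :: "'a::cstar_algebra set \<Rightarrow> ('a \<Rightarrow> 'a) \<Rightarrow> 'a list \<Rightarrow> bool" where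
  "quasi_basis A E ls \<longleftrightarrow> set ls \<subseteq> A \<and>
     (\<forall>x\<in>A. x = (\<Sum>l\<leftarrow>ls. l * E (star l * x)))"

definition index_finite_cond_exp ::
    "'a::cstar_algebra set \<Rightarrow> 'a set \<Rightarrow> ('a \<Rightarrow> 'a) \<Rightarrow> bool" where
  "index_finite_cond_exp A B E \<longleftrightarrow> cond_exp A B E \<and> (\<exists>ls. quasi_basis A E ls)"

text \<open>The index \<open>\<Sum> l * star l\<close> does not depend on the quasi-basis and lies in the centre
  of \<open>A\<close>; for simple \<open>A\<close> it is therefore a real multiple of the unit, and the following
  definition picks out that real number.\<close>

definition watatani_index :: "'a::cstar_algebra set \<Rightarrow> ('a \<Rightarrow> 'a) \<Rightarrow> real" where
  "watatani_index A E =
     (THE r. \<exists>ls. quasi_basis A E ls \<and> (\<Sum>l\<leftarrow>ls. l * star l) = r *\<^sub>R 1)"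

definition minimal_cond_exp ::
    "'a::cstar_algebra set \<Rightarrow> 'a set \<Rightarrow> ('a \<Rightarrow> 'a) \<Rightarrow> bool" where
  "minimal_cond_exp A B E \<longleftrightarrow> index_finite_cond_exp A B E \<and>
     (\<forall>F. index_finite_cond_exp A B F \<longrightarrow> watatani_index A E \<le> watatani_index A F)"


text \<open>Watatani's \<open>C*\<langle>A, e\<rangle>\<close> is the closed linear span of \<open>A e A\<close>. Being merely generated
  by \<open>A\<close> and \<open>e\<close> would not suffice abstractly: the relations survive when a further copy of
  \<open>A\<close>, on which \<open>e\<close> vanishes, is added as a direct summand. For index-finite
  \<open>E\<close> with quasi-basis \<open>ls\<close> the closed span contains \<open>1 = (\<Sum>l\<leftarrow>ls. l * e * star l)\<close>, so it is
  the C*-algebra generated by \<open>A\<close> and \<open>e\<close>. Injectivity of \<open>b \<mapsto> b * e\<close>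
  is automatic for simple \<open>B\<close>, as \<open>e \<noteq> 0\<close>.\<close>

definition basic_construction ::
    "'a::cstar_algebra set \<Rightarrow> 'a set \<Rightarrow> ('a \<Rightarrow> 'a) \<Rightarrow> 'a set \<Rightarrow> 'a \<Rightarrow> bool" where
  "basic_construction B A E A1 e \<longleftrightarrow>
     cstar_subalgebra A1 \<and> A \<subseteq> A1 \<and>
     star e = e \<and> e * e = e \<and>
     (\<forall>x\<in>A. e * x * e = E x * e) \<and>
     (\<forall>b\<in>B. e * b = b * e) \<and>
     A1 = closure (complex_vector.span {x * e * y | x y. x \<in> A \<and> y \<in> A})"

definition dual_cond_exp ::
    "real \<Rightarrow> 'a::cstar_algebra set \<Rightarrow> 'a set \<Rightarrow> 'a \<Rightarrow> ('a \<Rightarrow> 'a) \<Rightarrow> bool" where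
  "dual_cond_exp \<tau> A A1 e E1 \<longleftrightarrow> cond_exp A1 A E1 \<and>
     (\<forall>x\<in>A. \<forall>y\<in>A. E1 (x * e * y) = \<tau> *\<^sub>R (x * y))"


text \<open>\<open>E0 (E1 x)\<close> is a scalar multiple of the unit for \<open>x \<in> B' \<inter> A1\<close>, since \<open>B\<close> is simple.\<close>

definition tower_tr :: "('a::cstar_algebra \<Rightarrow> 'a) \<Rightarrow> ('a \<Rightarrow> 'a) \<Rightarrow> 'a \<Rightarrow> complex" where
  "tower_tr E0 E1 x = (THE c. E0 (E1 x) = c *\<^sub>C 1)"

definition tr_inner :: "('a::cstar_algebra \<Rightarrow> complex) \<Rightarrow> 'a \<Rightarrow> 'a \<Rightarrow> complex" where
  "tr_inner tr x y = tr (star x * y)"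

definition comm_cond_exp :: "real \<Rightarrow> 'a::cstar_algebra list \<Rightarrow> 'a \<Rightarrow> 'a" where
  "comm_cond_exp \<tau> ls x = \<tau> *\<^sub>R (\<Sum>l\<leftarrow>ls. l * x * star l)"

definition fourier1 :: "real \<Rightarrow> 'a::cstar_algebra list \<Rightarrow> 'a \<Rightarrow> 'a \<Rightarrow> 'a \<Rightarrow> 'a" where
  "fourier1 \<tau> ls e1 e2 x = (\<tau> powr (-3/2)) *\<^sub>R comm_cond_exp \<tau> ls (x * e2 * e1)"

definition inv_fourier1 :: "real \<Rightarrow> ('a::cstar_algebra \<Rightarrow> 'a) \<Rightarrow> 'a \<Rightarrow> 'a \<Rightarrow> 'a \<Rightarrow> 'a" where
  "inv_fourier1 \<tau> E2 e1 e2 w = (\<tau> powr (-3/2)) *\<^sub>R E2 (w * e1 * e2)"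

definition convolution ::
    "real \<Rightarrow> 'a::cstar_algebra list \<Rightarrow> ('a \<Rightarrow> 'a) \<Rightarrow> 'a \<Rightarrow> 'a \<Rightarrow> 'a \<Rightarrow> 'a \<Rightarrow> 'a" where
  "convolution \<tau> ls E2 e1 e2 x y =
     inv_fourier1 \<tau> E2 e1 e2 (fourier1 \<tau> ls e1 e2 y * fourier1 \<tau> ls e1 e2 x)"


definition bilinear_form ::
    "('a::complex_star_algebra \<Rightarrow> 'b::complex_star_algebra \<Rightarrow> complex) \<Rightarrow> bool" where
  "bilinear_form \<beta> \<longleftrightarrow>
     (\<forall>x x' y. \<beta> (x + x') y = \<beta> x y + \<beta> x' y) \<and>
     (\<forall>x y y'. \<beta> x (y + y') = \<beta> x y + \<beta> x y') \<and>
     (\<forall>c x y. \<beta> (c *\<^sub>C x) y = c * \<beta> x y \<and> \<beta> x (c *\<^sub>C y) = c * \<beta> x y)"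

definition form_sum :: "('a \<Rightarrow> 'b \<Rightarrow> complex) \<Rightarrow> ('a \<times> 'b) list \<Rightarrow> complex" where
  "form_sum \<beta> us = (\<Sum>(a, b)\<leftarrow>us. \<beta> a b)"

text \<open>A list \<open>[(a1, b1), \<dots>, (ak, bk)]\<close> stands for \<open>a1 \<otimes> b1 + \<dots> + ak \<otimes> bk\<close>. Two such sums are
  equal in the tensor product over the complex field iff no bilinear form
  separates them, because linear functionals separate the points of a vector space.\<close>

definition tensor_rel ::
    "('a::complex_star_algebra \<times> 'b::complex_star_algebra) list \<Rightarrow> ('a \<times> 'b) list \<Rightarrow> bool" where
  "tensor_rel us vs \<longleftrightarrow> (\<forall>\<beta>. bilinear_form \<beta> \<longrightarrow> form_sum \<beta> us = form_sum \<beta> vs)"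

lemma form_sum_simps [simp]:
  "form_sum \<beta> [] = 0"
  "form_sum \<beta> ((a, b) # us) = \<beta> a b + form_sum \<beta> us"
  "form_sum \<beta> (us @ vs) = form_sum \<beta> us + form_sum \<beta> vs"
  by (simp_all add: form_sum_def)

lemma form_sum_map:
  "form_sum \<beta> (map (map_prod f g) us) = form_sum (\<lambda>a b. \<beta> (f a) (g b)) us"
  by (induction us) auto

lemma form_sum_add: "form_sum (\<lambda>a b. \<beta> a b + \<gamma> a b) us = form_sum \<beta> us + form_sum \<gamma> us"
  by (induction us) auto

lemma form_sum_cmult: "form_sum (\<lambda>a b. c * \<beta> a b) us = c * form_sum \<beta> us"
  by (induction us) (auto simp: algebra_simps)

lemma form_sum_minus: "form_sum (\<lambda>a b. - \<beta> a b) us = - form_sum \<beta> us"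
  by (induction us) auto

lemma form_sum_cnj: "form_sum (\<lambda>a b. cnj (\<beta> a b)) us = cnj (form_sum \<beta> us)"
  by (induction us) auto

lemma form_sum_zero [simp]: "form_sum (\<lambda>a b. 0) us = 0"
  by (induction us) auto

lemma form_sum_swap:
  "form_sum (\<lambda>a b. form_sum (\<lambda>c d. \<beta> a b c d) vs) us =
   form_sum (\<lambda>c d. form_sum (\<lambda>a b. \<beta> a b c d) us) vs"
  by (induction us) (auto simp: form_sum_add)

quotient_type (overloaded) ('a, 'b) tensor =
  "('a::complex_star_algebra \<times> 'b::complex_star_algebra) list" / tensor_rel
  by (rule equivpI) (auto simp: reflp_def symp_def transp_def tensor_rel_def)

lift_definition tensor ::
    "'a::complex_star_algebra \<Rightarrow> 'b::complex_star_algebra \<Rightarrow> ('a, 'b) tensor"  (infixr \<open>\<otimes>\<close> 72)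
  is "\<lambda>a b. [(a, b)]" .

definition list_mult ::
    "('a::times \<times> 'b::times) list \<Rightarrow> ('a \<times> 'b) list \<Rightarrow> ('a \<times> 'b) list" where
  "list_mult us vs = concat (map (\<lambda>(a, b). map (map_prod ((*) a) ((*) b)) vs) us)"

lemma form_sum_list_mult:
  "form_sum \<beta> (list_mult us vs) =
   form_sum (\<lambda>a b. form_sum (\<lambda>c d. \<beta> (a * c) (b * d)) vs) us"
  by (induction us) (auto simp: list_mult_def form_sum_map)

lemma bilinear_form_mult_left:
  "bilinear_form \<beta> \<Longrightarrow> bilinear_form (\<lambda>c d. \<beta> (a * c) (b * d))"
  by (simp add: bilinear_form_def distrib_left mult_scaleC_right)

lemma bilinear_form_mult_right:
  "bilinear_form \<beta> \<Longrightarrow> bilinear_form (\<lambda>a b. \<beta> (a * c) (b * d))"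
  by (simp add: bilinear_form_def distrib_right mult_scaleC_left)

lemma bilinear_form_scale:
  "bilinear_form \<beta> \<Longrightarrow> bilinear_form (\<lambda>a b. \<beta> (c *\<^sub>C a) b)"
  by (simp add: bilinear_form_def scaleC_add_right algebra_simps)

lemma bilinear_form_star:
  "bilinear_form \<beta> \<Longrightarrow> bilinear_form (\<lambda>a b. cnj (\<beta> (star a) (star b)))"
  by (simp add: bilinear_form_def star_add star_scaleC)

lemma bilinear_form_simps:
  assumes "bilinear_form \<beta>"
  shows "\<beta> (x + x') y = \<beta> x y + \<beta> x' y" "\<beta> x (y + y') = \<beta> x y + \<beta> x y'"
    "\<beta> (c *\<^sub>C x) y = c * \<beta> x y" "\<beta> x (c *\<^sub>C y) = c * \<beta> x y"
  using assms by (auto simp: bilinear_form_def)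

lemma tensor_rel_list_mult:
  assumes "tensor_rel us us'" "tensor_rel vs vs'"
  shows "tensor_rel (list_mult us vs) (list_mult us' vs')"
  unfolding tensor_rel_def
proof (intro allI impI)
  fix \<beta> :: "'a \<Rightarrow> 'b \<Rightarrow> complex"
  assume \<beta>: "bilinear_form \<beta>"
  have "form_sum (\<lambda>a b. form_sum (\<lambda>c d. \<beta> (a * c) (b * d)) vs) us =
        form_sum (\<lambda>a b. form_sum (\<lambda>c d. \<beta> (a * c) (b * d)) vs') us"
    using assms(2) bilinear_form_mult_left[OF \<beta>] by (simp add: tensor_rel_def)
  also have "\<dots> = form_sum (\<lambda>c d. form_sum (\<lambda>a b. \<beta> (a * c) (b * d)) us) vs'"
    by (rule form_sum_swap)
  also have "\<dots> = form_sum (\<lambda>c d. form_sum (\<lambda>a b. \<beta> (a * c) (b * d)) us') vs'"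
    using assms(1) bilinear_form_mult_right[OF \<beta>] by (simp add: tensor_rel_def)
  also have "\<dots> = form_sum (\<lambda>a b. form_sum (\<lambda>c d. \<beta> (a * c) (b * d)) vs') us'"
    by (rule form_sum_swap)
  finally show "form_sum \<beta> (list_mult us vs) = form_sum \<beta> (list_mult us' vs')"
    by (simp add: form_sum_list_mult)
qed

instantiation tensor :: (complex_star_algebra, complex_star_algebra) complex_star_algebra
begin

lift_definition zero_tensor :: "('a, 'b) tensor" is "[]" .

lift_definition plus_tensor :: "('a, 'b) tensor \<Rightarrow> ('a, 'b) tensor \<Rightarrow> ('a, 'b) tensor"
  is "(@)" by (simp add: tensor_rel_def)

lift_definition scaleC_tensor :: "complex \<Rightarrow> ('a, 'b) tensor \<Rightarrow> ('a, 'b) tensor"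
  is "\<lambda>c. map (map_prod ((*\<^sub>C) c) id)"
  by (simp add: tensor_rel_def form_sum_map bilinear_form_scale)

definition uminus_tensor :: "('a, 'b) tensor \<Rightarrow> ('a, 'b) tensor"
  where "uminus_tensor u = (-1) *\<^sub>C u"

definition minus_tensor :: "('a, 'b) tensor \<Rightarrow> ('a, 'b) tensor \<Rightarrow> ('a, 'b) tensor"
  where "minus_tensor u v = u + (- v)"

lift_definition times_tensor :: "('a, 'b) tensor \<Rightarrow> ('a, 'b) tensor \<Rightarrow> ('a, 'b) tensor"
  is list_mult by (rule tensor_rel_list_mult)

lift_definition star_tensor :: "('a, 'b) tensor \<Rightarrow> ('a, 'b) tensor"
  is "map (map_prod star star)"
proof -
  fix us vs :: "('a \<times> 'b) list"
  assume uv: "tensor_rel us vs"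
  show "tensor_rel (map (map_prod star star) us) (map (map_prod star star) vs)"
    unfolding tensor_rel_def
  proof (intro allI impI)
    fix \<beta> :: "'a \<Rightarrow> 'b \<Rightarrow> complex"
    assume "bilinear_form \<beta>"
    then have "form_sum (\<lambda>a b. cnj (\<beta> (star a) (star b))) us =
               form_sum (\<lambda>a b. cnj (\<beta> (star a) (star b))) vs"
      using uv bilinear_form_star unfolding tensor_rel_def by blast
    then show "form_sum \<beta> (map (map_prod star star) us) =
               form_sum \<beta> (map (map_prod star star) vs)"
      by (simp add: form_sum_map form_sum_cnj)
  qed
qed

instance
proof
  fix u v w :: "('a, 'b) tensor" and c d :: complex
  show "u + v + w = u + (v + w)"
    by transfer (simp add: tensor_rel_def)
  show "u + v = v + u"
    by transfer (simp add: tensor_rel_def)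
  show "0 + u = u"
    by transfer (simp add: tensor_rel_def)
  show "- u + u = 0"
    unfolding uminus_tensor_def
    by transfer (simp add: tensor_rel_def form_sum_map bilinear_form_simps form_sum_minus
        del: complex_vector.scale_minus_left)
  show "u - v = u + - v"
    by (rule minus_tensor_def)
  show "u * v * w = u * (v * w)"
    by transfer (simp add: tensor_rel_def form_sum_list_mult mult.assoc)
  show "(u + v) * w = u * w + v * w"
    by transfer (simp add: tensor_rel_def form_sum_list_mult)
  show "u * (v + w) = u * v + u * w"
    by transfer (simp add: tensor_rel_def form_sum_list_mult form_sum_add)
  show "c *\<^sub>C (u + v) = c *\<^sub>C u + c *\<^sub>C v"
    by transfer (simp add: tensor_rel_def)
  show "(c + d) *\<^sub>C u = c *\<^sub>C u + d *\<^sub>C u"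
    by transfer (simp add: tensor_rel_def form_sum_map bilinear_form_simps form_sum_cmult
        form_sum_add distrib_right)
  show "c *\<^sub>C d *\<^sub>C u = (c * d) *\<^sub>C u"
    by transfer (simp add: tensor_rel_def form_sum_map bilinear_form_simps form_sum_cmult
        mult.assoc del: map_map)
  show "1 *\<^sub>C u = u"
    by transfer (simp add: tensor_rel_def form_sum_map bilinear_form_simps)
  show "(c *\<^sub>C u) * v = c *\<^sub>C (u * v)"
    by transfer (simp add: tensor_rel_def form_sum_map form_sum_list_mult mult_scaleC_left)
  show "u * (c *\<^sub>C v) = c *\<^sub>C (u * v)"
    by transfer (simp add: tensor_rel_def form_sum_map form_sum_list_mult mult_scaleC_right)
  show "star (star u) = u"
    by transfer (simp add: tensor_rel_def form_sum_map star_star del: map_map)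
  show "star (u + v) = star u + star v"
    by transfer (simp add: tensor_rel_def)
  show "star (u * v) = star v * star u"
  proof (transfer, unfold tensor_rel_def, intro allI impI)
    fix us vs :: "('a \<times> 'b) list" and \<beta> :: "'a \<Rightarrow> 'b \<Rightarrow> complex"
    show "form_sum \<beta> (map (map_prod star star) (list_mult us vs)) =
          form_sum \<beta> (list_mult (map (map_prod star star) vs) (map (map_prod star star) us))"
      by (simp add: form_sum_map form_sum_list_mult star_mult) (rule form_sum_swap)
  qed
  show "star (c *\<^sub>C u) = cnj c *\<^sub>C star u"
    by transfer (simp add: tensor_rel_def form_sum_map star_scaleC del: map_map)
qed

end

text \<open>For linear subspaces \<open>S\<close> and \<open>T\<close> the canonical map from the tensor product of \<open>S\<close>
  and \<open>T\<close> into the tensor product of the ambient spaces is injective. For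
  finite-dimensional C*-subalgebras its image is their unique C*-tensor product.\<close>

definition tensor_prod ::
    "'a::complex_star_algebra set \<Rightarrow> 'b::complex_star_algebra set \<Rightarrow> ('a, 'b) tensor set" where
  "tensor_prod S T = complex_vector.span {x \<otimes> y | x y. x \<in> S \<and> y \<in> T}"

definition tensor_sum ::
    "('a::complex_star_algebra \<times> 'b::complex_star_algebra) list \<Rightarrow> ('a, 'b) tensor" where
  "tensor_sum us = (\<Sum>(a, b)\<leftarrow>us. a \<otimes> b)"

text \<open>The sesquilinear extension of \<open>\<langle>a \<otimes> b, c \<otimes> d\<rangle> = \<langle>a, c\<rangle> \<langle>b, d\<rangle>\<close> to \<open>tensor_prod S T\<close>,
  expressed through representations of its elements as finite sums of elementary tensors of
  \<open>S\<close> and \<open>T\<close>. The value is independent of the representations if the two given forms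
  are sesquilinear on \<open>S\<close> and \<open>T\<close>.\<close>

definition tensor_inner ::
    "'a::complex_star_algebra set \<Rightarrow> 'b::complex_star_algebra set \<Rightarrow>
     ('a \<Rightarrow> 'a \<Rightarrow> complex) \<Rightarrow> ('b \<Rightarrow> 'b \<Rightarrow> complex) \<Rightarrow>
     ('a, 'b) tensor \<Rightarrow> ('a, 'b) tensor \<Rightarrow> complex" where
  "tensor_inner S T ip ip' u v =
     (THE r. \<exists>us vs. set us \<subseteq> S \<times> T \<and> set vs \<subseteq> S \<times> T \<and>
        u = tensor_sum us \<and> v = tensor_sum vs \<and>
        r = (\<Sum>(a, b)\<leftarrow>us. \<Sum>(c, d)\<leftarrow>vs. ip a c * ip' b d))"


definition coproduct ::
    "'a::cstar_algebra set \<Rightarrow> ('a \<Rightarrow> 'a \<Rightarrow> complex) \<Rightarrow> real \<Rightarrow> ('a \<Rightarrow> 'a \<Rightarrow> 'a) \<Rightarrow>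
     'a \<Rightarrow> ('a, 'a) tensor" where
  "coproduct M ip \<tau> conv x =
     (THE d. d \<in> tensor_prod M M \<and>
        (\<forall>y\<in>M. \<forall>z\<in>M. tensor_inner M M ip ip d (y \<otimes> z) =
           complex_of_real (\<tau> powr (1/2)) * ip x (conv y z)))"

text \<open>\<open>positive_matrix n S X\<close>: the \<open>n \<times> n\<close> matrix \<open>(X i j)\<close> is of the form \<open>Y\<^sup>* Y\<close> for some
  \<open>n \<times> n\<close> matrix \<open>Y\<close> over \<open>S\<close>, i.e. it is a positive element of the C*-algebra
  of \<open>n \<times> n\<close> matrices over the C*-algebra \<open>S\<close>.\<close>

definition positive_matrix ::
    "nat \<Rightarrow> 'a::complex_star_algebra set \<Rightarrow> (nat \<Rightarrow> nat \<Rightarrow> 'a) \<Rightarrow> bool" where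
  "positive_matrix n S X \<longleftrightarrow>
     (\<exists>Y. (\<forall>i<n. \<forall>j<n. Y i j \<in> S) \<and>
          (\<forall>i<n. \<forall>j<n. X i j = (\<Sum>k<n. star (Y k i) * Y k j)))"

definition completely_positive ::
    "'a::complex_star_algebra set \<Rightarrow> 'b::complex_star_algebra set \<Rightarrow> ('a \<Rightarrow> 'b) \<Rightarrow> bool" where
  "completely_positive S T \<Phi> \<longleftrightarrow> \<Phi> ` S \<subseteq> T \<and> linear_onC S \<Phi> \<and>
     (\<forall>n X. positive_matrix n S X \<longrightarrow> positive_matrix n T (\<lambda>i j. \<Phi> (X i j)))"

end

theory Submission
  imports Defs "HOL-Computational_Algebra.Fundamental_Theorem_Algebra"
begin

text \<open>
  Up to the factor \<open>sqrt \<tau>\<close>, the convolution \<open>y \<star> z\<close> is obtained from \<open>y\<close> by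
  replacing the Jones projection with \<open>z\<close>: for \<open>y = p * e1 * q\<close> with \<open>p, q \<in> A\<close> it is
  \<open>p * z * q\<close>. This makes sense because \<open>z\<close>, like \<open>e1\<close>, commutes with \<open>B\<close>. It leads to a
  Schur product theorem (\<open>conv_mult_star\<close>): the convolution of the Gram matrices
  \<open>(a p * star (a q))\<close> and \<open>(b p * star (b q))\<close> is a sum of matrices of the form
  \<open>(g p * star (g q))\<close>. Paired by means of the trace with a positive matrix over \<open>M\<close> it
  therefore gives the trace of a sum of elements \<open>G * star G\<close> (\<open>conv_positive\<close>). As \<open>\<Delta>\<close> is
  the adjoint of the convolution, this says that a matrix \<open>(\<Delta> (X i j))\<close> with \<open>(X i j)\<close>
  positive has a nonnegative quadratic form with respect to the trace of the matrices over
  \<open>M \<otimes> M\<close> (\<open>adjoint_completely_positive\<close>). In a finite-dimensional star-algebra with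
  a faithful positive functional such elements are squares
  (\<open>square_root_of_nonneg_form\<close>), so the matrix is positive.

  Two facts about \<open>F = E0 \<circ> E1\<close> on \<open>M\<close> are needed for this: the trace property
  and the finite dimension of \<open>M\<close>. The trace property comes from minimality. Perturbing \<open>E0\<close> by an
  element of the relative commutant changes the index, and the first variation vanishes only if
  \<open>x \<mapsto> \<Sum> l * x * star l\<close> is a multiple of \<open>E0\<close> there (\<open>minimal_index_map\<close>). This
  proportionality passes on to \<open>F\<close> (\<open>index_map_F\<close>), and it forces the modular
  automorphism of an expectation to be trivial (\<open>central_if_index_map_scalar\<close>): its square is
  trivial and it is a positive operator. Given the trace property, Bessel's inequality summed
  over a quasi-basis bounds the number of orthonormal elements of \<open>M\<close>
  (\<open>orthonormal_card_bound\<close>).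

  The arguments with positive elements rest on two properties: the sums of elements \<open>star z * z\<close>
  form a proper cone, and the elements of this cone have square roots. Both are derived from an
  iteration that converges to \<open>1 - sqrt (1 - r)\<close> (\<open>sqrt_one_minus\<close>). The same square roots yield
  positive and negative parts, with which the centre of a simple algebra is seen to be trivial
  (\<open>simple_central_scalar\<close>).
\<close>

section \<open>Positivity in a unital C*-algebra\<close>

lemma star_zero [simp]: "star (0::'a::complex_star_algebra) = 0"
  using star_add[of "0::'a" 0] by simp

lemma star_minus: "star (- x) = - star (x::'a::complex_star_algebra)"
  using star_add[of x "- x"] by (simp add: eq_neg_iff_add_eq_0 add.commute)

lemma star_diff: "star (x - y) = star x - star (y::'a::complex_star_algebra)"
  using star_add[of x "- y"] by (simp add: star_minus)

lemma star_sum: "star (sum f I) = (\<Sum>i\<in>I. star (f i :: 'a::complex_star_algebra))"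
  by (induction I rule: infinite_finite_induct) (auto simp: star_add)

lemma star_one [simp]: "star (1::'a::cstar_algebra) = 1"
  by (metis mult.left_neutral mult.right_neutral star_mult star_star)

lemma star_scaleR: "star (r *\<^sub>R x) = r *\<^sub>R star (x::'a::cstar_algebra)"
  by (simp add: scaleR_scaleC star_scaleC)

lemma star_square_eq_0_iff: "star x * x = 0 \<longleftrightarrow> x = (0::'a::cstar_algebra)"
  using cstar_identity[of x] by auto

lemma norm_star [simp]: "norm (star x) = norm (x::'a::cstar_algebra)"
proof -
  have *: "norm y \<le> norm (star y)" for y :: 'a
  proof (cases "y = 0")
    case False
    have "norm y * norm y \<le> norm (star y) * norm y"
      using norm_mult_ineq[of "star y" y] by (simp add: cstar_identity power2_eq_square)
    then show ?thesis using False by simp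
  qed simp
  show ?thesis using *[of x] *[of "star x"] by (simp add: star_star)
qed

lemma bounded_linear_star: "bounded_linear (star :: 'a \<Rightarrow> 'a::cstar_algebra)"
  by (rule bounded_linear_intro[where K = 1]) (simp_all add: star_add star_scaleR)

lemmas tendsto_star = bounded_linear.tendsto[OF bounded_linear_star]

lemma norm_square_selfadj: "star x = x \<Longrightarrow> norm (x * x) = (norm (x::'a::cstar_algebra))\<^sup>2"
  using cstar_identity[of x] by simp

lemma bounded_linear_scaleC: "bounded_linear (\<lambda>x::'a::cstar_algebra. c *\<^sub>C x)"
  by (rule bounded_linear_intro[where K = "cmod c"])
    (simp_all add: scaleC_add_right norm_scaleC scaleR_scaleC scaleC_scaleC mult.commute)

lemma scaleC_of_real: "complex_of_real r *\<^sub>C x = r *\<^sub>R (x::'a::cstar_algebra)"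
  by (simp add: scaleR_scaleC)

definition re_part :: "'a::cstar_algebra \<Rightarrow> 'a" where
  "re_part x = (1/2) *\<^sub>R (x + star x)"

definition im_part :: "'a::cstar_algebra \<Rightarrow> 'a" where
  "im_part x = (1/2) *\<^sub>R ((- \<i>) *\<^sub>C (x - star x))"

lemma star_re_part: "star (re_part x) = re_part x"
  by (simp add: re_part_def star_scaleR star_add star_star add.commute)

lemma star_im_part: "star (im_part x) = im_part x"
  unfolding im_part_def by (simp only: star_scaleR star_scaleC star_diff star_star)
    (simp add: complex_vector.scale_right_diff_distrib)

lemma re_im_decomposition: "x = re_part x + \<i> *\<^sub>C im_part x"
proof -
  have "\<i> *\<^sub>C im_part x = (1/2) *\<^sub>R (x - star x)"
    by (simp add: im_part_def scaleR_scaleC scaleC_scaleC)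
  then have "re_part x + \<i> *\<^sub>C im_part x = (1/2) *\<^sub>R (x + x)"
    unfolding re_part_def by (simp only: scaleR_add_right[symmetric]) simp
  then show ?thesis by (simp add: scaleR_2[symmetric])
qed

lemma norm_re_part: "norm (re_part x) \<le> norm x"
  using norm_triangle_ineq[of x "star x"] by (simp add: re_part_def)

lemma norm_im_part: "norm (im_part x) \<le> norm x"
  using norm_triangle_ineq4[of x "star x"] by (simp add: im_part_def norm_scaleC)

lemma cstar_subalgebraD:
  assumes "cstar_subalgebra S"
  shows "closed S" "1 \<in> S" "0 \<in> S" "\<And>x y. x \<in> S \<Longrightarrow> y \<in> S \<Longrightarrow> x + y \<in> S"
    "\<And>x y. x \<in> S \<Longrightarrow> y \<in> S \<Longrightarrow> x * y \<in> S" "\<And>x y. x \<in> S \<Longrightarrow> y \<in> S \<Longrightarrow> x - y \<in> S"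
    "\<And>x. x \<in> S \<Longrightarrow> - x \<in> S"
    "\<And>c x. x \<in> S \<Longrightarrow> c *\<^sub>C x \<in> S" "\<And>r x. x \<in> S \<Longrightarrow> r *\<^sub>R x \<in> S"
    "\<And>x. x \<in> S \<Longrightarrow> star x \<in> S"
proof -
  note S = assms[unfolded cstar_subalgebra_def]
  show "closed S" "1 \<in> S" "\<And>x y. x \<in> S \<Longrightarrow> y \<in> S \<Longrightarrow> x + y \<in> S"
    "\<And>x y. x \<in> S \<Longrightarrow> y \<in> S \<Longrightarrow> x * y \<in> S" and C: "\<And>c x. x \<in> S \<Longrightarrow> c *\<^sub>C x \<in> S"
    and "\<And>x. x \<in> S \<Longrightarrow> star x \<in> S"
    using S by auto
  show "\<And>r x. x \<in> S \<Longrightarrow> r *\<^sub>R x \<in> S" using C by (simp add: scaleR_scaleC)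
  show "0 \<in> S" using C[of 1 0] S by simp
  show m: "\<And>x. x \<in> S \<Longrightarrow> - x \<in> S" using C[of _ "-1"] by simp
  show "\<And>x y. x \<in> S \<Longrightarrow> y \<in> S \<Longrightarrow> x - y \<in> S"
    using S m by (metis diff_conv_add_uminus)
qed

lemma re_part_in: "cstar_subalgebra S \<Longrightarrow> x \<in> S \<Longrightarrow> re_part x \<in> S"
  unfolding re_part_def by (intro cstar_subalgebraD)

lemma im_part_in: "cstar_subalgebra S \<Longrightarrow> x \<in> S \<Longrightarrow> im_part x \<in> S"
  unfolding im_part_def by (intro cstar_subalgebraD)

lemma cstar_subalgebra_sum:
  assumes "cstar_subalgebra S" "\<And>i. i \<in> I \<Longrightarrow> f i \<in> S"
  shows "sum f I \<in> S"
  using assms(2) by (induction I rule: infinite_finite_induct)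
    (simp_all add: cstar_subalgebraD[OF assms(1)])

text \<open>The square root of \<open>1 - r\<close> is \<open>1 - s\<close> where \<open>s = (r + s\<^sup>2) / 2\<close>; the fixed point is the
  limit of the iteration started at \<open>0\<close>. All iterates are polynomials in \<open>r\<close> with
  nonnegative coefficients, so the scalar iteration at \<open>r = 1\<close> dominates them.\<close>

primrec sqrt_iter :: "'a::cstar_algebra \<Rightarrow> nat \<Rightarrow> 'a" where
  "sqrt_iter r 0 = 0"
| "sqrt_iter r (Suc n) = (1/2) *\<^sub>R (r + sqrt_iter r n * sqrt_iter r n)"

primrec sqrt_iter_bound :: "nat \<Rightarrow> real" where
  "sqrt_iter_bound 0 = 0"
| "sqrt_iter_bound (Suc n) = (1 + sqrt_iter_bound n * sqrt_iter_bound n) / 2"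

lemma sqrt_iter_bound: "0 \<le> sqrt_iter_bound n" "sqrt_iter_bound n \<le> 1"
  by (induction n) (auto simp: mult_le_one)

lemma sqrt_iter_bound_mono: "sqrt_iter_bound n \<le> sqrt_iter_bound (Suc n)"
proof -
  have "0 \<le> (1 - sqrt_iter_bound n)\<^sup>2" by simp
  then show ?thesis by (simp add: power2_eq_square algebra_simps)
qed

lemma norm_sqrt_iter:
  assumes "norm r \<le> 1"
  shows "norm (sqrt_iter r n) \<le> sqrt_iter_bound n"
proof (induction n)
  case (Suc n)
  have "norm (sqrt_iter r n * sqrt_iter r n) \<le> sqrt_iter_bound n * sqrt_iter_bound n"
    using norm_mult_ineq mult_mono[OF Suc Suc] sqrt_iter_bound order_trans norm_ge_zero by metis
  then have "norm (r + sqrt_iter r n * sqrt_iter r n) \<le> 1 + sqrt_iter_bound n * sqrt_iter_bound n"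
    using assms norm_triangle_ineq[of r "sqrt_iter r n * sqrt_iter r n"] by linarith
  then show ?case by simp
qed simp

lemma norm_sqrt_iter_step:
  assumes "norm r \<le> 1"
  shows "norm (sqrt_iter r (Suc n) - sqrt_iter r n) \<le> sqrt_iter_bound (Suc n) - sqrt_iter_bound n"
proof (induction n)
  case 0
  then show ?case using assms by simp
next
  case (Suc n)
  define a b where "a = sqrt_iter r (Suc n)" and "b = sqrt_iter r n"
  define s t where "s = sqrt_iter_bound (Suc n)" and "t = sqrt_iter_bound n"
  have ab: "norm a \<le> s" "norm b \<le> t" "norm (a - b) \<le> s - t"
    using norm_sqrt_iter[OF assms] Suc unfolding a_def b_def s_def t_def by blast+
  have a: "a = (1/2) *\<^sub>R (r + b * b)" by (simp add: a_def b_def)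
  have "sqrt_iter r (Suc (Suc n)) - sqrt_iter r (Suc n) = (1/2) *\<^sub>R (r + a * a) - (1/2) *\<^sub>R (r + b * b)"
    by (simp only: sqrt_iter.simps(2)[of r "Suc n"] a_def[symmetric] a[symmetric])
  also have "\<dots> = (1/2) *\<^sub>R (a * a - b * b)"
    by (simp only: scaleR_diff_right[symmetric] add_diff_cancel_left)
  also have "a * a - b * b = a * (a - b) + (a - b) * b" by (simp add: algebra_simps)
  also have "norm ((1/2) *\<^sub>R (a * (a - b) + (a - b) * b))
      \<le> 1/2 * (norm (a * (a - b)) + norm ((a - b) * b))"
    using norm_triangle_ineq by simp
  also have "\<dots> \<le> 1/2 * (norm a * norm (a - b) + norm (a - b) * norm b)"
    by (intro mult_left_mono add_mono norm_mult_ineq) auto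
  also have "\<dots> \<le> 1/2 * (s * (s - t) + (s - t) * t)"
  proof -
    have "0 \<le> s" "0 \<le> s - t"
      using sqrt_iter_bound_mono[of n] sqrt_iter_bound(1)[of "Suc n"] unfolding s_def t_def by linarith+
    then show ?thesis
      using ab by (intro mult_left_mono add_mono mult_mono norm_ge_zero) linarith+
  qed
  also have "\<dots> = sqrt_iter_bound (Suc (Suc n)) - sqrt_iter_bound (Suc n)"
  proof -
    have s: "s = (1 + t * t) / 2" by (simp add: s_def t_def)
    show ?thesis
      by (simp only: sqrt_iter_bound.simps(2)[of "Suc n"] s_def[symmetric]) (simp add: s field_simps)
  qed
  finally show ?case .
qed

lemma sqrt_one_minus:
  fixes r :: "'a::cstar_algebra"
  assumes r: "norm r \<le> 1" "star r = r"
  obtains s where "star s = s" "norm s \<le> 1" "(1 - s) * (1 - s) = 1 - r"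
    "\<And>b. b * r = r * b \<Longrightarrow> b * s = s * b" "\<And>S. cstar_subalgebra S \<Longrightarrow> r \<in> S \<Longrightarrow> s \<in> S"
proof -
  let ?q = "sqrt_iter r"
  have conv_bound: "convergent sqrt_iter_bound"
  proof (rule Bseq_mono_convergent)
    show "Bseq sqrt_iter_bound" using sqrt_iter_bound by (intro BseqI'[where K = 1]) simp
    show "\<forall>m n. m \<le> n \<longrightarrow> sqrt_iter_bound m \<le> sqrt_iter_bound n"
      using lift_Suc_mono_le[of sqrt_iter_bound, OF sqrt_iter_bound_mono] by blast
  qed
  then obtain l where "sqrt_iter_bound \<longlonglongrightarrow> l" by (auto simp: convergent_def)
  then have "summable (\<lambda>n. sqrt_iter_bound (Suc n) - sqrt_iter_bound n)"
    by (rule telescope_summable)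
  then have "summable (\<lambda>n. ?q (Suc n) - ?q n)"
    by (rule summable_comparison_test[rotated]) (use norm_sqrt_iter_step[OF r(1)] in blast)
  then obtain s where "(\<lambda>n. \<Sum>k<n. ?q (Suc k) - ?q k) \<longlonglongrightarrow> s"
    by (auto simp: summable_def sums_def)
  then have s: "?q \<longlonglongrightarrow> s"
    by (simp only: sum_lessThan_telescope sqrt_iter.simps(1) diff_zero)
  have "(\<lambda>n. ?q (Suc n)) \<longlonglongrightarrow> (1/2) *\<^sub>R (r + s * s)"
    unfolding sqrt_iter.simps(2) by (intro tendsto_intros s)
  then have fixpoint: "s = (1/2) *\<^sub>R (r + s * s)"
    by (rule LIMSEQ_unique[OF LIMSEQ_Suc[OF s]])
  show ?thesis
  proof
    have star_q: "star (?q n) = ?q n" for n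
      by (induction n) (simp_all add: star_scaleR star_add star_mult r)
    show "star s = s" by (rule LIMSEQ_unique[OF tendsto_star[OF s, unfolded star_q] s])
    show "norm s \<le> 1"
      by (rule LIMSEQ_le_const2[OF tendsto_norm[OF s]])
        (meson norm_sqrt_iter[OF r(1)] sqrt_iter_bound(2) order_trans)
    have "2 *\<^sub>R s = r + s * s" using arg_cong[OF fixpoint, of "scaleR 2"] by simp
    then show "(1 - s) * (1 - s) = 1 - r"
      by (simp add: algebra_simps scaleR_2)
    show "b * s = s * b" if b: "b * r = r * b" for b
    proof -
      have "b * ?q n = ?q n * b" for n
      proof (induction n)
        case (Suc n)
        have "b * (?q n * ?q n) = ?q n * ?q n * b" by (metis Suc mult.assoc)
        then show ?case by (simp add: distrib_left distrib_right b)
      qed simp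
      then have "(\<lambda>n. b * ?q n) \<longlonglongrightarrow> s * b"
        using tendsto_mult_right[OF s, of b] by (simp only:)
      then show ?thesis by (rule LIMSEQ_unique[OF tendsto_mult_left[OF s, of b]])
    qed
    show "s \<in> S" if S: "cstar_subalgebra S" "r \<in> S" for S
    proof -
      have "?q n \<in> S" for n
        by (induction n) (auto intro!: cstar_subalgebraD[OF S(1)] S(2))
      then show ?thesis
        using closed_sequentially[OF cstar_subalgebraD(1)[OF S(1)] _ s] by blast
    qed
  qed
qed

text \<open>An element is called positive if it is self-adjoint and lies in a ball around a nonnegative
  scalar which touches the origin. Sums of positive elements are visibly positive, whereas
  the agreement with the elements \<open>star z * z\<close> has to be proved.\<close>

definition pos :: "'a::cstar_algebra \<Rightarrow> bool" where
  "pos x \<longleftrightarrow> star x = x \<and> (\<exists>t\<ge>0. norm (t *\<^sub>R 1 - x) \<le> t)"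

lemma pos_selfadj: "pos x \<Longrightarrow> star x = x"
  by (simp add: pos_def)

lemma pos_zero [simp]: "pos 0"
  by (auto simp: pos_def)

lemma pos_add:
  assumes "pos x" "pos y" shows "pos (x + y)"
proof -
  obtain s t where "s \<ge> 0" "norm (s *\<^sub>R 1 - x) \<le> s" "t \<ge> 0" "norm (t *\<^sub>R 1 - y) \<le> t"
    using assms by (auto simp: pos_def)
  moreover have "(s + t) *\<^sub>R 1 - (x + y) = (s *\<^sub>R 1 - x) + (t *\<^sub>R 1 - y)"
    by (simp add: algebra_simps)
  ultimately have "norm ((s + t) *\<^sub>R 1 - (x + y)) \<le> s + t"
    by (metis add_mono norm_triangle_le)
  then show ?thesis
    using assms \<open>s \<ge> 0\<close> \<open>t \<ge> 0\<close> by (auto simp: pos_def star_add intro!: exI[of _ "s + t"])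
qed

lemma pos_sum: "(\<And>i. i \<in> I \<Longrightarrow> pos (f i)) \<Longrightarrow> pos (sum f I)"
  by (induction I rule: infinite_finite_induct) (auto intro: pos_add)

lemma pos_scaleR:
  assumes "pos x" "r \<ge> 0" shows "pos (r *\<^sub>R x)"
proof -
  obtain t where t: "t \<ge> 0" "norm (t *\<^sub>R 1 - x) \<le> t"
    using assms by (auto simp: pos_def)
  have "(r * t) *\<^sub>R 1 - r *\<^sub>R x = r *\<^sub>R (t *\<^sub>R 1 - x)" by (simp add: algebra_simps)
  then have "norm ((r * t) *\<^sub>R 1 - r *\<^sub>R x) \<le> r * t"
    using t assms by (simp add: mult_left_mono)
  then show ?thesis
    using assms t by (auto simp: pos_def star_scaleR intro!: exI[of _ "r * t"])
qed

lemma pos_norm_minus: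
  assumes "star x = x" "norm x \<le> k"
  shows "pos (k *\<^sub>R 1 - x)"
  unfolding pos_def
proof (intro conjI exI[of _ k])
  show "star (k *\<^sub>R 1 - x) = k *\<^sub>R 1 - x" using assms by (simp add: star_diff star_scaleR)
  show "norm (k *\<^sub>R 1 - (k *\<^sub>R 1 - x)) \<le> k" using assms by simp
  show "0 \<le> k" using assms norm_ge_zero order_trans by blast
qed

lemma pos_norm_plus:
  assumes "star x = x" "norm x \<le> k"
  shows "pos (k *\<^sub>R 1 + x)"
  using pos_norm_minus[of "- x" k] assms by (simp add: star_minus)

lemma pos_scalarD:
  assumes "pos (c *\<^sub>C (1::'a::cstar_algebra))"
  shows "0 \<le> Re c" "Im c = 0"
proof -
  have "cnj c *\<^sub>C (1::'a) = c *\<^sub>C 1" using pos_selfadj[OF assms] by (simp add: star_scaleC)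
  then have "cnj c = c" by (metis complex_vector.scale_cancel_right zero_neq_one)
  then show "Im c = 0" by (simp add: complex_eq_iff)
  then have c: "c = complex_of_real (Re c)" by (simp add: complex_eq_iff)
  obtain t where "t \<ge> 0" "norm (t *\<^sub>R 1 - c *\<^sub>C (1::'a)) \<le> t" using assms by (auto simp: pos_def)
  then have "norm ((t - Re c) *\<^sub>R (1::'a)) \<le> t"
    by (subst (asm) c) (simp add: scaleC_of_real scaleR_diff_left)
  then show "0 \<le> Re c" by simp
qed

lemma pos_scalarRD: "pos (k *\<^sub>R (1::'a::cstar_algebra)) \<Longrightarrow> k \<ge> 0"
  using pos_scalarD(1)[of "complex_of_real k", where 'a = 'a] by (simp add: scaleC_of_real)

text \<open>With \<open>t\<close> the radius of the ball, \<open>x = t * (1 - r)\<close> for some \<open>r\<close> in the unit ball. The root inherits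
  from the iteration that it commutes with whatever commutes with \<open>x\<close> and lies in every
  subalgebra containing \<open>x\<close>.\<close>

lemma pos_sqrt:
  assumes "pos x"
  obtains c where "pos c" "c * c = x" "\<And>b. b * x = x * b \<Longrightarrow> b * c = c * b"
    "\<And>S. cstar_subalgebra S \<Longrightarrow> x \<in> S \<Longrightarrow> c \<in> S"
proof -
  obtain t where t: "t \<ge> 0" "norm (t *\<^sub>R 1 - x) \<le> t" and x: "star x = x"
    using assms by (auto simp: pos_def)
  show ?thesis
  proof (cases "t = 0")
    case True
    then have "x = 0" using t by simp
    then show ?thesis using that[of 0] by simp
  next
    case False
    then have t0: "t > 0" using t by simp
    define r where "r = 1 - (1/t) *\<^sub>R x"
    have "r = (1/t) *\<^sub>R (t *\<^sub>R 1 - x)" using t0 by (simp add: r_def algebra_simps)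
    then have "norm r \<le> 1" using t t0 by simp
    moreover have "star r = r" by (simp add: r_def x star_diff star_scaleR)
    ultimately obtain s where s: "star s = s" "norm s \<le> 1" "(1 - s) * (1 - s) = 1 - r"
      "\<And>b. b * r = r * b \<Longrightarrow> b * s = s * b" "\<And>S. cstar_subalgebra S \<Longrightarrow> r \<in> S \<Longrightarrow> s \<in> S"
      using sqrt_one_minus by metis
    show ?thesis
    proof (rule that[of "sqrt t *\<^sub>R (1 - s)"])
      show "pos (sqrt t *\<^sub>R (1 - s))"
        using pos_norm_minus[OF s(1,2)] t by (intro pos_scaleR) simp_all
      show "sqrt t *\<^sub>R (1 - s) * sqrt t *\<^sub>R (1 - s) = x"
        using t0 by (simp add: s(3) r_def)
      show "b * sqrt t *\<^sub>R (1 - s) = sqrt t *\<^sub>R (1 - s) * b" if "b * x = x * b" for b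
      proof -
        have "b * s = s * b" by (rule s(4)) (simp add: r_def algebra_simps that)
        then show ?thesis by (simp add: algebra_simps)
      qed
      show "sqrt t *\<^sub>R (1 - s) \<in> S" if "cstar_subalgebra S" "x \<in> S" for S
        using that s(5)[of S] by (auto simp: r_def intro!: cstar_subalgebraD[OF that(1)])
    qed
  qed
qed

text \<open>If \<open>c\<close> and \<open>d\<close> are commuting self-adjoint elements then \<open>u = c + i d\<close> satisfies
  \<open>u\<^sup>* u = c\<^sup>2 + d\<^sup>2\<close>, and the C*-identity bounds the norm of \<open>u\<close>, hence of its real part.\<close>

lemma norm_le_of_sum_squares:
  fixes c d :: "'a::cstar_algebra"
  assumes "star c = c" "star d = d" "c * d = d * c" "c * c + d * d = k *\<^sub>R 1" "k \<ge> 0"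
  shows "norm (c * c) \<le> k"
proof -
  define u where "u = c + \<i> *\<^sub>C d"
  have star_u: "star u = c - \<i> *\<^sub>C d"
    by (simp add: u_def star_add star_scaleC assms(1,2))
  have "star u * u = (c - \<i> *\<^sub>C d) * (c + \<i> *\<^sub>C d)" by (simp only: star_u) (simp only: u_def)
  also have "\<dots> = c * c + d * d"
    by (simp add: algebra_simps mult_scaleC_left mult_scaleC_right scaleC_scaleC assms(3))
  finally have "(norm u)\<^sup>2 = k" using cstar_identity[of u] assms(4,5) by simp
  moreover have "c = (1/2) *\<^sub>R (u + star u)"
    by (simp only: star_u) (simp add: u_def scaleR_2[symmetric])
  then have "norm c \<le> norm u"
    using norm_triangle_ineq[of u "star u"] by simp
  ultimately show ?thesis
    by (simp only: norm_square_selfadj[OF assms(1)]) (metis norm_ge_zero power_mono)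
qed

text \<open>If \<open>norm a \<le> 1\<close> and \<open>c\<close> is the square root of \<open>1 - a\<^sup>2\<close> then \<open>c + i a\<close> is unitary, so
  \<open>1 - a\<^sup>2 = c\<^sup>2\<close> lies in the unit ball.\<close>

lemma pos_square:
  assumes "star a = a" shows "pos (a * a)"
proof (cases "a = 0")
  case False
  define t where "t = (norm a)\<^sup>2"
  have t: "t > 0" using False by (simp add: t_def)
  define r where "r = (1/t) *\<^sub>R (a * a)"
  have "norm r \<le> 1" using t by (simp add: r_def norm_square_selfadj[OF assms] t_def)
  moreover have "star r = r" by (simp add: r_def star_scaleR star_mult assms)
  ultimately obtain s where s: "star s = s" "(1 - s) * (1 - s) = 1 - r"
      "\<And>b. b * r = r * b \<Longrightarrow> b * s = s * b" using sqrt_one_minus by metis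
  have as: "a * s = s * a" by (rule s(3)) (simp add: r_def mult.assoc)
  define c where "c = sqrt t *\<^sub>R (1 - s)"
  have cc: "c * c = t *\<^sub>R 1 - a * a"
    using t by (simp add: c_def s(2)) (simp add: r_def scaleR_diff_right)
  have "norm (c * c) \<le> t"
  proof (rule norm_le_of_sum_squares)
    show "c * c + a * a = t *\<^sub>R 1" by (simp add: cc)
    show "c * a = a * c" by (simp add: c_def algebra_simps as)
  qed (use t s assms in \<open>auto simp: c_def star_scaleR star_diff\<close>)
  then show ?thesis using t assms by (auto simp: pos_def star_mult cc intro!: exI[of _ t])
qed simp

text \<open>Commuting square roots \<open>c\<close> and \<open>d\<close> of \<open>x\<close> and \<open>- x\<close> satisfy \<open>c\<^sup>2 + d\<^sup>2 = 0\<close>.\<close>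

lemma pos_antisym:
  assumes "pos x" "pos (- x)" shows "x = 0"
proof -
  obtain c where c: "pos c" "c * c = x" "\<And>b. b * x = x * b \<Longrightarrow> b * c = c * b"
    using pos_sqrt[OF assms(1)] by metis
  obtain d where d: "pos d" "d * d = - x" "\<And>b. b * (- x) = (- x) * b \<Longrightarrow> b * d = d * b"
    using pos_sqrt[OF assms(2)] by metis
  have "c * x = x * c" by (simp flip: c(2) add: mult.assoc)
  then have "c * d = d * c" by (intro d(3)) simp
  then have "norm (c * c) \<le> 0"
    using c(1,2) d(1,2) by (intro norm_le_of_sum_squares[of c d]) (auto simp: pos_selfadj)
  then show ?thesis by (simp add: c)
qed

lemma norm_le_of_pos:
  assumes "pos p" "pos (k *\<^sub>R 1 - p)" shows "norm p \<le> k"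
proof -
  have k: "k \<ge> 0" using pos_add[OF assms] by (intro pos_scalarRD) simp
  obtain c where c: "pos c" "c * c = p" "\<And>b. b * p = p * b \<Longrightarrow> b * c = c * b"
    using pos_sqrt[OF assms(1)] by metis
  obtain d where d: "pos d" "d * d = k *\<^sub>R 1 - p"
    "\<And>b. b * (k *\<^sub>R 1 - p) = (k *\<^sub>R 1 - p) * b \<Longrightarrow> b * d = d * b"
    using pos_sqrt[OF assms(2)] by metis
  have "c * p = p * c" by (simp flip: c(2) add: mult.assoc)
  then have "c * d = d * c" by (intro d(3)) (simp add: algebra_simps)
  then have "norm (c * c) \<le> k"
    using c(1,2) d(1,2) k by (intro norm_le_of_sum_squares[of c d]) (auto simp: pos_selfadj)
  then show ?thesis by (simp add: c)
qed

text \<open>The elements \<open>star w * w\<close> and \<open>w * star w\<close> have the same nonzero spectrum. The next lemmas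
  replace spectra by norms of powers: the norm of a self-adjoint element is determined by its
  powers, and \<open>(1 - star w * w) ^ n\<close> is \<open>1 - star w * q * w\<close> for a polynomial \<open>q\<close> in
  \<open>w * star w\<close> whose norm grows only linearly in \<open>n\<close>.\<close>

lemma norm_selfadj_power2:
  assumes "star h = (h::'a::cstar_algebra)"
  shows "norm (h ^ 2 ^ k) = norm h ^ 2 ^ k"
proof (induction k)
  case (Suc k)
  have star_pow: "star (h ^ n) = h ^ n" for n
    by (induction n) (auto simp: star_mult assms power_commutes)
  have "norm (h ^ 2 ^ Suc k) = norm (h ^ 2 ^ k * h ^ 2 ^ k)"
    by (simp only: power_add[symmetric] power_Suc mult_2)
  also have "\<dots> = (norm (h ^ 2 ^ k))\<^sup>2" by (rule norm_square_selfadj[OF star_pow])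
  also have "\<dots> = norm h ^ 2 ^ Suc k"
    by (simp only: Suc power_mult[symmetric] power_Suc mult.commute)
  finally show ?case .
qed simp

lemma norm_one_minus_swap:
  fixes w :: "'a::cstar_algebra"
  assumes "norm (1 - w * star w) \<le> 1"
  shows "norm (1 - star w * w) \<le> 1"
proof (rule ccontr)
  let ?h = "1 - star w * w" and ?g = "1 - w * star w"
  have hw: "?h * star w = star w * ?g" by (simp add: algebra_simps)
  have powers: "\<exists>q. ?h ^ n = 1 - star w * q * w \<and> norm q \<le> real n" for n
  proof (induction n)
    case (Suc n)
    then obtain q where q: "?h ^ n = 1 - star w * q * w" "norm q \<le> real n" by blast
    have "?h ^ Suc n = ?h * (1 - star w * q * w)" using q by simp
    also have "\<dots> = ?h - ?h * star w * q * w" by (simp add: right_diff_distrib mult.assoc)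
    also have "\<dots> = ?h - star w * ?g * q * w" unfolding hw ..
    also have "\<dots> = 1 - star w * (1 + ?g * q) * w"
      by (simp add: distrib_left distrib_right mult.assoc)
    finally have "?h ^ Suc n = 1 - star w * (1 + ?g * q) * w" .
    moreover have "norm (?g * q) \<le> 1 * real n"
      using norm_mult_ineq[of ?g q] mult_mono[OF assms q(2)] by simp
    then have "norm (1 + ?g * q) \<le> real (Suc n)"
      using norm_triangle_ineq[of 1 "?g * q"] by simp
    ultimately show ?case by blast
  qed (auto intro: exI[of _ 0])
  assume "\<not> norm ?h \<le> 1"
  then have h1: "norm ?h > 1" by simp
  \<comment> \<open>\<open>norm ?h ^ n\<close> is the square of \<open>(1 + y) ^ n \<ge> n * y\<close>, which outgrows every linear bound.\<close>
  define y where "y = sqrt (norm ?h) - 1"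
  have y: "y > 0" "(1 + y)\<^sup>2 = norm ?h" using h1 by (auto simp: y_def)
  define C where "C = (norm w)\<^sup>2"
  have bound: "(real n * y)\<^sup>2 \<le> 1 + real n * C" if n: "n = 2 ^ k" for n k
  proof -
    obtain q where q: "?h ^ n = 1 - star w * q * w" "norm q \<le> real n" using powers by blast
    have "real n * y \<le> (1 + y) ^ n" using Bernoulli_inequality[of y n] y by simp
    then have "(real n * y)\<^sup>2 \<le> ((1 + y) ^ n)\<^sup>2" using y by (intro power_mono) auto
    also have "\<dots> = norm ?h ^ n" by (simp add: y(2)[symmetric] power_mult[symmetric] mult.commute)
    also have "\<dots> = norm (?h ^ n)"
      unfolding n by (rule norm_selfadj_power2[symmetric]) (simp add: star_diff star_mult star_star)
    also have "\<dots> \<le> 1 + norm (star w * q * w)" 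
      unfolding q using norm_triangle_ineq4[of 1 "star w * q * w"] by simp
    also have "norm (star w * q * w) \<le> norm w * norm q * norm w"
      by (metis norm_mult_ineq mult_right_mono norm_ge_zero norm_star order_trans)
    also have "\<dots> = norm q * C" by (simp add: C_def power2_eq_square)
    also have "\<dots> \<le> real n * C" using q(2) by (simp add: C_def mult_right_mono)
    finally show ?thesis by simp
  qed
  have C: "C \<ge> 0" by (simp add: C_def)
  obtain k :: nat where k: "(1 + C) / y\<^sup>2 < 2 ^ k" using real_arch_pow[of 2] by auto
  define n :: nat where "n = 2 ^ k"
  have "1 + C < real n * y\<^sup>2" using k y by (simp add: n_def field_simps)
  then have "real n * (1 + C) < real n * (real n * y\<^sup>2)"
    by (intro mult_strict_left_mono) (auto simp: n_def)
  then have "real n + real n * C < (real n * y)\<^sup>2" by (simp add: power2_eq_square algebra_simps)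
  moreover have "real n \<ge> 1" by (simp add: n_def)
  ultimately show False using bound[OF n_def] by simp
qed

lemma pos_swap:
  assumes "pos (w * star w)" shows "pos (star w * w)"
proof -
  obtain t where t: "t \<ge> 0" "norm (t *\<^sub>R 1 - w * star w) \<le> t" using assms by (auto simp: pos_def)
  show ?thesis
  proof (cases "t = 0")
    case True
    then have "star (star w) * star w = 0" using t by (simp add: star_star)
    then have "star w = 0" by (simp only: star_square_eq_0_iff)
    then show ?thesis by simp
  next
    case False
    then have t0: "t > 0" using t by simp
    define v where "v = (1 / sqrt t) *\<^sub>R w"
    have vv: "v * star v = (1/t) *\<^sub>R (w * star w)" "star v * v = (1/t) *\<^sub>R (star w * w)"
      using t0 by (auto simp: v_def star_scaleR)
    have "1 - v * star v = (1/t) *\<^sub>R (t *\<^sub>R 1 - w * star w)"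
      using t0 by (simp add: vv algebra_simps)
    then have "norm (1 - v * star v) \<le> 1" using t t0 by simp
    then have "norm (1 - star v * v) \<le> 1" by (rule norm_one_minus_swap)
    moreover have "t *\<^sub>R 1 - star w * w = t *\<^sub>R (1 - star v * v)"
      using t0 by (simp add: vv algebra_simps)
    ultimately have "norm (t *\<^sub>R 1 - star w * w) \<le> t" using t0 by simp
    then show ?thesis using t by (auto simp: pos_def star_mult star_star)
  qed
qed

lemma pos_abs:
  assumes "star y = y"
  obtains a where "pos a" "a * a = y * y" "\<And>b. b * y = y * b \<Longrightarrow> b * a = a * b"
    "\<And>S. cstar_subalgebra S \<Longrightarrow> y \<in> S \<Longrightarrow> a \<in> S"
proof -
  obtain a where a: "pos a" "a * a = y * y" "\<And>b. b * (y * y) = (y * y) * b \<Longrightarrow> b * a = a * b"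
    "\<And>S. cstar_subalgebra S \<Longrightarrow> y * y \<in> S \<Longrightarrow> a \<in> S"
    using pos_sqrt[OF pos_square[OF assms]] by metis
  show ?thesis
  proof (rule that[of a])
    show "b * a = a * b" if "b * y = y * b" for b
      by (rule a(3)) (metis that mult.assoc)
    show "a \<in> S" if "cstar_subalgebra S" "y \<in> S" for S
      using a(4) that cstar_subalgebraD(5) by blast
  qed (rule a(1) a(2))+
qed

text \<open>Let \<open>y = star z * z\<close> and let \<open>n = \<bar>y\<bar> - y\<close> be (twice) its negative part. For \<open>w = z * n\<close> the
  element \<open>star w * w = n * y * n\<close> is negative. As \<open>star w * w + w * star w\<close> is a sum of
  squares, \<open>w * star w\<close> is positive, hence so is \<open>star w * w\<close>; thus \<open>w = 0\<close> and \<open>n = 0\<close>.\<close>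

lemma pos_star_mult: "pos (star z * z)"
proof -
  define y where "y = star z * z"
  have sy: "star y = y" by (simp add: y_def star_mult star_star)
  obtain a where a: "pos a" "a * a = y * y" "\<And>b. b * y = y * b \<Longrightarrow> b * a = a * b"
    using pos_abs[OF sy] by metis
  have ya: "y * a = a * y" by (rule a(3)) simp
  obtain s where s: "pos s" "s * s = a" "\<And>b. b * a = a * b \<Longrightarrow> b * s = s * b"
    using pos_sqrt[OF a(1)] by metis
  define n where "n = a - y"
  have sn: "star n = n" using sy a(1) by (simp add: n_def star_diff pos_selfadj)
  have na: "n * a = a * n" by (simp add: n_def algebra_simps ya)
  then have ns: "n * s = s * n" by (rule s(3))
  have yn: "y * n = - (a * n)" by (simp add: n_def algebra_simps ya a(2))
  define w where "w = z * n"
  have "star w * w = n * (y * n)" by (simp add: w_def y_def star_mult sn mult.assoc)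
  also have "\<dots> = - (n * (s * s) * n)" by (simp add: yn s(2) mult.assoc)
  also have "n * (s * s) * n = (n * s) * (n * s)" by (metis ns mult.assoc)
  finally have ww: "star w * w = - ((n * s) * (n * s))" .
  have "star (n * s) = n * s" using sn s(1) by (simp add: star_mult pos_selfadj ns)
  then have p1: "pos ((n * s) * (n * s))" by (rule pos_square)
  obtain p q where pq: "star p = p" "star q = q" "w = p + \<i> *\<^sub>C q"
    using star_re_part star_im_part re_im_decomposition by blast
  have star_w: "star w = p - \<i> *\<^sub>C q" by (simp add: pq star_add star_scaleC)
  have "w * star w + star w * w = (p + \<i> *\<^sub>C q) * (p - \<i> *\<^sub>C q) + (p - \<i> *\<^sub>C q) * (p + \<i> *\<^sub>C q)"
    by (simp only: star_w) (simp only: pq(3))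
  also have "\<dots> = 2 *\<^sub>R (p * p + q * q)"
    by (simp add: algebra_simps mult_scaleC_left mult_scaleC_right scaleC_scaleC scaleR_2)
  finally have "w * star w = 2 *\<^sub>R (p * p + q * q) + (n * s) * (n * s)"
    by (simp add: ww algebra_simps)
  then have "pos (w * star w)"
    using p1 pos_square pq by (auto intro!: pos_add pos_scaleR)
  then have "pos (star w * w)" by (rule pos_swap)
  moreover have "pos (- (star w * w))" using p1 by (simp add: ww)
  ultimately have "w = 0" using pos_antisym star_square_eq_0_iff by blast
  then have "y * n = 0" by (simp add: y_def w_def mult.assoc)
  moreover from this have "a * n = 0" using yn by simp
  ultimately have "n * n = 0" by (simp add: n_def left_diff_distrib)
  then have "n = 0" using star_square_eq_0_iff[of n] sn by simp
  then show ?thesis using a(1) by (simp add: n_def y_def)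
qed

lemma pos_conj:
  assumes "pos x" shows "pos (star b * x * b)"
proof -
  obtain c where c: "pos c" "c * c = x" using pos_sqrt[OF assms] by metis
  have "star b * x * b = star (c * b) * (c * b)"
    using c by (auto simp: star_mult pos_selfadj mult.assoc)
  then show ?thesis using pos_star_mult by metis
qed

lemma positive_in_pos: "positive_in S x \<Longrightarrow> pos x"
  by (auto simp: positive_in_def pos_star_mult)

lemma pos_positive_in:
  assumes "pos x" "cstar_subalgebra S" "x \<in> S" shows "positive_in S x"
  using pos_sqrt[OF assms(1)] assms(2,3) pos_selfadj unfolding positive_in_def by metis

section \<open>The centre of a simple C*-algebra\<close>

lemma closed_ideal_generated_by_central:
  assumes B: "cstar_subalgebra B" and n: "n \<in> B" "\<And>b. b \<in> B \<Longrightarrow> b * n = n * b"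
  shows "closed_ideal B (closure ((*) n ` B))" (is "closed_ideal B (closure ?S)")
proof -
  note B' = cstar_subalgebraD[OF B]
  have img: "f ` closure ?S \<subseteq> closure ?S" if "bounded_linear f" "f ` ?S \<subseteq> ?S" for f
    using closure_bounded_linear_image_subset[OF that(1)] closure_mono[OF that(2)] by blast
  have mem: "n * b \<in> ?S" if "b \<in> B" for b using that by blast
  show ?thesis
    unfolding closed_ideal_def
  proof (intro conjI ballI allI)
    show "closure ?S \<subseteq> B" using B' n by (intro closure_minimal) auto
    have "n * 0 \<in> ?S" using B' by (intro mem) auto
    then show "0 \<in> closure ?S" using closure_subset by fastforce
    show "x + y \<in> closure ?S" if "x \<in> closure ?S" "y \<in> closure ?S" for x y
    proof -
      obtain f where f: "\<And>k. f k \<in> ?S" "f \<longlonglongrightarrow> x"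
        using \<open>x \<in> closure ?S\<close> unfolding closure_sequential by blast
      obtain g where g: "\<And>k. g k \<in> ?S" "g \<longlonglongrightarrow> y"
        using \<open>y \<in> closure ?S\<close> unfolding closure_sequential by blast
      have "f k + g k \<in> ?S" for k
      proof -
        obtain b c where "f k = n * b" "b \<in> B" "g k = n * c" "c \<in> B" using f(1)[of k] g(1)[of k] by blast
        then show ?thesis using mem[of "b + c"] B' by (simp add: distrib_left)
      qed
      then show ?thesis
        unfolding closure_sequential using tendsto_add[OF f(2) g(2)]
        by (intro exI[of _ "\<lambda>k. f k + g k"]) blast
    qed
    show "c *\<^sub>C x \<in> closure ?S" if "x \<in> closure ?S" for c x
    proof -
      have "(*\<^sub>C) c ` ?S \<subseteq> ?S"
        using mem B' by (auto simp: mult_scaleC_right[symmetric])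
      then show ?thesis using img[OF bounded_linear_scaleC] that by blast
    qed
    fix a x assume a: "a \<in> B" and x: "x \<in> closure ?S"
    have "a * (n * b) = n * (a * b)" for b using n(2)[OF a] by (metis mult.assoc)
    then have "(*) a ` ?S \<subseteq> ?S" using mem B' a by auto
    then show "a * x \<in> closure ?S" using img[OF bounded_linear_mult_right] x by blast
    have "(\<lambda>y. y * a) ` ?S \<subseteq> ?S" using mem B' a by (auto simp: mult.assoc)
    then show "x * a \<in> closure ?S" using img[OF bounded_linear_mult_left] x by blast
  qed (rule closed_closure)
qed

text \<open>The positive and negative parts of a central self-adjoint element are central and
  annihilate each other. In a simple algebra one of them vanishes.\<close>

lemma simple_central_pos_or_neg:
  assumes B: "simple_cstar_subalgebra B"
    and y: "star y = y" "y \<in> B" "\<And>b. b \<in> B \<Longrightarrow> b * y = y * b"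
  shows "pos y \<or> pos (- y)"
proof -
  have sub: "cstar_subalgebra B" using B by (simp add: simple_cstar_subalgebra_def)
  note B' = cstar_subalgebraD[OF sub]
  obtain a where a: "pos a" "a * a = y * y" "\<And>b. b * y = y * b \<Longrightarrow> b * a = a * b" "a \<in> B"
    using pos_abs[OF y(1)] sub y(2) by metis
  have ya: "y * a = a * y" by (rule a(3)) simp
  define n where "n = a - y"
  have nB: "n \<in> B" using a(4) y(2) B' by (simp add: n_def)
  have nc: "b * n = n * b" if "b \<in> B" for b
    using a(3)[OF y(3)[OF that]] y(3)[OF that] by (simp add: n_def algebra_simps)
  let ?I = "closure ((*) n ` B)"
  have "?I = {0} \<or> ?I = B"
    using B closed_ideal_generated_by_central[OF sub nB nc]
    by (simp add: simple_cstar_subalgebra_def)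
  then show ?thesis
  proof
    assume I: "?I = {0}"
    have "n * 1 \<in> ?I" using imageI[OF B'(2)] by (rule subsetD[OF closure_subset])
    then have "n = 0" unfolding I by simp
    then show ?thesis using a(1) by (simp add: n_def)
  next
    assume I: "?I = B"
    have "(a + y) * (n * b) = 0" for b
    proof -
      have "(a + y) * n = 0" by (simp add: n_def algebra_simps a(2) ya)
      then show ?thesis by (metis mult.assoc mult_zero_left)
    qed
    then have "(*) n ` B \<subseteq> {x. (a + y) * x = 0}" by auto
    moreover have "closed {x. (a + y) * x = 0}"
      by (intro closed_Collect_eq continuous_intros)
    ultimately have "?I \<subseteq> {x. (a + y) * x = 0}" by (rule closure_minimal)
    then have "a + y = 0" using I B'(2) by auto
    then have "- y = a" by (simp add: eq_neg_iff_add_eq_0 add.commute neg_eq_iff_add_eq_0)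
    then show ?thesis using a(1) by simp
  qed
qed

text \<open>Such an element is comparable with every scalar, hence equal to the supremum of the
  scalars below it.\<close>

lemma simple_central_selfadj_scalar:
  assumes B: "simple_cstar_subalgebra B"
    and z: "star z = z" "z \<in> B" "\<And>b. b \<in> B \<Longrightarrow> b * z = z * b"
  shows "\<exists>r. z = r *\<^sub>R 1"
proof -
  have sub: "cstar_subalgebra B" using B by (simp add: simple_cstar_subalgebra_def)
  note B' = cstar_subalgebraD[OF sub]
  have dich: "pos (z - t *\<^sub>R 1) \<or> pos (t *\<^sub>R 1 - z)" for t
    using simple_central_pos_or_neg[OF B, of "z - t *\<^sub>R 1"] z B'
    by (simp add: star_diff star_scaleR algebra_simps)
  let ?T = "{t. pos (z - t *\<^sub>R 1)}"
  have bdd: "t \<le> norm z" if "t \<in> ?T" for t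
  proof -
    have "pos ((z - t *\<^sub>R 1) + (norm z *\<^sub>R 1 - z))"
      using that by (intro pos_add pos_norm_minus z) auto
    then have "pos ((norm z - t) *\<^sub>R (1::'a))" by (simp add: algebra_simps)
    then show ?thesis using pos_scalarRD by force
  qed
  have ne: "- norm z \<in> ?T" using pos_norm_plus[OF z(1), of "norm z"] by (simp add: add.commute)
  define s where "s = Sup ?T"
  have bdd': "bdd_above ?T" using bdd by (intro bdd_aboveI) blast
  have "norm (z - s *\<^sub>R 1) \<le> 3 * e" if e: "e > 0" for e
  proof -
    obtain t where t: "t \<in> ?T" "s - e < t"
    proof (rule less_cSupE[of "s - e" ?T])
      show "s - e < Sup ?T" using e by (simp add: s_def)
      show "?T \<noteq> {}" using ne by blast
    qed
    have ts: "t \<le> s" unfolding s_def using t bdd' by (intro cSup_upper) auto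
    have "s + e \<notin> ?T" using cSup_upper[OF _ bdd', of "s + e"] e unfolding s_def by auto
    then have "pos ((s + e) *\<^sub>R 1 - z)" using dich by blast
    then have "norm (z - t *\<^sub>R 1) \<le> s + e - t"
      using t by (intro norm_le_of_pos) (auto simp: algebra_simps)
    moreover have "z - s *\<^sub>R 1 = (z - t *\<^sub>R 1) - (s - t) *\<^sub>R 1" by (simp add: algebra_simps)
    then have "norm (z - s *\<^sub>R 1) \<le> norm (z - t *\<^sub>R 1) + norm ((s - t) *\<^sub>R (1::'a))"
      by (metis norm_triangle_ineq4)
    ultimately show ?thesis using t ts by simp
  qed
  then have "norm (z - s *\<^sub>R 1) \<le> 0 + e" if "e > 0" for e
    using that by (metis add_0 nonzero_mult_div_cancel_left times_divide_eq_right zero_less_divide_iff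
        zero_less_numeral zero_neq_numeral)
  then have "norm (z - s *\<^sub>R 1) \<le> 0" by (rule field_le_epsilon)
  then show ?thesis by auto
qed

lemma simple_central_scalar:
  assumes B: "simple_cstar_subalgebra B"
    and z: "z \<in> B" "\<And>b. b \<in> B \<Longrightarrow> b * z = z * b"
  shows "\<exists>c. z = c *\<^sub>C 1"
proof -
  have sub: "cstar_subalgebra B" using B by (simp add: simple_cstar_subalgebra_def)
  note B' = cstar_subalgebraD[OF sub]
  have zs: "b * star z = star z * b" if "b \<in> B" for b
    using z(2)[of "star b"] B' that by (metis star_mult star_star)
  have "\<exists>r. re_part z = r *\<^sub>R 1"
  proof (rule simple_central_selfadj_scalar[OF B star_re_part re_part_in[OF sub z(1)]])
    show "b * re_part z = re_part z * b" if "b \<in> B" for b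
      unfolding re_part_def using z(2)[OF that] zs[OF that]
      by (simp only: mult_scaleR_right mult_scaleR_left distrib_left distrib_right)
  qed
  moreover have "\<exists>r. im_part z = r *\<^sub>R 1"
  proof (rule simple_central_selfadj_scalar[OF B star_im_part im_part_in[OF sub z(1)]])
    show "b * im_part z = im_part z * b" if "b \<in> B" for b
      unfolding im_part_def using z(2)[OF that] zs[OF that]
      by (simp only: mult_scaleR_right mult_scaleR_left mult_scaleC_right mult_scaleC_left
          left_diff_distrib right_diff_distrib)
  qed
  ultimately obtain r s where "z = r *\<^sub>R 1 + \<i> *\<^sub>C (s *\<^sub>R 1)" using re_im_decomposition by metis
  then have "z = (complex_of_real r + \<i> * complex_of_real s) *\<^sub>C 1"
    by (simp add: scaleR_scaleC scaleC_scaleC scaleC_add_left)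
  then show ?thesis by blast
qed

section \<open>Conditional expectations of finite index\<close>

lemma cond_expD:
  assumes "cond_exp A B E"
  shows "\<And>x y. x \<in> A \<Longrightarrow> y \<in> A \<Longrightarrow> E (x + y) = E x + E y"
    "\<And>c x. x \<in> A \<Longrightarrow> E (c *\<^sub>C x) = c *\<^sub>C E x"
    "\<And>x. x \<in> A \<Longrightarrow> E x \<in> B" "\<And>b. b \<in> B \<Longrightarrow> E b = b"
    "\<And>b x. b \<in> B \<Longrightarrow> x \<in> A \<Longrightarrow> E (b * x) = b * E x"
    "\<And>b x. b \<in> B \<Longrightarrow> x \<in> A \<Longrightarrow> E (x * b) = E x * b"
  using assms unfolding cond_exp_def linear_onC_def by blast+

locale conditional_expectation =
  fixes A B :: "'a::cstar_algebra set" and E :: "'a \<Rightarrow> 'a"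
  assumes A: "cstar_subalgebra A" and B: "cstar_subalgebra B" and BA: "B \<subseteq> A"
    and E: "cond_exp A B E"
begin

lemmas A_rules = cstar_subalgebraD(2-)[OF A]
lemmas B_rules = cstar_subalgebraD(2-)[OF B]
lemmas E_add = cond_expD(1)[OF E]
lemmas E_scaleC = cond_expD(2)[OF E]
lemmas E_in = cond_expD(3)[OF E]
lemmas E_id = cond_expD(4)[OF E]
lemmas E_left = cond_expD(5)[OF E]
lemmas E_right = cond_expD(6)[OF E]

lemma BA': "b \<in> B \<Longrightarrow> b \<in> A"
  using BA by blast

lemma E_in_A: "x \<in> A \<Longrightarrow> E x \<in> A"
  using E_in BA' by blast

lemma E_scaleR: "x \<in> A \<Longrightarrow> E (r *\<^sub>R x) = r *\<^sub>R E x"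
  by (simp add: scaleR_scaleC E_scaleC)

lemma E_zero: "E 0 = 0"
  using E_id B_rules by simp

lemma E_one: "E 1 = 1"
  using E_id B_rules by simp

lemma E_diff: "x \<in> A \<Longrightarrow> y \<in> A \<Longrightarrow> E (x - y) = E x - E y"
  using E_add[of "x - y" y] A_rules by (simp add: algebra_simps)

lemma E_sum: "(\<And>i. i \<in> I \<Longrightarrow> f i \<in> A) \<Longrightarrow> E (sum f I) = (\<Sum>i\<in>I. E (f i))"
  by (induction I rule: infinite_finite_induct)
    (simp_all add: E_zero E_add cstar_subalgebra_sum[OF A])

lemma E_pos: "x \<in> A \<Longrightarrow> pos x \<Longrightarrow> pos (E x)"
  using pos_positive_in[OF _ A] positive_in_pos E unfolding cond_exp_def by blast

lemma E_pos_star_mult: "x \<in> A \<Longrightarrow> pos (E (star x * x))"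
  using A_rules by (intro E_pos pos_star_mult) auto

text \<open>Both \<open>norm x - x\<close> and \<open>norm x + x\<close> are positive, and so are their images. Self-adjointness of
  \<open>E x\<close> and boundedness of \<open>E\<close> are thus consequences of positivity.\<close>

lemma E_selfadj:
  assumes "x \<in> A" "star x = x"
  shows "star (E x) = E x" "norm (E x) \<le> 3 * norm x"
proof -
  have "pos (E (norm x *\<^sub>R 1 + x))" "pos (E (norm x *\<^sub>R 1 - x))"
    using assms A_rules by (auto intro!: E_pos pos_norm_plus pos_norm_minus)
  then have p: "pos (norm x *\<^sub>R 1 + E x)" "pos (norm x *\<^sub>R 1 - E x)"
    using assms A_rules by (simp_all add: E_add E_diff E_scaleR E_one)
  from pos_selfadj[OF p(1)] show "star (E x) = E x" by (simp add: star_add star_scaleR)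
  have "pos ((2 * norm x) *\<^sub>R 1 - (norm x *\<^sub>R 1 + E x))"
  proof -
    have "(2 * norm x) *\<^sub>R 1 - (norm x *\<^sub>R 1 + E x) = norm x *\<^sub>R 1 - E x"
      by (simp only: mult_2 scaleR_add_left add_diff_cancel_left)
    then show ?thesis using p(2) by (simp only:)
  qed
  then have "norm (norm x *\<^sub>R 1 + E x) \<le> 2 * norm x" by (rule norm_le_of_pos[OF p(1)])
  then have "norm (norm x *\<^sub>R 1 + E x) + norm (norm x *\<^sub>R (1::'a)) \<le> 3 * norm x" by simp
  moreover have "E x = (norm x *\<^sub>R 1 + E x) - norm x *\<^sub>R 1" by simp
  ultimately show "norm (E x) \<le> 3 * norm x" by (metis norm_triangle_ineq4 order_trans)
qed

lemma E_re_im: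
  assumes "x \<in> A" shows "E x = E (re_part x) + \<i> *\<^sub>C E (im_part x)"
  using E_add[of "re_part x" "\<i> *\<^sub>C im_part x"] E_scaleC A_rules assms
    re_part_in[OF A] im_part_in[OF A] re_im_decomposition[of x] by simp

lemma E_star:
  assumes "x \<in> A" shows "E (star x) = star (E x)"
proof -
  note parts = re_part_in[OF A assms] im_part_in[OF A assms]
  have "star x = re_part x + (- \<i>) *\<^sub>C im_part x"
    using arg_cong[OF re_im_decomposition[of x], of star]
    by (simp add: star_add star_scaleC star_re_part star_im_part)
  then have "E (star x) = E (re_part x) + (- \<i>) *\<^sub>C E (im_part x)"
    using parts A_rules E_add E_scaleC by metis
  then show ?thesis
    unfolding E_re_im[OF assms]
    by (simp add: star_add star_scaleC E_selfadj(1)[OF parts(1) star_re_part]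
        E_selfadj(1)[OF parts(2) star_im_part])
qed

lemma E_bounded:
  assumes "x \<in> A" shows "norm (E x) \<le> 6 * norm x"
proof -
  note parts = re_part_in[OF A assms] im_part_in[OF A assms]
  have "norm (E x) \<le> norm (E (re_part x)) + norm (E (im_part x))"
    using norm_triangle_ineq[of "E (re_part x)" "\<i> *\<^sub>C E (im_part x)"] E_re_im[OF assms]
    by (simp add: norm_scaleC)
  then show ?thesis
    using E_selfadj(2)[OF parts(1) star_re_part] E_selfadj(2)[OF parts(2) star_im_part]
      norm_re_part[of x] norm_im_part[of x] by linarith
qed

lemma E_tendsto:
  assumes "\<And>n::nat. f n \<in> A" "f \<longlonglongrightarrow> x" shows "(\<lambda>n. E (f n)) \<longlonglongrightarrow> E x"
proof -
  have x: "x \<in> A" using closed_sequentially[OF cstar_subalgebraD(1)[OF A]] assms by blast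
  have "(\<lambda>n. norm (f n - x)) \<longlonglongrightarrow> 0" using assms(2) by (simp add: LIM_zero tendsto_norm_zero)
  then have "(\<lambda>n. 6 * norm (f n - x)) \<longlonglongrightarrow> 0" by (rule tendsto_mult_right_zero)
  then have "(\<lambda>n. E (f n) - E x) \<longlonglongrightarrow> 0"
  proof (rule Lim_null_comparison[rotated], intro always_eventually allI)
    fix n
    show "norm (E (f n) - E x) \<le> 6 * norm (f n - x)"
      using E_bounded[of "f n - x"] assms(1) x A_rules by (simp add: E_diff)
  qed
  then show ?thesis by (rule LIM_zero_cancel)
qed

text \<open>As in the proof of the Cauchy-Schwarz inequality, evaluate the expectation of \<open>star y * y\<close> at
  \<open>y = x - (1/g) v f\<close> where \<open>f = E (star v * x)\<close>.\<close>

lemma E_Cauchy_Schwarz: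
  assumes x: "x \<in> A" and v: "v \<in> A" and k: "E (star x * x) = k *\<^sub>R 1"
  shows "(norm (E (star v * x)))\<^sup>2 \<le> (1 + norm (E (star v * v))) * k"
proof -
  define f where "f = E (star v * x)"
  define G where "G = E (star v * v)"
  define g where "g = 1 + norm G"
  have g: "g > 0" by (simp add: g_def add_pos_nonneg)
  note rules = A_rules E_in BA' x v
  have f: "f \<in> B" "f \<in> A" "star f \<in> B" "star f \<in> A" using rules B_rules by (auto simp: f_def)
  have fx: "E (star x * v) = star f"
    using rules E_star[of "star v * x"] by (simp add: f_def star_mult star_star)
  define y where "y = x - (1/g) *\<^sub>R (v * f)"
  have y: "y \<in> A" using rules f by (simp add: y_def)
  have "star y * y = star x * x - (1/g) *\<^sub>R ((star x * v) * f) - (1/g) *\<^sub>R (star f * (star v * x))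
      + (1/g * (1/g)) *\<^sub>R (star f * (star v * v) * f)"
    by (simp add: y_def star_diff star_scaleR star_mult algebra_simps)
  then have "E (star y * y) = k *\<^sub>R 1 - (1/g) *\<^sub>R (star f * f) - (1/g) *\<^sub>R (star f * f)
      + (1/g * (1/g)) *\<^sub>R (star f * G * f)"
    using rules f k
    by (simp add: E_diff E_add E_scaleR E_left E_right fx f_def[symmetric] G_def[symmetric])
  then have p1: "pos (k *\<^sub>R 1 - (1/g) *\<^sub>R (star f * f) - (1/g) *\<^sub>R (star f * f)
      + (1/g * (1/g)) *\<^sub>R (star f * G * f))"
    using E_pos_star_mult[OF y] by simp
  have "star G = G" using rules E_star[of "star v * v"] by (simp add: G_def star_mult star_star)
  then have "pos (star f * (g *\<^sub>R 1 - G) * f)"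
    by (intro pos_conj pos_norm_minus) (simp_all add: g_def)
  then have "pos ((1/g * (1/g)) *\<^sub>R (star f * (g *\<^sub>R 1 - G) * f))" using g by (intro pos_scaleR) auto
  also have "(1/g * (1/g)) *\<^sub>R (star f * (g *\<^sub>R 1 - G) * f)
      = (1/g) *\<^sub>R (star f * f) - (1/g * (1/g)) *\<^sub>R (star f * G * f)"
    using g by (simp add: algebra_simps)
  finally have p2: "pos ((1/g) *\<^sub>R (star f * f) - (1/g * (1/g)) *\<^sub>R (star f * G * f))" .
  have "pos (k *\<^sub>R 1 - (1/g) *\<^sub>R (star f * f))"
    using pos_add[OF p1 p2] by simp
  then have "norm ((1/g) *\<^sub>R (star f * f)) \<le> k"
    using g by (intro norm_le_of_pos pos_scaleR pos_star_mult) auto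
  then show ?thesis
    using g by (simp add: cstar_identity f_def[symmetric] G_def[symmetric] g_def[symmetric] field_simps)
qed

end

lemma rel_commutantD: "x \<in> rel_commutant C D \<Longrightarrow> x \<in> D"
  "x \<in> rel_commutant C D \<Longrightarrow> c \<in> C \<Longrightarrow> c * x = x * c"
  by (auto simp: rel_commutant_def)

lemma rel_commutantI: "x \<in> D \<Longrightarrow> (\<And>c. c \<in> C \<Longrightarrow> c * x = x * c) \<Longrightarrow> x \<in> rel_commutant C D"
  by (auto simp: rel_commutant_def)

lemma rel_commutant_closed:
  assumes D: "cstar_subalgebra D" and C: "\<forall>c\<in>C. star c \<in> C"
  shows "1 \<in> rel_commutant C D" "0 \<in> rel_commutant C D"
    "\<And>x y. x \<in> rel_commutant C D \<Longrightarrow> y \<in> rel_commutant C D \<Longrightarrow> x + y \<in> rel_commutant C D"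
    "\<And>x y. x \<in> rel_commutant C D \<Longrightarrow> y \<in> rel_commutant C D \<Longrightarrow> x - y \<in> rel_commutant C D"
    "\<And>x y. x \<in> rel_commutant C D \<Longrightarrow> y \<in> rel_commutant C D \<Longrightarrow> x * y \<in> rel_commutant C D"
    "\<And>a x. x \<in> rel_commutant C D \<Longrightarrow> a *\<^sub>C x \<in> rel_commutant C D"
    "\<And>r x. x \<in> rel_commutant C D \<Longrightarrow> r *\<^sub>R x \<in> rel_commutant C D"
    "\<And>x. x \<in> rel_commutant C D \<Longrightarrow> star x \<in> rel_commutant C D"
proof -
  note D' = cstar_subalgebraD[OF D]
  let ?R = "rel_commutant C D"
  note rD = rel_commutantD[where C = C and D = D]
  show "1 \<in> ?R" "0 \<in> ?R" using D' by (auto intro: rel_commutantI)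
  fix x assume x: "x \<in> ?R"
  show "a *\<^sub>C x \<in> ?R" for a
    using D'(8) rD[OF x] by (auto intro!: rel_commutantI simp: mult_scaleC_left mult_scaleC_right)
  then show "r *\<^sub>R x \<in> ?R" for r by (simp add: scaleR_scaleC)
  show "star x \<in> ?R"
  proof (rule rel_commutantI)
    show "star x \<in> D" by (rule D'(10)[OF rD(1)[OF x]])
    show "c * star x = star x * c" if "c \<in> C" for c
      using rD(2)[OF x C[rule_format, OF that]] by (metis star_mult star_star)
  qed
  fix y assume y: "y \<in> ?R"
  show "x + y \<in> ?R" "x - y \<in> ?R"
    using D'(4,6) rD(1)[OF x] rD(1)[OF y] rD(2)[OF x] rD(2)[OF y]
    by (auto intro!: rel_commutantI simp: distrib_left distrib_right left_diff_distrib right_diff_distrib)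
  show "x * y \<in> ?R"
  proof (rule rel_commutantI)
    show "x * y \<in> D" by (rule D'(5)[OF rD(1)[OF x] rD(1)[OF y]])
    show "c * (x * y) = x * y * c" if "c \<in> C" for c
      by (metis rD(2)[OF x that] rD(2)[OF y that] mult.assoc)
  qed
qed

text \<open>Since \<open>B\<close> has trivial centre, \<open>E\<close> restricts to a state \<open>tr\<close> on the relative commutant.
  The index set of the quasi-basis \<open>u\<close> is arbitrary because the composite of two expectations
  has a quasi-basis indexed by pairs.\<close>

locale finite_index_expectation = conditional_expectation A B E
  for A B :: "'a::cstar_algebra set" and E :: "'a \<Rightarrow> 'a" +
  fixes I :: "'i set" and u :: "'i \<Rightarrow> 'a"
  assumes fin: "finite I" and u: "\<And>i. i \<in> I \<Longrightarrow> u i \<in> A"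
    and basis: "\<And>x. x \<in> A \<Longrightarrow> (\<Sum>i\<in>I. u i * E (star (u i) * x)) = x"
    and center: "\<And>z. z \<in> B \<Longrightarrow> (\<And>b. b \<in> B \<Longrightarrow> b * z = z * b) \<Longrightarrow> \<exists>c. z = c *\<^sub>C 1"
begin

abbreviation N where "N \<equiv> rel_commutant B A"

definition tr :: "'a \<Rightarrow> complex" where "tr x = (THE c. E x = c *\<^sub>C 1)"

text \<open>At \<open>1\<close> this is the Watatani index.\<close>

definition index_map :: "'a \<Rightarrow> 'a" where "index_map x = (\<Sum>i\<in>I. u i * x * star (u i))"

lemma star_B: "\<forall>b\<in>B. star b \<in> B"
  using B_rules(9) by simp

lemmas N_rules = rel_commutant_closed[OF A star_B]
lemmas N_A = rel_commutantD(1)[where C = B and D = A]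
lemmas N_comm = rel_commutantD(2)[where C = B and D = A]

lemma basis_right:
  assumes "x \<in> A" shows "(\<Sum>i\<in>I. E (x * u i) * star (u i)) = x"
proof -
  have "star (\<Sum>i\<in>I. u i * E (star (u i) * star x)) = x"
    using basis[of "star x"] assms A_rules by (simp add: star_star)
  moreover have "E (star (u i) * star x) = star (E (x * u i))" if "i \<in> I" for i
    using E_star[of "x * u i"] u[OF that] assms A_rules by (simp add: star_mult)
  ultimately show ?thesis by (simp add: star_sum star_mult star_star)
qed

lemma E_N:
  assumes "x \<in> N" shows "E x = tr x *\<^sub>C 1"
proof -
  have "\<exists>c. E x = c *\<^sub>C 1"
  proof (rule center)
    show "E x \<in> B" using E_in N_A assms by blast
    show "b * E x = E x * b" if "b \<in> B" for b
      using E_left[OF that N_A[OF assms]] E_right[OF that N_A[OF assms]] N_comm[OF assms that] by simp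
  qed
  then obtain c where c: "E x = c *\<^sub>C 1" ..
  have "tr x = c" unfolding tr_def
    by (rule the_equality[where P = "\<lambda>c. E x = c *\<^sub>C 1", OF c]) (simp add: c)
  then show ?thesis by (simp add: c)
qed

lemma tr_eqI: "x \<in> N \<Longrightarrow> E x = c *\<^sub>C 1 \<Longrightarrow> tr x = c"
  using E_N[of x] by simp

lemma tr_add: "x \<in> N \<Longrightarrow> y \<in> N \<Longrightarrow> tr (x + y) = tr x + tr y"
  by (rule tr_eqI, simp add: N_rules) (simp add: E_add N_A E_N scaleC_add_left)

lemma tr_scaleC: "x \<in> N \<Longrightarrow> tr (c *\<^sub>C x) = c * tr x"
  by (rule tr_eqI, simp add: N_rules) (simp add: E_scaleC N_A E_N scaleC_scaleC)

lemma tr_scaleR: "x \<in> N \<Longrightarrow> tr (r *\<^sub>R x) = of_real r * tr x"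
  by (simp add: scaleR_scaleC tr_scaleC)

lemma tr_one: "tr 1 = 1"
  by (rule tr_eqI, simp add: N_rules) (simp add: E_one)

lemma tr_zero: "tr 0 = 0"
  by (rule tr_eqI, simp add: N_rules) (simp add: E_zero)

lemma tr_star: "x \<in> N \<Longrightarrow> tr (star x) = cnj (tr x)"
  by (rule tr_eqI, simp add: N_rules) (simp add: E_star N_A E_N star_scaleC)

lemma tr_diff: "x \<in> N \<Longrightarrow> y \<in> N \<Longrightarrow> tr (x - y) = tr x - tr y"
  by (rule tr_eqI, simp add: N_rules) (simp add: E_diff N_A E_N complex_vector.scale_left_diff_distrib)

lemma N_sum: "(\<And>j. j \<in> J \<Longrightarrow> f j \<in> N) \<Longrightarrow> sum f J \<in> N"
  by (induction J rule: infinite_finite_induct) (simp_all add: N_rules)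

lemma tr_sum: "(\<And>j. j \<in> J \<Longrightarrow> f j \<in> N) \<Longrightarrow> tr (sum f J) = (\<Sum>j\<in>J. tr (f j))"
  by (induction J rule: infinite_finite_induct) (simp_all add: N_rules tr_add tr_zero N_sum)

lemma tr_pos:
  assumes "x \<in> N" "pos x" shows "tr x = of_real (Re (tr x))" "0 \<le> Re (tr x)"
proof -
  have "pos (tr x *\<^sub>C (1::'a))" using E_pos[OF N_A[OF assms(1)] assms(2)] E_N assms(1) by simp
  from pos_scalarD[OF this] show "tr x = of_real (Re (tr x))" "0 \<le> Re (tr x)"
    by (auto simp: complex_eq_iff)
qed

text \<open>Faithfulness of \<open>tr\<close>: by the Cauchy--Schwarz inequality every coefficient of \<open>w\<close> in the
  quasi-basis vanishes.\<close>

lemma tr_faithful: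
  assumes w: "w \<in> N" and "tr (star w * w) = 0" shows "w = 0"
proof -
  have wA: "w \<in> A" using N_A w by blast
  have "E (star w * w) = 0 *\<^sub>R 1" using E_N[of "star w * w"] assms N_rules by simp
  then have "(norm (E (star (u i) * w)))\<^sup>2 \<le> 0" if "i \<in> I" for i
    using E_Cauchy_Schwarz[OF wA u[OF that], of 0] by simp
  then have "E (star (u i) * w) = 0" if "i \<in> I" for i using that by simp
  then show ?thesis using basis[OF wA] by simp
qed

lemma E_nondegenerate:
  assumes "z \<in> A" "\<And>a. a \<in> A \<Longrightarrow> E (a * z) = 0" shows "z = 0"
  using basis[OF assms(1)] assms(2) u A_rules by simp

text \<open>The modular automorphism of \<open>E\<close> on the relative commutant: it corrects the failure of
  \<open>E (y * a) = E (a * y)\<close>. Every map \<open>f : A \<rightarrow> B\<close> that is linear over \<open>B\<close> from the left has the form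
  \<open>f a = E (a * z)\<close> with \<open>z = (\<Sum>i. u i * f (star (u i)))\<close>; here \<open>f a = E (y * a)\<close>.\<close>

definition modular :: "'a \<Rightarrow> 'a" where
  "modular y = (\<Sum>i\<in>I. u i * E (y * star (u i)))"

lemma E_modular:
  assumes y: "y \<in> N" and a: "a \<in> A" shows "E (y * a) = E (a * modular y)"
proof -
  note yA = N_A[OF y]
  have "E (a * modular y) = (\<Sum>i\<in>I. E (a * u i * E (y * star (u i))))"
    unfolding modular_def sum_distrib_left
    by (subst E_sum) (use a yA u A_rules E_in_A in \<open>auto simp: mult.assoc\<close>)
  also have "\<dots> = (\<Sum>i\<in>I. E (y * (E (a * u i) * star (u i))))"
  proof (rule sum.cong[OF refl])
    fix i assume i: "i \<in> I"
    note rules = a yA u[OF i] A_rules E_in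
    have "E (a * u i * E (y * star (u i))) = E (a * u i) * E (y * star (u i))"
      using rules by (intro E_right) auto
    also have "\<dots> = E (E (a * u i) * (y * star (u i)))" using rules by (intro E_left[symmetric]) auto
    also have "E (a * u i) * (y * star (u i)) = y * (E (a * u i) * star (u i))"
      using N_comm[OF y, of "E (a * u i)"] rules by (simp add: mult.assoc[symmetric])
    finally show "E (a * u i * E (y * star (u i))) = E (y * (E (a * u i) * star (u i)))" .
  qed
  also have "\<dots> = E (y * (\<Sum>i\<in>I. E (a * u i) * star (u i)))"
    unfolding sum_distrib_left by (subst E_sum) (use a yA u A_rules E_in_A in auto)
  finally show ?thesis using basis_right[OF a] by simp
qed

lemma modular_in_N:
  assumes y: "y \<in> N" shows "modular y \<in> N"
proof (rule rel_commutantI)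
  note yA = N_A[OF y]
  show mA: "modular y \<in> A"
    unfolding modular_def by (intro cstar_subalgebra_sum[OF A]) (use yA u A_rules E_in_A in auto)
  show "b * modular y = modular y * b" if b: "b \<in> B" for b
  proof -
    note bA = BA'[OF b]
    have zero: "E (a * (b * modular y - modular y * b)) = 0" if a: "a \<in> A" for a
    proof -
      have "E (a * (b * modular y - modular y * b)) = E ((a * b) * modular y) - E (a * modular y) * b"
        using a bA mA b A_rules
        by (simp add: right_diff_distrib E_diff E_right flip: mult.assoc)
      also have "\<dots> = E (y * a * b) - E (y * a) * b"
        using E_modular[OF y, of "a * b"] E_modular[OF y a] a bA A_rules by (simp add: mult.assoc)
      also have "\<dots> = 0" using a b yA A_rules by (simp add: E_right)
      finally show ?thesis .
    qed
    have "b * modular y - modular y * b \<in> A" using bA mA by (simp add: A_rules)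
    then have "b * modular y - modular y * b = 0" by (rule E_nondegenerate[OF _ zero])
    then show ?thesis by simp
  qed
qed

text \<open>Expand \<open>y * star (u i)\<close> in the quasi-basis and move \<open>y\<close> to the other side of the
  coefficients by means of the modular automorphism.\<close>

lemma index_map_modular:
  assumes x: "x \<in> N" and y: "y \<in> N"
  shows "index_map (x * y) = index_map (modular y * x)"
proof -
  note xA = N_A[OF x] and yA = N_A[OF y] and mA = N_A[OF modular_in_N[OF y]]
  have "index_map (x * y) = (\<Sum>i\<in>I. u i * x * (\<Sum>j\<in>I. E (y * (star (u i) * u j)) * star (u j)))"
    unfolding index_map_def
  proof (rule sum.cong[OF refl])
    fix i assume "i \<in> I"
    then have "(\<Sum>j\<in>I. E (y * (star (u i) * u j)) * star (u j)) = y * star (u i)"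
      using basis_right[of "y * star (u i)"] yA u A_rules by (simp add: mult.assoc)
    then show "u i * (x * y) * star (u i)
        = u i * x * (\<Sum>j\<in>I. E (y * (star (u i) * u j)) * star (u j))"
      by (simp add: mult.assoc)
  qed
  also have "\<dots> = (\<Sum>i\<in>I. \<Sum>j\<in>I. u i * E (star (u i) * (u j * modular y)) * (x * star (u j)))"
    unfolding sum_distrib_left
  proof (intro sum.cong refl)
    fix i j assume ij: "i \<in> I" "j \<in> I"
    have "E (y * (star (u i) * u j)) = E (star (u i) * (u j * modular y))"
      using E_modular[OF y, of "star (u i) * u j"] u ij A_rules by (simp add: mult.assoc)
    moreover have "E (y * (star (u i) * u j)) * x = x * E (y * (star (u i) * u j))"
      using N_comm[OF x, of "E (y * (star (u i) * u j))"] u ij A_rules yA E_in by simp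
    ultimately show "u i * x * (E (y * (star (u i) * u j)) * star (u j))
        = u i * E (star (u i) * (u j * modular y)) * (x * star (u j))"
      by (metis mult.assoc)
  qed
  also have "\<dots> = (\<Sum>j\<in>I. (\<Sum>i\<in>I. u i * E (star (u i) * (u j * modular y))) * (x * star (u j)))"
    unfolding sum_distrib_right by (rule sum.swap)
  also have "\<dots> = (\<Sum>j\<in>I. u j * modular y * (x * star (u j)))"
    using u mA A_rules by (intro sum.cong refl) (simp add: basis)
  finally show ?thesis by (simp add: index_map_def mult.assoc)
qed

text \<open>If the index map is a multiple of \<open>E\<close> on the relative commutant, then the square of the modular
  automorphism is trivial. It is a positive operator for the inner product of \<open>tr\<close>, hence
  itself trivial. This is the step where minimality of an expectation becomes a trace
  property.\<close>

lemma central_if_index_map_scalar: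
  assumes index: "\<And>x. x \<in> N \<Longrightarrow> index_map x = k *\<^sub>R E x" and k: "k \<noteq> 0"
    and y: "y \<in> N" and a: "a \<in> A"
  shows "E (y * a) = E (a * y)"
proof -
  have swap: "E (x * z) = E (modular z * x)" if "x \<in> N" "z \<in> N" for x z
    using index_map_modular[OF that] index k N_rules modular_in_N that by simp
  define w where "w = modular y - y"
  note mN = modular_in_N[OF y]
  have w: "w \<in> N" using mN y N_rules by (simp add: w_def)
  have mm: "modular (modular y) = y"
  proof -
    define d where "d = modular (modular y) - y"
    have d: "d \<in> N" using modular_in_N[OF mN] y N_rules by (simp add: d_def)
    have "E (d * x) = 0" if x: "x \<in> N" for x
    proof -
      have "E (modular (modular y) * x) = E (x * modular y)" using swap[OF x mN] by simp
      also have "\<dots> = E (y * x)" using E_modular[OF y N_A[OF x]] by simp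
      finally show ?thesis
        using N_A[OF x] N_A[OF y] N_A[OF modular_in_N[OF mN]] A_rules
        by (simp add: d_def left_diff_distrib E_diff)
    qed
    then have "E (star (star d) * star d) = 0" using d N_rules by (simp add: star_star)
    then have "star d = 0"
      using d N_rules E_N[of "star (star d) * star d"] by (intro tr_faithful) auto
    then show ?thesis by (metis d_def eq_iff_diff_eq_0 star_star star_zero)
  qed
  have "modular w = - w"
  proof -
    have "modular w + modular y = modular (w + y)"
      unfolding modular_def sum.distrib[symmetric] using N_A[OF w] N_A[OF y] u A_rules
      by (intro sum.cong refl) (simp add: distrib_right distrib_left E_add)
    then show ?thesis by (simp add: w_def mm algebra_simps)
  qed
  then have "E (w * star w) = - E (star w * w)"
    using E_modular[OF w, of "star w"] N_A[OF w] A_rules E_scaleC[of "star w * w" "- 1"] by simp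
  moreover have "pos (E (w * star w))"
    using E_pos_star_mult[of "star w"] N_A[OF w] A_rules by (simp add: star_star)
  moreover have "pos (E (star w * w))" using E_pos_star_mult N_A[OF w] by simp
  ultimately have "E (star w * w) = 0" using pos_antisym by simp
  then have "w = 0" using w N_rules E_N[of "star w * w"] by (intro tr_faithful) auto
  then show ?thesis using E_modular[OF y a] by (simp add: w_def)
qed

text \<open>The difference is the expectation of \<open>star (v - p) * (v - p)\<close> for the orthogonal projection
  \<open>p\<close> of \<open>v\<close>.\<close>

lemma Bessel:
  fixes x :: "'j \<Rightarrow> 'a"
  assumes J: "finite J" and x: "\<And>j. j \<in> J \<Longrightarrow> x j \<in> N"
    and orth: "\<And>i j. i \<in> J \<Longrightarrow> j \<in> J \<Longrightarrow> tr (star (x i) * x j) = (if i = j then 1 else 0)"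
    and v: "v \<in> A"
  shows "pos (E (star v * v) - (\<Sum>j\<in>J. E (star v * x j) * E (star (x j) * v)))"
proof -
  define f where "f j = E (star (x j) * v)" for j
  note rules = A_rules v E_in BA'
  have xA: "x j \<in> A" if "j \<in> J" for j using x N_A that by blast
  have f: "f j \<in> B" "f j \<in> A" "star (f j) \<in> B" "star (f j) \<in> A" if "j \<in> J" for j
    using rules xA[OF that] B_rules by (auto simp: f_def)
  have fx: "E (star v * x j) = star (f j)" if "j \<in> J" for j
    using rules xA[OF that] E_star[of "star (x j) * v"] by (simp add: f_def star_mult star_star)
  define p where "p = (\<Sum>j\<in>J. x j * f j)"
  have p: "p \<in> A" unfolding p_def using xA f A_rules by (intro cstar_subalgebra_sum[OF A]) auto
  have vp: "E (star v * p) = (\<Sum>j\<in>J. star (f j) * f j)"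
    unfolding p_def sum_distrib_left
    by (subst E_sum) (use rules xA f in \<open>auto simp: mult.assoc[symmetric] E_right fx intro!: sum.cong\<close>)
  have pv: "E (star p * v) = (\<Sum>j\<in>J. star (f j) * f j)"
    unfolding p_def star_sum star_mult sum_distrib_right
    by (subst E_sum) (use rules xA f in \<open>auto simp: mult.assoc E_left f_def[symmetric] intro!: sum.cong\<close>)
  have pp: "E (star p * p) = (\<Sum>j\<in>J. star (f j) * f j)"
  proof -
    have "star p * p = (\<Sum>i\<in>J. \<Sum>j\<in>J. star (f i) * (star (x i) * x j) * f j)"
      by (simp add: p_def star_sum sum_product star_mult mult.assoc)
    then have "E (star p * p) = (\<Sum>i\<in>J. \<Sum>j\<in>J. E (star (f i) * (star (x i) * x j) * f j))"
      using rules xA f by (simp add: E_sum cstar_subalgebra_sum[OF A])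
    also have "\<dots> = (\<Sum>i\<in>J. \<Sum>j\<in>J. if i = j then star (f i) * f j else 0)"
    proof (intro sum.cong refl)
      fix i j assume ij: "i \<in> J" "j \<in> J"
      have "star (x i) * x j \<in> N" using x ij by (simp add: N_rules)
      then have "E (star (x i) * x j) = (if i = j then 1 else 0)" using E_N orth ij by auto
      moreover have "E (star (f i) * (star (x i) * x j) * f j) = star (f i) * E (star (x i) * x j) * f j"
        using rules xA f ij by (simp add: E_left E_right)
      ultimately show "E (star (f i) * (star (x i) * x j) * f j)
          = (if i = j then star (f i) * f j else 0)" by simp
    qed
    also have "\<dots> = (\<Sum>j\<in>J. star (f j) * f j)" using J by (simp add: sum.delta)
    finally show ?thesis .
  qed
  have "star (v - p) * (v - p) = star v * v - star v * p - star p * v + star p * p"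
    by (simp add: star_diff algebra_simps)
  then have "E (star (v - p) * (v - p)) = E (star v * v) - (\<Sum>j\<in>J. star (f j) * f j)"
    using rules p by (simp add: E_diff E_add vp pv pp)
  then have "pos (E (star v * v) - (\<Sum>j\<in>J. star (f j) * f j))"
    using E_pos_star_mult[of "v - p"] rules p by simp
  then show ?thesis by (simp add: fx f_def)
qed

text \<open>Summing Bessel's inequality over the quasi-basis bounds the size of orthonormal
  families; the trace property permits exchanging \<open>star x * x\<close> and \<open>x * star x\<close>.\<close>

lemma orthonormal_card_bound:
  fixes x :: "'j \<Rightarrow> 'a"
  assumes central: "\<And>y a. y \<in> N \<Longrightarrow> a \<in> A \<Longrightarrow> E (y * a) = E (a * y)"
    and J: "finite J" and x: "\<And>j. j \<in> J \<Longrightarrow> x j \<in> N"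
    and orth: "\<And>i j. i \<in> J \<Longrightarrow> j \<in> J \<Longrightarrow> tr (star (x i) * x j) = (if i = j then 1 else 0)"
  shows "real (card J) \<le> norm (\<Sum>i\<in>I. E (u i * star (u i)))"
proof -
  let ?G = "\<Sum>i\<in>I. E (u i * star (u i))"
  have xA: "x j \<in> A" if "j \<in> J" for j using x N_A that by blast
  have expand: "(\<Sum>i\<in>I. E (u i * x j) * E (star (x j) * star (u i))) = 1" if j: "j \<in> J" for j
  proof -
    note rules = xA[OF j] A_rules E_in E_in_A
    have "x j * star (x j) = (\<Sum>i\<in>I. x j * u i * E (star (u i) * star (x j)))"
      using basis[of "star (x j)"] rules by (simp add: sum_distrib_left[symmetric] mult.assoc)
    then have "E (x j * star (x j)) = (\<Sum>i\<in>I. E (x j * u i * E (star (u i) * star (x j))))"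
      using rules u by (simp add: E_sum)
    also have "\<dots> = (\<Sum>i\<in>I. E (u i * x j) * E (star (x j) * star (u i)))"
    proof (rule sum.cong[OF refl])
      fix i assume i: "i \<in> I"
      have "E (x j * u i) = E (u i * x j)" using central x j u i by blast
      moreover have "E (star (u i) * star (x j)) = E (star (x j) * star (u i))"
        using central[of "star (x j)" "star (u i)"] x[OF j] u[OF i] N_rules A_rules by simp
      ultimately show "E (x j * u i * E (star (u i) * star (x j)))
          = E (u i * x j) * E (star (x j) * star (u i))"
        using rules u[OF i] by (simp add: E_right)
    qed
    finally have "E (x j * star (x j)) = (\<Sum>i\<in>I. E (u i * x j) * E (star (x j) * star (u i)))" .
    moreover have "E (x j * star (x j)) = E (star (x j) * x j)"
      using central[OF x[OF j]] rules by simp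
    moreover have "star (x j) * x j \<in> N" using x[OF j] by (simp add: N_rules)
    ultimately show ?thesis using E_N orth[OF j j] by simp
  qed
  have "pos (\<Sum>i\<in>I. E (u i * star (u i)) - (\<Sum>j\<in>J. E (u i * x j) * E (star (x j) * star (u i))))"
  proof (rule pos_sum)
    fix i assume "i \<in> I"
    then show "pos (E (u i * star (u i)) - (\<Sum>j\<in>J. E (u i * x j) * E (star (x j) * star (u i))))"
      using Bessel[OF J x orth, of "star (u i)"] u A_rules by (simp add: star_star)
  qed
  also have "(\<Sum>i\<in>I. E (u i * star (u i)) - (\<Sum>j\<in>J. E (u i * x j) * E (star (x j) * star (u i))))
      = ?G - (\<Sum>j\<in>J. \<Sum>i\<in>I. E (u i * x j) * E (star (x j) * star (u i)))"
    unfolding sum_subtractf by (subst sum.swap) (rule refl)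
  also have "\<dots> = ?G - real (card J) *\<^sub>R 1"
    by (simp add: expand scaleR_conv_of_real)
  finally have "pos (?G - real (card J) *\<^sub>R 1)" .
  moreover have "star ?G = ?G"
    unfolding star_sum using u A_rules
    by (intro sum.cong refl) (simp add: E_star[symmetric] star_mult star_star)
  then have "pos (norm ?G *\<^sub>R 1 - ?G)" by (rule pos_norm_minus) simp
  ultimately have "pos ((norm ?G - real (card J)) *\<^sub>R (1::'a))"
    using pos_add by (fastforce simp: scaleR_diff_left)
  then show ?thesis using pos_scalarRD by force
qed

end

lemma cstar_subalgebra_rel_commutant:
  assumes "cstar_subalgebra D" "\<forall>c\<in>C. star c \<in> C"
  shows "cstar_subalgebra (rel_commutant C D)"
proof -
  have "rel_commutant C D = D \<inter> (\<Inter>c\<in>C. {x. c * x = x * c})"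
    by (auto simp: rel_commutant_def)
  moreover have "closed {x::'a. c * x = x * c}" for c
    by (intro closed_Collect_eq continuous_intros)
  ultimately have "closed (rel_commutant C D)"
    using cstar_subalgebraD(1)[OF assms(1)] by (simp add: closed_Int closed_INT)
  then show ?thesis
    unfolding cstar_subalgebra_def by (simp add: rel_commutant_closed[OF assms])
qed

lemma sum_list_conv_sum_nth: "(\<Sum>l\<leftarrow>ms. f l :: 'b::comm_monoid_add) = (\<Sum>i<length ms. f (ms ! i))"
  by (simp add: sum_list_sum_nth atLeast0LessThan)

context finite_index_expectation
begin

text \<open>An orthonormal family of maximal size, which exists by the bound, spans the relative
  commutant: otherwise the normalized rest of some element could be added to it.\<close>

lemma orthonormal_basis:
  assumes central: "\<And>y a. y \<in> N \<Longrightarrow> a \<in> A \<Longrightarrow> E (y * a) = E (a * y)"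
  obtains m :: nat and x :: "nat \<Rightarrow> 'a" where "\<And>j. j < m \<Longrightarrow> x j \<in> N"
    "\<And>i j. i < m \<Longrightarrow> j < m \<Longrightarrow> tr (star (x i) * x j) = (if i = j then 1 else 0)"
    "\<And>y. y \<in> N \<Longrightarrow> y = (\<Sum>j<m. tr (star (x j) * y) *\<^sub>C x j)"
proof -
  define P where "P m \<longleftrightarrow> (\<exists>x::nat \<Rightarrow> 'a. (\<forall>j<m. x j \<in> N) \<and>
    (\<forall>i<m. \<forall>j<m. tr (star (x i) * x j) = (if i = j then 1 else 0)))" for m
  have P0: "P 0" by (simp add: P_def)
  have bounded: "m \<le> nat \<lceil>norm (\<Sum>i\<in>I. E (u i * star (u i)))\<rceil>" if m: "P m" for m
  proof -
    obtain x :: "nat \<Rightarrow> 'a" where x: "\<forall>j<m. x j \<in> N"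
      "\<forall>i<m. \<forall>j<m. tr (star (x i) * x j) = (if i = j then 1 else 0)"
      using m unfolding P_def by blast
    have "real (card {..<m}) \<le> norm (\<Sum>i\<in>I. E (u i * star (u i)))"
      by (rule orthonormal_card_bound[OF central, of "{..<m}" x]) (use x in auto)
    then show ?thesis by (simp add: le_nat_iff le_ceiling_iff)
  qed
  obtain m where m: "P m" "\<And>k. P k \<Longrightarrow> k \<le> m"
    using GreatestI_nat[of P, OF P0] Greatest_le_nat[of P] bounded by metis
  obtain x :: "nat \<Rightarrow> 'a" where x: "\<And>j. j < m \<Longrightarrow> x j \<in> N"
    and orth: "\<And>i j. i < m \<Longrightarrow> j < m \<Longrightarrow> tr (star (x i) * x j) = (if i = j then 1 else 0)"
    using m(1) unfolding P_def by blast
  have "y = (\<Sum>j<m. tr (star (x j) * y) *\<^sub>C x j)" if y: "y \<in> N" for y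
  proof (rule ccontr)
    assume neq: "y \<noteq> (\<Sum>j<m. tr (star (x j) * y) *\<^sub>C x j)"
    define r where "r = y - (\<Sum>j<m. tr (star (x j) * y) *\<^sub>C x j)"
    have rN: "r \<in> N" unfolding r_def using x y N_rules by (intro N_rules N_sum) auto
    have xr: "tr (star (x i) * r) = 0" if i: "i < m" for i
    proof -
      have "star (x i) * r = star (x i) * y - (\<Sum>j<m. tr (star (x j) * y) *\<^sub>C (star (x i) * x j))"
        by (simp add: r_def right_diff_distrib sum_distrib_left mult_scaleC_right)
      moreover have xxN: "star (x i) * x j \<in> N" if "j < m" for j
        using x[OF i] x[OF that] by (simp add: N_rules)
      then have "(\<Sum>j<m. tr (star (x j) * y) *\<^sub>C (star (x i) * x j)) \<in> N"
        by (intro N_sum N_rules(6)) auto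
      moreover have "star (x i) * y \<in> N" using x[OF i] y by (simp add: N_rules)
      ultimately have "tr (star (x i) * r) = tr (star (x i) * y)
          - tr (\<Sum>j<m. tr (star (x j) * y) *\<^sub>C (star (x i) * x j))"
        by (simp add: tr_diff)
      also have "tr (\<Sum>j<m. tr (star (x j) * y) *\<^sub>C (star (x i) * x j))
          = (\<Sum>j<m. tr (tr (star (x j) * y) *\<^sub>C (star (x i) * x j)))"
        by (rule tr_sum) (rule N_rules(6), simp add: xxN)
      also have "\<dots> = (\<Sum>j<m. tr (star (x j) * y) * tr (star (x i) * x j))"
        by (intro sum.cong refl tr_scaleC) (simp add: xxN)
      also have "(\<Sum>j<m. tr (star (x j) * y) * tr (star (x i) * x j))
          = (\<Sum>j<m. if i = j then tr (star (x j) * y) else 0)"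
        using orth i by (intro sum.cong) auto
      finally show ?thesis using i by simp
    qed
    have "star r * x i = star (star (x i) * r)" for i by (simp add: star_mult star_star)
    then have rx: "tr (star r * x i) = 0" if "i < m" for i
      using tr_star[of "star (x i) * r"] x[OF that] rN xr[OF that] N_rules by simp
    have rrN: "star r * r \<in> N" using rN N_rules by simp
    have "tr (star r * r) \<noteq> 0" using tr_faithful[OF rN] neq by (auto simp: r_def)
    then obtain c where c: "tr (star r * r) = complex_of_real c" "c > 0"
      using tr_pos[OF rrN pos_star_mult] by (metis less_eq_real_def of_real_0)
    define z where "z = (1 / sqrt c) *\<^sub>R r"
    have "star z * z = (1 / c) *\<^sub>R (star r * r)" using c(2) by (simp add: z_def star_scaleR)
    then have zz: "tr (star z * z) = 1" using c tr_scaleR[OF rrN] by simp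
    have zx: "tr (star z * x i) = 0" "tr (star (x i) * z) = 0" if "i < m" for i
      using rx[OF that] xr[OF that] x[OF that] rN
      by (simp_all add: z_def star_scaleR tr_scaleR N_rules)
    have "P (Suc m)"
      unfolding P_def
    proof (intro exI[of _ "x(m := z)"] conjI allI impI)
      show "(x(m := z)) j \<in> N" if "j < Suc m" for j
        using that x rN by (auto simp: z_def less_Suc_eq N_rules)
      show "tr (star ((x(m := z)) i) * (x(m := z)) j) = (if i = j then 1 else 0)"
        if "i < Suc m" "j < Suc m" for i j
        using that orth zx zz by (auto simp: less_Suc_eq)
    qed
    then show False using m(2) by fastforce
  qed
  then show ?thesis using that x orth by blast
qed

section \<open>Minimal expectations\<close>

text \<open>The tensor \<open>\<Sum>i. u i \<otimes> star (u i)\<close> over \<open>B\<close> is central for the action of \<open>A\<close> on both sides.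
  The element \<open>y\<close> may lie in a larger algebra, which is used for the step from \<open>A\<close> to the
  basic construction.\<close>

lemma index_map_commutes:
  assumes y: "\<And>b. b \<in> B \<Longrightarrow> b * y = y * b" and a: "a \<in> A"
  shows "a * index_map y = index_map y * a"
proof -
  note rules = a A_rules E_in
  have "a * index_map y = (\<Sum>i\<in>I. (\<Sum>k\<in>I. u k * E (star (u k) * (a * u i))) * y * star (u i))"
    unfolding index_map_def sum_distrib_left
    using rules u by (intro sum.cong refl) (simp add: basis mult.assoc)
  also have "\<dots> = (\<Sum>i\<in>I. \<Sum>k\<in>I. u k * y * (E (star (u k) * a * u i) * star (u i)))"
    unfolding sum_distrib_right
  proof (intro sum.cong refl)
    fix i k assume "i \<in> I" "k \<in> I"
    then have "E (star (u k) * (a * u i)) * y = y * E (star (u k) * (a * u i))"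
      using y rules u by simp
    then show "u k * E (star (u k) * (a * u i)) * y * star (u i)
        = u k * y * (E (star (u k) * a * u i) * star (u i))"
      by (metis mult.assoc)
  qed
  also have "\<dots> = (\<Sum>k\<in>I. u k * y * (\<Sum>i\<in>I. E (star (u k) * a * u i) * star (u i)))"
    unfolding sum_distrib_left by (rule sum.swap)
  also have "\<dots> = (\<Sum>k\<in>I. u k * y * (star (u k) * a))"
    using rules u by (intro sum.cong refl) (simp add: basis_right)
  finally show ?thesis by (simp add: index_map_def sum_distrib_right mult.assoc)
qed

lemma index_map_in: "x \<in> A \<Longrightarrow> index_map x \<in> A"
  unfolding index_map_def using u A_rules by (intro cstar_subalgebra_sum[OF A]) auto

lemma index_map_add: "index_map (x + y) = index_map x + index_map y"
  by (simp add: index_map_def distrib_left distrib_right sum.distrib)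

lemma index_map_scaleC: "index_map (c *\<^sub>C x) = c *\<^sub>C index_map x"
  by (simp add: index_map_def mult_scaleC_left mult_scaleC_right complex_vector.scale_sum_right)

lemma index_map_star: "index_map (star x) = star (index_map x)"
  by (simp add: index_map_def star_sum star_mult star_star mult.assoc)

lemma norm_index_map: "norm (index_map x) \<le> (\<Sum>i\<in>I. (norm (u i))\<^sup>2) * norm x"
proof -
  have "norm (u i * x * star (u i)) \<le> (norm (u i))\<^sup>2 * norm x" for i
  proof -
    have "norm (u i * x * star (u i)) \<le> norm (u i * x) * norm (u i)"
      using norm_mult_ineq[of "u i * x" "star (u i)"] by simp
    also have "\<dots> \<le> norm (u i) * norm x * norm (u i)"
      by (intro mult_right_mono norm_mult_ineq) simp
    finally show ?thesis by (simp add: power2_eq_square mult_ac)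
  qed
  then show ?thesis unfolding index_map_def sum_distrib_right
    by (intro order_trans[OF norm_sum] sum_mono)
qed

text \<open>The index is independent of the quasi-basis: expand each of the two in the other.\<close>

lemma index_of_quasi_basis:
  assumes ms: "quasi_basis A E ms"
  shows "(\<Sum>l\<leftarrow>ms. l * star l) = index_map 1"
proof -
  let ?n = "length ms"
  have mA: "ms ! j \<in> A" if "j < ?n" for j
    using ms that unfolding quasi_basis_def by (meson nth_mem subsetD)
  have mb: "(\<Sum>j<?n. ms ! j * E (star (ms ! j) * x)) = x" if "x \<in> A" for x
    using ms that unfolding quasi_basis_def sum_list_conv_sum_nth by simp
  have "(\<Sum>l\<leftarrow>ms. l * star l)
      = (\<Sum>j<?n. ms ! j * (\<Sum>i\<in>I. E (star (ms ! j) * u i) * star (u i)))"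
    unfolding sum_list_conv_sum_nth
    using mA A_rules by (intro sum.cong refl) (simp add: basis_right)
  also have "\<dots> = (\<Sum>i\<in>I. (\<Sum>j<?n. ms ! j * E (star (ms ! j) * u i)) * star (u i))"
    unfolding sum_distrib_left sum_distrib_right mult.assoc by (rule sum.swap)
  also have "\<dots> = index_map 1" using mb u by (simp add: index_map_def)
  finally show ?thesis .
qed

lemma quasi_basis_list: "\<exists>ms. quasi_basis A E ms"
proof -
  obtain xs where xs: "set xs = I" "distinct xs" using finite_distinct_list[OF fin] by blast
  have "(\<Sum>l\<leftarrow>map u xs. l * E (star l * x)) = x" if "x \<in> A" for x
    using basis[OF that] xs by (simp add: comp_def sum_list_distinct_conv_sum_set)
  then have "quasi_basis A E (map u xs)" unfolding quasi_basis_def using u xs by auto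
  then show ?thesis ..
qed

lemma watatani_index_eq:
  assumes "index_map 1 = r *\<^sub>R 1" shows "watatani_index A E = r"
  unfolding watatani_index_def
proof (rule the_equality)
  show "\<exists>ls. quasi_basis A E ls \<and> (\<Sum>l\<leftarrow>ls. l * star l) = r *\<^sub>R 1"
    using quasi_basis_list index_of_quasi_basis assms by metis
  show "r' = r" if "\<exists>ls. quasi_basis A E ls \<and> (\<Sum>l\<leftarrow>ls. l * star l) = r' *\<^sub>R 1" for r'
    using that index_of_quasi_basis assms by (metis scaleR_cancel_right zero_neq_one)
qed

end

lemma exp_in_cstar_subalgebra:
  assumes S: "cstar_subalgebra S" and x: "x \<in> S" shows "exp x \<in> S"
proof -
  note S' = cstar_subalgebraD[OF S]
  have pow: "x ^ n \<in> S" for n by (induction n) (simp_all add: S' x)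
  have "(\<lambda>n. \<Sum>k<n. x ^ k /\<^sub>R fact k) \<longlonglongrightarrow> exp x"
    using exp_converges[of x] by (simp add: sums_def)
  moreover have "(\<Sum>k<n. x ^ k /\<^sub>R fact k) \<in> S" for n
    by (intro cstar_subalgebra_sum[OF S] S' pow)
  ultimately show ?thesis using closed_sequentially[OF S'(1)] by metis
qed

lemma star_exp: "star (exp x) = exp (star x :: 'a::cstar_algebra)"
proof -
  have pow: "star (x ^ n) = star x ^ n" for n
    by (induction n) (simp_all add: star_mult power_commutes)
  have "(\<lambda>n. star (x ^ n /\<^sub>R fact n)) sums star (exp x)"
    by (rule bounded_linear.sums[OF bounded_linear_star exp_converges])
  then have "(\<lambda>n. star x ^ n /\<^sub>R fact n) sums star (exp x)"
    by (simp add: star_scaleR pow)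
  then show ?thesis using exp_converges[of "star x"] sums_unique2 by blast
qed

text \<open>A bounded real-linear functional on a subalgebra can be differentiated along
  one-parameter groups in that subalgebra.\<close>

lemma DERIV_functional_exp:
  fixes f :: "'a::cstar_algebra \<Rightarrow> real"
  assumes S: "cstar_subalgebra S" and \<epsilon>: "\<epsilon> \<in> S"
    and add: "\<And>x y. x \<in> S \<Longrightarrow> y \<in> S \<Longrightarrow> f (x + y) = f x + f y"
    and scale: "\<And>r x. x \<in> S \<Longrightarrow> f (r *\<^sub>R x) = r * f x"
    and bound: "\<And>x. x \<in> S \<Longrightarrow> \<bar>f x\<bar> \<le> K * norm x"
  shows "((\<lambda>t. f (exp (t *\<^sub>R \<epsilon>))) has_real_derivative f \<epsilon>) (at 0)"
proof -
  note S' = cstar_subalgebraD[OF S]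
  let ?r = "\<lambda>t. exp (t *\<^sub>R \<epsilon>) - (1 + t *\<^sub>R \<epsilon>)"
  have "((\<lambda>t. exp (t *\<^sub>R \<epsilon>)) has_vector_derivative exp (0 *\<^sub>R \<epsilon>) * \<epsilon>) (at 0)"
    by (rule exp_scaleR_has_vector_derivative_right)
  then have "((\<lambda>t. (1 / norm (t - 0)) *\<^sub>R (exp (t *\<^sub>R \<epsilon>) - (exp (0 *\<^sub>R \<epsilon>) + (t - 0) *\<^sub>R \<epsilon>)))
      \<longlongrightarrow> 0) (at 0)"
    unfolding has_vector_derivative_def has_derivative_at2 by simp
  then have "((\<lambda>t. (1 / \<bar>t\<bar>) *\<^sub>R ?r t) \<longlongrightarrow> 0) (at 0)" by simp
  then have lim: "((\<lambda>t. K * norm ((1 / \<bar>t\<bar>) *\<^sub>R ?r t)) \<longlongrightarrow> 0) (at 0)"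
    by (intro tendsto_mult_right_zero tendsto_norm_zero)
  have r: "?r t \<in> S" for t using exp_in_cstar_subalgebra[OF S] S' \<epsilon> by simp
  have eq: "f (exp (t *\<^sub>R \<epsilon>)) - (f 1 + f \<epsilon> * t) = f (?r t)" for t
  proof -
    have "exp (t *\<^sub>R \<epsilon>) = ?r t + (1 + t *\<^sub>R \<epsilon>)" by simp
    then have "f (exp (t *\<^sub>R \<epsilon>)) = f (?r t) + f (1 + t *\<^sub>R \<epsilon>)"
      using add[OF r] S' \<epsilon> by metis
    then show ?thesis using add[of 1 "t *\<^sub>R \<epsilon>"] scale[of \<epsilon>] S' \<epsilon> by simp
  qed
  have "((\<lambda>t. (1 / \<bar>t\<bar>) *\<^sub>R f (?r t)) \<longlongrightarrow> 0) (at 0)"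
  proof (rule Lim_null_comparison[OF _ lim], intro always_eventually allI)
    fix t
    show "norm ((1 / \<bar>t\<bar>) *\<^sub>R f (?r t)) \<le> K * norm ((1 / \<bar>t\<bar>) *\<^sub>R ?r t)"
      using bound[OF r[of t]] by (simp add: divide_right_mono)
  qed
  then show ?thesis
    unfolding has_field_derivative_def has_derivative_at2
    by (simp add: eq bounded_linear_mult_right)
qed

context finite_index_expectation
begin

text \<open>For an invertible self-adjoint \<open>h\<close> in the relative commutant, \<open>E\<close> can be perturbed to the
  expectation \<open>x \<mapsto> E (h * x * h) / tr (h * h)\<close>, whose index is \<open>tr (h * h) * index_map (g * g)\<close>
  for the inverse \<open>g\<close> of \<open>h\<close>.\<close>

lemma minimal_perturbation:
  assumes min: "minimal_cond_exp A B E" and k: "index_map 1 = k *\<^sub>R 1"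
    and h: "h \<in> N" "star h = h" and g: "g \<in> N" "star g = g" and hg: "h * g = 1" "g * h = 1"
    and \<alpha>: "tr (h * h) = complex_of_real \<alpha>"
    and r: "index_map (g * g) = r *\<^sub>R 1"
  shows "k \<le> \<alpha> * r"
proof -
  note hA = N_A[OF h(1)] and gA = N_A[OF g(1)]
  have "h \<noteq> 0" using hg by auto
  have hh: "h * h \<in> N" using h N_rules by simp
  have "tr (h * h) \<noteq> 0" using tr_faithful[OF h(1)] h(2) \<open>h \<noteq> 0\<close> by auto
  moreover have "0 \<le> Re (tr (h * h))" using tr_pos[OF hh] pos_star_mult[of h] h(2) by simp
  ultimately have \<alpha>0: "\<alpha> > 0" using \<alpha> by auto
  define F where "F x = (1 / \<alpha>) *\<^sub>R E (h * x * h)" for x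
  define v where "v i = sqrt \<alpha> *\<^sub>R (u i * g)" for i
  have F: "cond_exp A B F"
    unfolding cond_exp_def linear_onC_def
  proof (intro conjI ballI allI impI subsetI)
    show "F (x + y) = F x + F y" if "x \<in> A" "y \<in> A" for x y
      using that hA A_rules by (simp add: F_def distrib_left distrib_right E_add scaleR_add_right)
    show "F (c *\<^sub>C x) = c *\<^sub>C F x" if "x \<in> A" for c x
      using that hA A_rules
      by (simp add: F_def mult_scaleC_left mult_scaleC_right E_scaleC scaleR_scaleC scaleC_scaleC mult.commute)
    show "y \<in> B" if "y \<in> F ` A" for y
      using that hA A_rules B_rules E_in by (auto simp: F_def)
    show "F b = b" if b: "b \<in> B" for b
    proof -
      have "h * b * h = b * (h * h)" using N_comm[OF h(1) b] by (metis mult.assoc)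
      then have "E (h * b * h) = b * (complex_of_real \<alpha> *\<^sub>C 1)"
        using E_left[OF b, of "h * h"] hA A_rules E_N[OF hh] \<alpha> by simp
      then show ?thesis using \<alpha>0 by (simp add: F_def scaleC_of_real)
    qed
    fix x assume x: "x \<in> A"
    show "F (b * x) = b * F x" if b: "b \<in> B" for b
    proof -
      have "h * (b * x) * h = b * (h * x * h)" using N_comm[OF h(1) b] by (metis mult.assoc)
      then show ?thesis using E_left[OF b, of "h * x * h"] hA x A_rules by (simp add: F_def)
    qed
    show "F (x * b) = F x * b" if b: "b \<in> B" for b
    proof -
      have "h * (x * b) * h = (h * x * h) * b" using N_comm[OF h(1) b] by (metis mult.assoc)
      then show ?thesis using E_right[OF b, of "h * x * h"] hA x A_rules by (simp add: F_def)
    qed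
    assume "positive_in A x"
    then have "pos x" by (rule positive_in_pos)
    then have "pos (h * x * h)" using pos_conj[of x h] h(2) by simp
    then have "pos (F x)" unfolding F_def using \<alpha>0 hA x A_rules by (intro pos_scaleR E_pos) auto
    then show "positive_in B (F x)"
      using hA x A_rules B_rules E_in by (intro pos_positive_in[OF _ B]) (auto simp: F_def)
  qed
  interpret F: finite_index_expectation A B F I v
  proof
    show "v i \<in> A" if "i \<in> I" for i using u[OF that] gA A_rules by (simp add: v_def)
    show "(\<Sum>i\<in>I. v i * F (star (v i) * x)) = x" if x: "x \<in> A" for x
    proof -
      have "v i * F (star (v i) * x) = u i * E (star (u i) * (x * h)) * g" if i: "i \<in> I" for i
      proof -
        have "h * (star (v i) * x) * h = sqrt \<alpha> *\<^sub>R (star (u i) * (x * h))"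
          using hg by (simp add: v_def star_scaleR star_mult g(2) flip: mult.assoc)
        then have "F (star (v i) * x) = (1 / \<alpha> * sqrt \<alpha>) *\<^sub>R E (star (u i) * (x * h))"
          using u[OF i] x hA A_rules by (simp add: F_def E_scaleR)
        then have "v i * F (star (v i) * x) = u i * g * E (star (u i) * (x * h))"
          using \<alpha>0 by (simp add: v_def)
        also have "\<dots> = u i * E (star (u i) * (x * h)) * g"
          using N_comm[OF g(1), of "E (star (u i) * (x * h))"] u[OF i] x hA A_rules E_in
          by (simp add: mult.assoc)
        finally show ?thesis .
      qed
      then have "(\<Sum>i\<in>I. v i * F (star (v i) * x)) = x * h * g"
        using basis[of "x * h"] x hA A_rules by (simp add: sum_distrib_right[symmetric])
      then show ?thesis using hg by (simp add: mult.assoc)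
    qed
  qed (use A B BA F fin center in auto)
  have "F.index_map 1 = \<alpha> *\<^sub>R index_map (g * g)"
    unfolding F.index_map_def index_map_def scaleR_sum_right
    using \<alpha>0 by (intro sum.cong refl) (simp add: v_def star_scaleR star_mult g(2) mult.assoc)
  then have "watatani_index A F = \<alpha> * r" using r by (intro F.watatani_index_eq) simp
  moreover have "watatani_index A E = k" using k by (rule watatani_index_eq)
  moreover have "index_finite_cond_exp A B F"
    using F F.quasi_basis_list by (simp add: index_finite_cond_exp_def)
  ultimately show ?thesis using min by (auto simp: minimal_cond_exp_def)
qed

text \<open>On self-adjoint elements \<open>y\<close> this is the vanishing, at the minimum of the index, of its first
  variation along \<open>h = exp (t y / 2)\<close>.\<close>

lemma minimal_index_map:
  assumes min: "minimal_cond_exp A B E" and k: "index_map 1 = k *\<^sub>R 1"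
    and center_A: "\<And>z. z \<in> A \<Longrightarrow> (\<And>a. a \<in> A \<Longrightarrow> a * z = z * a) \<Longrightarrow> \<exists>c. z = c *\<^sub>C 1"
    and x: "x \<in> N"
  shows "index_map x = k *\<^sub>R E x"
proof -
  have "\<exists>c. index_map y = c *\<^sub>C 1" if y: "y \<in> N" for y
    using index_map_in[OF N_A[OF y]] index_map_commutes[OF N_comm[OF y]] by (intro center_A) auto
  then obtain p where p: "\<And>y. y \<in> N \<Longrightarrow> index_map y = p y *\<^sub>C 1" by metis
  have p_eqI: "p y = c" if "y \<in> N" "index_map y = c *\<^sub>C 1" for y c
    using p[OF that(1)] that(2) by simp
  have p_add: "p (y + z) = p y + p z" if "y \<in> N" "z \<in> N" for y z
    using that by (intro p_eqI) (simp_all add: N_rules index_map_add p[symmetric] scaleC_add_left)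
  have p_scale: "p (c *\<^sub>C y) = c * p y" if "y \<in> N" for c y
    using that by (intro p_eqI) (simp_all only: N_rules index_map_scaleC p scaleC_scaleC)
  have p_star: "p (star y) = cnj (p y)" if "y \<in> N" for y
    using that by (intro p_eqI) (simp_all add: N_rules index_map_star p star_scaleC)
  have p_one: "p 1 = of_real k" by (intro p_eqI) (simp_all add: N_rules k scaleC_of_real)
  have selfadj: "p y = of_real k * tr y" if y: "y \<in> N" "star y = y" for y
  proof -
    have N: "cstar_subalgebra N" by (rule cstar_subalgebra_rel_commutant[OF A star_B])
    let ?e = "\<lambda>t. exp (t *\<^sub>R y)"
    have eN: "?e t \<in> N" for t by (intro exp_in_cstar_subalgebra[OF N] N_rules y)
    have star_e: "star (?e t) = ?e t" for t by (simp add: star_exp star_scaleR y)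
    have tr_real: "tr z = of_real (Re (tr z))" "p z = of_real (Re (p z))" if "z \<in> N" "star z = z" for z
      using tr_star[of z] p_star[of z] that by (simp_all add: complex_eq_iff)
    \<comment> \<open>The right-hand side is the index of the expectation perturbed by \<open>h = exp (t y / 2)\<close>.\<close>
    have min0: "k \<le> Re (tr (?e t)) * Re (p (?e (- t)))" for t
    proof (rule minimal_perturbation[OF min k, of "?e (t/2)" "?e (- (t/2))"])
      have double: "?e s * ?e s = ?e (s + s)" for s
        by (subst exp_add_commuting[symmetric]) (simp_all only: scaleR_add_left)
      show "tr (?e (t/2) * ?e (t/2)) = of_real (Re (tr (?e t)))"
        unfolding double using tr_real(1)[OF eN star_e] by simp
      show "index_map (?e (- (t/2)) * ?e (- (t/2))) = Re (p (?e (- t))) *\<^sub>R 1"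
        unfolding double using p[OF eN] tr_real(2)[OF eN star_e]
        by (metis add_uminus_conv_diff field_sum_of_halves minus_add_distrib scaleC_of_real)
      show "?e (t/2) * ?e (- (t/2)) = 1" using exp_minus_inverse[of "(t/2) *\<^sub>R y"] by simp
      show "?e (- (t/2)) * ?e (t/2) = 1" using exp_minus_inverse[of "- ((t/2) *\<^sub>R y)"] by simp
    qed (intro eN star_e)+
    have d1: "((\<lambda>t. Re (tr (?e t))) has_real_derivative Re (tr y)) (at 0)"
    proof (rule DERIV_functional_exp[OF N y(1), of "\<lambda>z. Re (tr z)" 6])
      show "\<bar>Re (tr z)\<bar> \<le> 6 * norm z" if z: "z \<in> N" for z
      proof -
        have "cmod (tr z) = norm (E z)" using E_N[OF z] by (simp add: norm_scaleC)
        then show ?thesis using E_bounded[OF N_A[OF z]] abs_Re_le_cmod[of "tr z"] by linarith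
      qed
    qed (simp_all add: tr_add tr_scaleR)
    let ?K = "\<Sum>i\<in>I. (norm (u i))\<^sup>2"
    have "((\<lambda>t. Re (p (exp (t *\<^sub>R (- y))))) has_real_derivative Re (p (- y))) (at 0)"
    proof (rule DERIV_functional_exp[OF N, of "- y" "\<lambda>z. Re (p z)" ?K])
      show "- y \<in> N" using N_rules(6)[OF y(1), of "- 1"] by simp
      show "\<bar>Re (p z)\<bar> \<le> ?K * norm z" if z: "z \<in> N" for z
      proof -
        have "cmod (p z) = norm (index_map z)" using p[OF z] by (simp add: norm_scaleC)
        then show ?thesis using norm_index_map[of z] abs_Re_le_cmod[of "p z"] by linarith
      qed
    qed (simp_all add: p_add p_scale scaleR_scaleC)
    then have d2: "((\<lambda>t. Re (p (?e (- t)))) has_real_derivative - Re (p y)) (at 0)"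
      using p_scale[OF y(1), of "- 1"] by simp
    have "((\<lambda>t. Re (tr (?e t)) * Re (p (?e (- t)))) has_real_derivative
        Re (tr y) * Re (p (?e (- 0))) + - Re (p y) * Re (tr (?e 0))) (at 0)"
      by (rule DERIV_mult[OF d1 d2])
    then have "Re (tr y) * Re (p (?e (- 0))) + - Re (p y) * Re (tr (?e 0)) = 0"
      by (rule DERIV_local_min[where d = 1]) (use min0 in \<open>simp_all add: tr_one p_one\<close>)
    then show ?thesis using tr_real[OF y] by (simp add: tr_one p_one complex_eq_iff mult.commute)
  qed
  have parts: "re_part x \<in> N" "im_part x \<in> N"
    using x re_part_in im_part_in cstar_subalgebra_rel_commutant[OF A star_B] by blast+
  have "p x = p (re_part x) + \<i> * p (im_part x)"
    using p_add[of "re_part x" "\<i> *\<^sub>C im_part x"] p_scale parts N_rules(6) re_im_decomposition[of x]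
    by simp
  moreover have "tr x = tr (re_part x) + \<i> * tr (im_part x)"
    using tr_add[of "re_part x" "\<i> *\<^sub>C im_part x"] tr_scaleC parts N_rules(6) re_im_decomposition[of x]
    by simp
  ultimately have "p x = of_real k * tr x"
    using selfadj[OF parts(1) star_re_part] selfadj[OF parts(2) star_im_part]
    by (simp add: algebra_simps)
  then show ?thesis using p[OF x] E_N[OF x] by (simp add: scaleR_scaleC scaleC_scaleC)
qed

end

section \<open>The basic construction\<close>

text \<open>The assumption \<open>index\<close> is the form in which minimality of \<open>E\<close> enters the first step of the
  tower.\<close>

locale basic_extension = finite_index_expectation A B E I u
  for A B :: "'a::cstar_algebra set" and E :: "'a \<Rightarrow> 'a" and I :: "'i set" and u :: "'i \<Rightarrow> 'a" +
  fixes A1 :: "'a set" and e :: 'a and E1 :: "'a \<Rightarrow> 'a" and \<tau> :: real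
  assumes bc: "basic_construction B A E A1 e" and dual: "dual_cond_exp \<tau> A A1 e E1"
    and \<tau>: "\<tau> > 0" and index: "\<And>x. x \<in> N \<Longrightarrow> index_map x = (1/\<tau>) *\<^sub>R E x"
    and center_A: "\<And>z. z \<in> A \<Longrightarrow> (\<And>a. a \<in> A \<Longrightarrow> a * z = z * a) \<Longrightarrow> \<exists>c. z = c *\<^sub>C 1"
begin

lemma
  shows A1: "cstar_subalgebra A1" and A_A1: "A \<subseteq> A1"
    and star_e: "star e = e" and e_idem: "e * e = e"
    and e_compress: "\<And>x. x \<in> A \<Longrightarrow> e * x * e = E x * e"
    and e_comm: "\<And>b. b \<in> B \<Longrightarrow> e * b = b * e"
    and A1_closure: "A1 = closure (complex_vector.span {x * e * y | x y. x \<in> A \<and> y \<in> A})"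
  using bc unfolding basic_construction_def by auto

sublocale dual: conditional_expectation A1 A E1
  using dual A1 A A_A1 by unfold_locales (auto simp: dual_cond_exp_def)

lemma E1_e: "x \<in> A \<Longrightarrow> y \<in> A \<Longrightarrow> E1 (x * e * y) = \<tau> *\<^sub>R (x * y)"
  using dual by (simp add: dual_cond_exp_def)

lemmas A1_rules = dual.A_rules

lemma AA1: "x \<in> A \<Longrightarrow> x \<in> A1"
  using A_A1 by blast

lemma span_A1: "complex_vector.span {x * e * y | x y. x \<in> A \<and> y \<in> A} \<subseteq> A1"
  using closure_subset A1_closure by blast

lemma e_A1: "e \<in> A1"
proof -
  have "1 * e * 1 \<in> {x * e * y | x y. x \<in> A \<and> y \<in> A}" using A_rules(1) by blast
  then have "1 * e * 1 \<in> A1" by (intro subsetD[OF span_A1] complex_vector.span_base)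
  then show ?thesis by simp
qed

text \<open>Identities that are linear and continuous need to be checked only on \<open>A e A\<close>.\<close>

lemma A1_induct [consumes 1, case_names gen add scale lim]:
  assumes w: "w \<in> A1"
    and gen: "\<And>x y. x \<in> A \<Longrightarrow> y \<in> A \<Longrightarrow> P (x * e * y)"
    and add: "\<And>w w'. w \<in> A1 \<Longrightarrow> w' \<in> A1 \<Longrightarrow> P w \<Longrightarrow> P w' \<Longrightarrow> P (w + w')"
    and scale: "\<And>c w. w \<in> A1 \<Longrightarrow> P w \<Longrightarrow> P (c *\<^sub>C w)"
    and lim: "\<And>f w. (\<And>n::nat. f n \<in> A1) \<Longrightarrow> (\<And>n. P (f n)) \<Longrightarrow> f \<longlonglongrightarrow> w \<Longrightarrow> P w"
  shows "P w"
proof -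
  let ?S = "{x * e * y | x y. x \<in> A \<and> y \<in> A}"
  have span: "v \<in> A1 \<and> P v" if "v \<in> complex_vector.span ?S" for v
    using that
  proof (induction rule: complex_vector.span_induct_alt)
    case base
    have "P (0 * e * 0)" using A_rules by (intro gen) auto
    then show ?case using A1_rules by simp
  next
    case (step c x y)
    then have x: "x \<in> A1" by (intro subsetD[OF span_A1] complex_vector.span_base)
    have "P x" using step(1) gen by blast
    then have "P (c *\<^sub>C x)" by (rule scale[OF x])
    then show ?case using step(2) x A1_rules(3,7) add by simp
  qed
  obtain f where "\<And>n. f n \<in> complex_vector.span ?S" "f \<longlonglongrightarrow> w"
    using w unfolding A1_closure closure_sequential by blast
  then show ?thesis using span lim[of f w] by blast
qed

text \<open>The sum acts as the identity on \<open>A e A\<close> from the left.\<close>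

lemma sum_e: "(\<Sum>i\<in>I. u i * e * star (u i)) = 1"
proof -
  let ?p = "\<Sum>i\<in>I. u i * e * star (u i)"
  have "?p * w = w" if "w \<in> A1" for w
    using that
  proof (induction rule: A1_induct)
    case (gen x y)
    have "?p * (x * e * y) = (\<Sum>i\<in>I. u i * E (star (u i) * x)) * e * y"
      unfolding sum_distrib_right
    proof (rule sum.cong[OF refl])
      fix i assume "i \<in> I"
      then have "e * (star (u i) * x) * e = E (star (u i) * x) * e"
        using u gen A_rules by (intro e_compress) auto
      then show "u i * e * star (u i) * (x * e * y) = u i * E (star (u i) * x) * e * y"
        by (metis mult.assoc)
    qed
    then show ?case using basis gen by simp
  next
    case (lim f w)
    have "(\<lambda>n. ?p * f n) \<longlonglongrightarrow> ?p * w" by (intro tendsto_intros lim.hyps(2))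
    then have "f \<longlonglongrightarrow> ?p * w" by (simp only: lim.IH)
    then show ?case by (rule LIMSEQ_unique[OF _ lim.hyps(2)])
  qed (simp_all add: distrib_left mult_scaleC_right)
  from this[of 1] show ?thesis using A1_rules by simp
qed

text \<open>On \<open>A e A\<close> this holds as \<open>x * e * y * e = x * E y * e\<close>. It says that \<open>A1 e = A e\<close>, so that
  identities between elements of the form \<open>w * e\<close> can be pushed down to \<open>A\<close>.\<close>

lemma push_down:
  assumes "w \<in> A1" shows "w * e = (1/\<tau>) *\<^sub>R (E1 (w * e) * e)"
  using assms
proof (induction rule: A1_induct)
  case (gen x y)
  have "x * e * y * e = x * E y * e"
    using e_compress[OF gen(2)] by (metis mult.assoc)
  moreover from this have "x * e * y * e = x * e * E y"
    using e_comm[of "E y"] E_in gen by (metis mult.assoc)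
  ultimately show ?case using E1_e[OF gen(1), of "E y"] E_in_A gen \<tau> by simp
next
  case (add w w')
  then show ?case using e_A1 A1_rules by (simp add: distrib_right dual.E_add scaleR_add_right)
next
  case (scale c w)
  then have "E1 (c *\<^sub>C w * e) = c *\<^sub>C E1 (w * e)"
    using e_A1 A1_rules by (simp add: mult_scaleC_left dual.E_scaleC)
  moreover have "c *\<^sub>C (w * e) = c *\<^sub>C ((1/\<tau>) *\<^sub>R (E1 (w * e) * e))" using scale by simp
  ultimately show ?case
    by (simp add: mult_scaleC_left scaleR_scaleC scaleC_scaleC mult.commute)
next
  case (lim f w)
  have "(\<lambda>n. E1 (f n * e)) \<longlonglongrightarrow> E1 (w * e)"
    using lim.hyps(1) e_A1 A1_rules by (intro dual.E_tendsto tendsto_intros lim.hyps(2)) auto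
  then have "(\<lambda>n. (1/\<tau>) *\<^sub>R (E1 (f n * e) * e)) \<longlonglongrightarrow> (1/\<tau>) *\<^sub>R (E1 (w * e) * e)"
    by (intro tendsto_intros)
  then have "(\<lambda>n. f n * e) \<longlonglongrightarrow> (1/\<tau>) *\<^sub>R (E1 (w * e) * e)" by (simp only: lim.IH[symmetric])
  moreover have "(\<lambda>n. f n * e) \<longlonglongrightarrow> w * e" by (intro tendsto_intros lim.hyps(2))
  ultimately show ?case by (rule LIMSEQ_unique[rotated])
qed

lemma push_down_left:
  assumes "w \<in> A1" shows "e * w = (1/\<tau>) *\<^sub>R (e * E1 (e * w))"
proof -
  have "star (star w * e) = star ((1/\<tau>) *\<^sub>R (E1 (star w * e) * e))"
    using push_down[of "star w"] assms A1_rules by simp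
  moreover have "star (E1 (star w * e)) = E1 (e * w)"
    using dual.E_star[of "star w * e"] assms e_A1 A1_rules by (simp add: star_mult star_star star_e)
  ultimately show ?thesis by (simp only: star_mult star_star star_e star_scaleR)
qed

lemma A1_basis:
  assumes "w \<in> A1" shows "(\<Sum>i\<in>I. u i * e * E1 (e * (star (u i) * w))) = \<tau> *\<^sub>R w"
proof -
  have "u i * e * E1 (e * (star (u i) * w)) = \<tau> *\<^sub>R (u i * e * star (u i) * w)" if "i \<in> I" for i
  proof -
    have "star (u i) * w \<in> A1" using that u AA1 assms A1_rules by simp
    then have "\<tau> *\<^sub>R (e * (star (u i) * w)) = e * E1 (e * (star (u i) * w))"
      by (subst push_down_left) (use \<tau> in auto)
    then show ?thesis by (metis mult.assoc mult_scaleR_right)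
  qed
  then show ?thesis
    using sum_e by (simp add: scaleR_sum_right[symmetric] sum_distrib_right[symmetric])
qed

definition F :: "'a \<Rightarrow> 'a" where "F x = E (E1 x)"

definition v :: "'i \<times> 'i \<Rightarrow> 'a" where
  "v = (\<lambda>(j, i). (1 / sqrt \<tau>) *\<^sub>R (u j * e * u i))"

lemma cond_exp_F: "cond_exp A1 B F"
  unfolding cond_exp_def linear_onC_def F_def
proof (intro conjI ballI allI impI subsetI)
  fix x assume x: "x \<in> A1"
  show "E (E1 (b * x)) = b * E (E1 x)" "E (E1 (x * b)) = E (E1 x) * b" if "b \<in> B" for b
    using that x BA' dual.E_in by (simp_all add: dual.E_left dual.E_right E_left E_right)
  assume "positive_in A1 x"
  then show "positive_in B (E (E1 x))"
    using x dual.E_in E_in dual.E_pos E_pos positive_in_pos by (intro pos_positive_in[OF _ B]) blast+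
qed (use dual.E_in E_in BA' in \<open>auto simp: dual.E_add E_add dual.E_scaleC E_scaleC dual.E_id E_id\<close>)

text \<open>Expanding in the quasi-basis \<open>u j * e / sqrt \<tau>\<close> of \<open>E1\<close> and then in the quasi-basis \<open>u\<close> of
  \<open>E\<close> shows that the family \<open>v\<close> is a quasi-basis for the composite.\<close>

sublocale F: finite_index_expectation A1 B F "I \<times> I" v
proof
  show "B \<subseteq> A1" using BA A_A1 by blast
  show "v p \<in> A1" if "p \<in> I \<times> I" for p
    using that u AA1 e_A1 A1_rules by (auto simp: v_def)
  show "(\<Sum>p\<in>I \<times> I. v p * F (star (v p) * x)) = x" if x: "x \<in> A1" for x
  proof -
    note rules = x u AA1 A1_rules A_rules e_A1 dual.E_in
    have "(\<Sum>p\<in>I \<times> I. v p * F (star (v p) * x))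
        = (\<Sum>j\<in>I. \<Sum>i\<in>I. (1/\<tau>) *\<^sub>R (u j * e * (u i * E (star (u i) * E1 (e * (star (u j) * x))))))"
      unfolding sum.cartesian_product
    proof (rule sum.cong[OF refl], clarify)
      fix j i assume ij: "j \<in> I" "i \<in> I"
      have "star (v (j, i)) * x = (1 / sqrt \<tau>) *\<^sub>R (star (u i) * (e * (star (u j) * x)))"
        by (simp add: v_def star_scaleR star_mult star_e mult.assoc)
      then have "F (star (v (j, i)) * x)
          = (1 / sqrt \<tau>) *\<^sub>R E (star (u i) * E1 (e * (star (u j) * x)))"
        using rules ij by (simp add: F_def dual.E_scaleR E_scaleR dual.E_left)
      then show "v (j, i) * F (star (v (j, i)) * x)
          = (1/\<tau>) *\<^sub>R (u j * e * (u i * E (star (u i) * E1 (e * (star (u j) * x)))))"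
        using \<tau> by (simp add: v_def mult.assoc)
    qed
    also have "\<dots> = (\<Sum>j\<in>I. (1/\<tau>) *\<^sub>R (u j * e * E1 (e * (star (u j) * x))))"
      unfolding scaleR_sum_right[symmetric] sum_distrib_left[symmetric]
      using rules by (intro arg_cong[where f = "scaleR _"] sum.cong refl) (simp add: basis)
    also have "\<dots> = x" using A1_basis[OF x] \<tau> by (simp add: scaleR_sum_right[symmetric])
    finally show ?thesis .
  qed
  show "finite (I \<times> I)" using fin by simp
  show "\<exists>c. z = c *\<^sub>C 1" if "z \<in> B" "\<And>b. b \<in> B \<Longrightarrow> b * z = z * b" for z
    using that by (rule center)
qed (fact A1 B cond_exp_F)+

lemma E1_N:
  assumes y: "y \<in> F.N" shows "E1 y \<in> N"
proof (rule rel_commutantI)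
  show "E1 y \<in> A" by (rule dual.E_in[OF F.N_A[OF y]])
  show "b * E1 y = E1 y * b" if b: "b \<in> B" for b
    using dual.E_left[OF BA'[OF b] F.N_A[OF y]] dual.E_right[OF BA'[OF b] F.N_A[OF y]]
      F.N_comm[OF y b] by simp
qed

text \<open>For \<open>y\<close> in the relative commutant of \<open>B\<close> in \<open>A1\<close> the element
  \<open>w = (\<Sum>i\<in>I. u i * y * star (u i))\<close> commutes with \<open>A\<close>, hence \<open>w e = z e\<close> for some
  \<open>z\<close> in the relative commutant of \<open>B\<close> in \<open>A\<close>. Both \<open>index_map y\<close> for the
  composite expectation and the expectation of \<open>y\<close> are multiples of \<open>tr z\<close>.\<close>

lemma index_map_F:
  assumes y: "y \<in> F.N" shows "F.index_map y = (1 / \<tau>\<^sup>2) *\<^sub>R F y"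
proof -
  note yA = F.N_A[OF y]
  define w where "w = index_map y"
  have w: "w \<in> A1"
    unfolding w_def index_map_def using yA u AA1 A1_rules
    by (intro cstar_subalgebra_sum[OF A1]) auto
  have wA: "a * w = w * a" if "a \<in> A" for a
    unfolding w_def by (rule index_map_commutes[OF F.N_comm[OF y] that])
  define z where "z = (1/\<tau>) *\<^sub>R E1 (w * e)"
  have we: "w * e = z * e" unfolding z_def using push_down[OF w] by simp
  have zN: "z \<in> N"
  proof (rule rel_commutantI)
    show "z \<in> A" unfolding z_def using w e_A1 A1_rules A_rules dual.E_in by simp
    show "b * z = z * b" if b: "b \<in> B" for b
    proof -
      have "b * (w * e) = w * e * b" using wA[OF BA'[OF b]] e_comm[OF b] by (metis mult.assoc)
      then have "b * E1 (w * e) = E1 (w * e) * b"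
        using dual.E_left[OF BA'[OF b], of "w * e"] dual.E_right[OF BA'[OF b], of "w * e"]
          w e_A1 A1_rules by simp
      then show ?thesis by (simp add: z_def)
    qed
  qed
  note zA = N_A[OF zN]
  have ewe: "e * w * e = tr z *\<^sub>C e"
  proof -
    have "e * w * e = e * z * e" using we by (metis mult.assoc)
    also have "\<dots> = tr z *\<^sub>C e" using e_compress[OF zA] E_N[OF zN] by (simp add: mult_scaleC_left)
    finally show ?thesis .
  qed
  have "F.index_map y = (\<Sum>j\<in>I. \<Sum>i\<in>I. (1/\<tau>) *\<^sub>R (u j * e * (u i * y * star (u i)) * (e * star (u j))))"
    unfolding F.index_map_def sum.cartesian_product using \<tau>
    by (intro sum.cong refl) (auto simp: v_def star_scaleR star_mult star_e mult.assoc)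
  also have "\<dots> = (\<Sum>j\<in>I. (1/\<tau>) *\<^sub>R (u j * (e * w * e) * star (u j)))"
  proof (rule sum.cong[OF refl])
    fix j
    have "(\<Sum>i\<in>I. u j * e * (u i * y * star (u i)) * (e * star (u j))) = u j * (e * w * e) * star (u j)"
      by (simp add: w_def index_map_def sum_distrib_left sum_distrib_right mult.assoc)
    then show "(\<Sum>i\<in>I. (1/\<tau>) *\<^sub>R (u j * e * (u i * y * star (u i)) * (e * star (u j))))
        = (1/\<tau>) *\<^sub>R (u j * (e * w * e) * star (u j))"
      by (simp only: scaleR_sum_right[symmetric])
  qed
  also have "\<dots> = (1/\<tau>) *\<^sub>R tr z *\<^sub>C (\<Sum>j\<in>I. u j * e * star (u j))"
    unfolding ewe scaleR_sum_right complex_vector.scale_sum_right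
    by (simp add: mult_scaleC_left mult_scaleC_right)
  finally have left: "F.index_map y = (1/\<tau>) *\<^sub>R tr z *\<^sub>C 1" by (simp add: sum_e)
  have "w = (\<Sum>j\<in>I. w * (u j * e * star (u j)))"
    using sum_e by (simp add: sum_distrib_left[symmetric])
  also have "\<dots> = (\<Sum>j\<in>I. u j * z * e * star (u j))"
    using wA[OF u] we by (intro sum.cong refl) (metis mult.assoc)
  finally have "E1 w = (\<Sum>j\<in>I. E1 (u j * z * e * star (u j)))"
    using u zA AA1 e_A1 A1_rules by (simp add: dual.E_sum)
  also have "\<dots> = (\<Sum>j\<in>I. \<tau> *\<^sub>R (u j * z * star (u j)))"
    using u zA A_rules by (intro sum.cong refl E1_e) auto
  also have "\<dots> = \<tau> *\<^sub>R index_map z" by (simp add: index_map_def scaleR_sum_right)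
  also have "\<dots> = tr z *\<^sub>C 1" using index[OF zN] E_N[OF zN] \<tau> by simp
  finally have "E1 w = tr z *\<^sub>C 1" .
  moreover have "E1 w = index_map (E1 y)"
    unfolding w_def index_map_def using u yA AA1 A1_rules A_rules
    by (simp add: dual.E_sum dual.E_left dual.E_right)
  ultimately have "tr z *\<^sub>C 1 = (1/\<tau>) *\<^sub>R F y" using index[OF E1_N[OF y]] by (simp add: F_def)
  then show ?thesis using left by (simp add: power2_eq_square)
qed

lemma F_central:
  assumes "y \<in> F.N" "a \<in> A1" shows "F (y * a) = F (a * y)"
  using F.central_if_index_map_scalar[OF index_map_F _ assms] \<tau> by simp

end

section \<open>The convolution product\<close>

locale two_step_extension = basic_extension A B E "{..<length ls}" "(!) ls" A1 e E1 \<tau>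
  for A B :: "'a::cstar_algebra set" and E :: "'a \<Rightarrow> 'a" and ls :: "'a list"
    and A1 :: "'a set" and e :: 'a and E1 :: "'a \<Rightarrow> 'a" and \<tau> :: real +
  fixes A2 :: "'a set" and e2 :: 'a and E2 :: "'a \<Rightarrow> 'a"
  assumes bc2: "basic_construction A A1 E1 A2 e2" and dual2: "dual_cond_exp \<tau> A1 A2 e2 E2"
begin

abbreviation I where "I \<equiv> {..<length ls}"
abbreviation u where "u \<equiv> (!) ls"
abbreviation M where "M \<equiv> F.N"

lemmas M_rules = F.N_rules
lemmas M_A1 = F.N_A

lemma
  shows A2: "cstar_subalgebra A2" and A1_A2: "A1 \<subseteq> A2"
    and e2_compress: "\<And>x. x \<in> A1 \<Longrightarrow> e2 * x * e2 = E1 x * e2"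
    and e2_comm: "\<And>a. a \<in> A \<Longrightarrow> e2 * a = a * e2"
  using bc2 unfolding basic_construction_def by auto

lemma E2_e2: "x \<in> A1 \<Longrightarrow> E2 (x * e2) = \<tau> *\<^sub>R x"
  using dual2 A1_rules(1) mult.right_neutral unfolding dual_cond_exp_def by metis

lemma E1_e1: "E1 e = \<tau> *\<^sub>R 1"
  using E1_e[of 1 1] A_rules by simp

lemma uA: "i \<in> I \<Longrightarrow> u i \<in> A"
  using u by simp

lemma comm_cond_exp_eq: "comm_cond_exp \<tau> ls x = \<tau> *\<^sub>R (\<Sum>i\<in>I. u i * x * star (u i))"
  by (simp add: comm_cond_exp_def sum_list_conv_sum_nth)

lemma \<tau>_powr: "\<tau> powr (-3/2) * \<tau> = 1 / sqrt \<tau>"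
proof -
  have "\<tau> powr (-3/2) * \<tau> = \<tau> powr (-3/2) * \<tau> powr 1" using \<tau> by simp
  also have "\<dots> = \<tau> powr (-1/2)" by (subst powr_add[symmetric]) simp
  finally show ?thesis using \<tau> by (simp add: powr_half_sqrt powr_minus_divide)
qed

lemma fourier1_eq: "fourier1 \<tau> ls e e2 x = (1 / sqrt \<tau>) *\<^sub>R (\<Sum>i\<in>I. u i * (x * e2 * e) * star (u i))"
  by (simp only: fourier1_def comm_cond_exp_eq scaleR_scaleR \<tau>_powr)

text \<open>As \<open>e * star (u i) * e = E (star (u i)) * e\<close>, the coefficients of \<open>1\<close> in the quasi-basis appear.
  They commute with \<open>y\<close> and \<open>e2\<close> and sum up with the \<open>u i\<close> to \<open>1\<close>. In particular the inverse
  Fourier transform in the convolution can be evaluated.\<close>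

lemma fourier1_mult_e_e2:
  assumes y: "y \<in> M" shows "fourier1 \<tau> ls e e2 y * e * e2 = sqrt \<tau> *\<^sub>R (y * e2)"
proof -
  have "u i * (y * e2 * e) * star (u i) * e * e2 = u i * E (star (u i)) * (\<tau> *\<^sub>R (y * e2))"
    if i: "i \<in> I" for i
  proof -
    have b: "E (star (u i)) \<in> B" using uA[OF i] A_rules E_in by simp
    have "u i * (y * e2 * e) * star (u i) * e * e2 = u i * y * e2 * (e * star (u i) * e) * e2"
      by (simp add: mult.assoc)
    also have "e * star (u i) * e = E (star (u i)) * e" using e_compress uA[OF i] A_rules by simp
    also have "u i * y * e2 * (E (star (u i)) * e) * e2 = u i * (y * (e2 * E (star (u i))) * e * e2)"
      by (simp add: mult.assoc)
    also have "y * (e2 * E (star (u i))) = E (star (u i)) * (y * e2)"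
      using e2_comm[OF BA'[OF b]] F.N_comm[OF y b] by (metis mult.assoc)
    also have "u i * (E (star (u i)) * (y * e2) * e * e2) = u i * E (star (u i)) * (y * (e2 * e * e2))"
      by (simp add: mult.assoc)
    also have "e2 * e * e2 = \<tau> *\<^sub>R e2" using e2_compress[OF e_A1] E1_e1 by simp
    finally show ?thesis by simp
  qed
  then have "(\<Sum>i\<in>I. u i * (y * e2 * e) * star (u i)) * e * e2
      = (\<Sum>i\<in>I. u i * E (star (u i) * 1)) * (\<tau> *\<^sub>R (y * e2))"
    unfolding sum_distrib_right by (intro sum.cong refl) simp
  also have "\<dots> = \<tau> *\<^sub>R (y * e2)" using basis[of 1] A_rules by simp
  finally have "fourier1 \<tau> ls e e2 y * e * e2 = (1 / sqrt \<tau> * \<tau>) *\<^sub>R (y * e2)"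
    by (simp add: fourier1_eq)
  moreover have "1 / sqrt \<tau> * \<tau> = sqrt \<tau>" using \<tau> by (simp add: real_div_sqrt)
  ultimately show ?thesis by simp
qed

text \<open>The convolution product multiplied by \<open>sqrt \<tau>\<close>, in a form that involves only the first step of
  the tower. For \<open>y = p * e * q\<close> with \<open>p\<close> and \<open>q\<close> in \<open>A\<close>, and \<open>z\<close> in \<open>M\<close>, it is \<open>\<tau> p z q\<close>: the
  convolution replaces the Jones projection in \<open>y\<close> by \<open>z\<close>.\<close>

definition conv :: "'a \<Rightarrow> 'a \<Rightarrow> 'a" where
  "conv y z = (\<Sum>i\<in>I. u i * z * E1 (e * (star (u i) * y)))"

lemma convolution_eq:
  assumes y: "y \<in> M" and z: "z \<in> M"
  shows "convolution \<tau> ls E2 e e2 y z = (1 / sqrt \<tau>) *\<^sub>R conv y z"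
proof -
  note rules = M_A1[OF y] M_A1[OF z] e_A1 A1_rules uA AA1 dual.E_in
  have "fourier1 \<tau> ls e e2 z * (y * e2)
      = (1 / sqrt \<tau>) *\<^sub>R (\<Sum>i\<in>I. u i * z * E1 (e * (star (u i) * y)) * e2)"
    unfolding fourier1_eq mult_scaleR_left sum_distrib_right
  proof (intro arg_cong[where f = "scaleR _"] sum.cong refl)
    fix i assume "i \<in> I"
    then have "e2 * (e * (star (u i) * y)) * e2 = E1 (e * (star (u i) * y)) * e2"
      using rules by (intro e2_compress) auto
    moreover have "u i * (z * e2 * e) * star (u i) * (y * e2)
        = u i * z * (e2 * (e * (star (u i) * y)) * e2)"
      by (simp add: mult.assoc)
    ultimately show "u i * (z * e2 * e) * star (u i) * (y * e2)
        = u i * z * E1 (e * (star (u i) * y)) * e2"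
      by (simp add: mult.assoc)
  qed
  also have "\<dots> = ((1 / sqrt \<tau>) *\<^sub>R conv y z) * e2"
    by (simp add: conv_def sum_distrib_right)
  finally have zy: "fourier1 \<tau> ls e e2 z * (y * e2) = ((1 / sqrt \<tau>) *\<^sub>R conv y z) * e2" .
  have cA1: "conv y z \<in> A1"
    unfolding conv_def using rules by (intro cstar_subalgebra_sum[OF A1]) auto
  have "fourier1 \<tau> ls e e2 z * fourier1 \<tau> ls e e2 y * e * e2
      = fourier1 \<tau> ls e e2 z * (sqrt \<tau> *\<^sub>R (y * e2))"
    using fourier1_mult_e_e2[OF y] by (metis mult.assoc)
  also have "\<dots> = sqrt \<tau> *\<^sub>R (((1 / sqrt \<tau>) *\<^sub>R conv y z) * e2)" by (simp only: mult_scaleR_right zy)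
  also have "\<dots> = conv y z * e2" using \<tau> by simp
  finally have "E2 (fourier1 \<tau> ls e e2 z * fourier1 \<tau> ls e e2 y * e * e2) = \<tau> *\<^sub>R conv y z"
    using E2_e2[OF cA1] by simp
  then show ?thesis
    by (simp only: convolution_def inv_fourier1_def scaleR_scaleR \<tau>_powr)
qed

text \<open>To commute \<open>b\<close> past \<open>conv y z\<close>, expand \<open>b * u i\<close> in the quasi-basis. The coefficients lie in \<open>B\<close>,
  so they pass \<open>z\<close> and \<open>e\<close>, and the sum over \<open>i\<close> collects them to \<open>star (u k) * b\<close>.\<close>

lemma conv_in_M:
  assumes y: "y \<in> M" and z: "z \<in> M" shows "conv y z \<in> M"
proof (rule rel_commutantI)
  note rules = M_A1[OF y] M_A1[OF z] e_A1 A1_rules uA AA1 dual.E_in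
  show "conv y z \<in> A1"
    unfolding conv_def using rules by (intro cstar_subalgebra_sum[OF A1]) auto
  show "b * conv y z = conv y z * b" if b: "b \<in> B" for b
  proof -
    note bA = BA'[OF b]
    have "b * conv y z
        = (\<Sum>i\<in>I. (\<Sum>k\<in>I. u k * E (star (u k) * (b * u i))) * z * E1 (e * (star (u i) * y)))"
      unfolding conv_def sum_distrib_left
      using uA bA A_rules by (intro sum.cong refl) (simp add: basis mult.assoc)
    also have "\<dots> = (\<Sum>i\<in>I. \<Sum>k\<in>I. u k * z * E1 (e * (E (star (u k) * b * u i) * star (u i) * y)))"
      unfolding sum_distrib_right
    proof (intro sum.cong refl)
      fix i k assume ik: "i \<in> I" "k \<in> I"
      define c where "c = E (star (u k) * b * u i)"
      have c: "c \<in> B" using ik uA bA A_rules E_in by (simp add: c_def)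
      have "c * E1 (e * (star (u i) * y)) = E1 (c * (e * (star (u i) * y)))"
        using dual.E_left[OF BA'[OF c]] rules ik by simp
      also have "c * (e * (star (u i) * y)) = e * (c * star (u i) * y)"
        using e_comm[OF c] by (metis mult.assoc)
      finally have "c * E1 (e * (star (u i) * y)) = E1 (e * (c * star (u i) * y))" .
      note W = this
      have "E (star (u k) * (b * u i)) = c" by (simp add: c_def mult.assoc)
      then have "u k * E (star (u k) * (b * u i)) * z * E1 (e * (star (u i) * y))
          = u k * (c * z) * E1 (e * (star (u i) * y))"
        by (simp add: mult.assoc)
      also have "\<dots> = u k * z * (c * E1 (e * (star (u i) * y)))"
        by (simp only: F.N_comm[OF z c] mult.assoc)
      finally show "u k * E (star (u k) * (b * u i)) * z * E1 (e * (star (u i) * y))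
          = u k * z * E1 (e * (E (star (u k) * b * u i) * star (u i) * y))"
        unfolding W unfolding c_def .
    qed
    also have "\<dots> = (\<Sum>k\<in>I. \<Sum>i\<in>I. u k * z * E1 (e * (E (star (u k) * b * u i) * star (u i) * y)))"
      by (rule sum.swap)
    also have "\<dots> = (\<Sum>k\<in>I. u k * z * E1 (e * (star (u k) * y) * b))"
    proof (rule sum.cong[OF refl])
      fix k assume k: "k \<in> I"
      have "(\<Sum>i\<in>I. E1 (e * (E (star (u k) * b * u i) * star (u i) * y)))
          = E1 (\<Sum>i\<in>I. e * (E (star (u k) * b * u i) * star (u i) * y))"
        using rules k bA A_rules E_in_A by (intro dual.E_sum[symmetric]) auto
      also have "(\<Sum>i\<in>I. e * (E (star (u k) * b * u i) * star (u i) * y)) = e * (star (u k) * b * y)"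
        using basis_right[of "star (u k) * b"] k uA bA A_rules
        by (simp only: sum_distrib_left[symmetric] sum_distrib_right[symmetric])
      also have "e * (star (u k) * b * y) = e * (star (u k) * y) * b"
        by (simp only: F.N_comm[OF y b] mult.assoc)
      finally show "(\<Sum>i\<in>I. u k * z * E1 (e * (E (star (u k) * b * u i) * star (u i) * y)))
          = u k * z * E1 (e * (star (u k) * y) * b)"
        by (simp add: sum_distrib_left[symmetric])
    qed
    also have "\<dots> = conv y z * b"
      unfolding conv_def sum_distrib_right
    proof (rule sum.cong[OF refl])
      fix k assume "k \<in> I"
      then have "E1 (e * (star (u k) * y) * b) = E1 (e * (star (u k) * y)) * b"
        using rules by (intro dual.E_right[OF bA]) simp
      then show "u k * z * E1 (e * (star (u k) * y) * b) = u k * z * E1 (e * (star (u k) * y)) * b"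
        by (simp only: mult.assoc)
    qed
    finally show ?thesis .
  qed
qed

lemma conv_add_left: "y \<in> A1 \<Longrightarrow> y' \<in> A1 \<Longrightarrow> conv (y + y') z = conv y z + conv y' z"
  using e_A1 A1_rules uA AA1
  by (simp add: conv_def distrib_left dual.E_add sum.distrib)

lemma conv_add_right: "conv y (z + z') = conv y z + conv y z'"
  by (simp add: conv_def distrib_left distrib_right sum.distrib)

lemma conv_scaleC_left: "y \<in> A1 \<Longrightarrow> conv (c *\<^sub>C y) z = c *\<^sub>C conv y z"
  using e_A1 A1_rules uA AA1
  by (simp add: conv_def mult_scaleC_right dual.E_scaleC complex_vector.scale_sum_right)

lemma conv_scaleC_right: "conv y (c *\<^sub>C z) = c *\<^sub>C conv y z"
  by (simp add: conv_def mult_scaleC_left mult_scaleC_right complex_vector.scale_sum_right)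

text \<open>The analogue of the Schur product theorem: the convolution of two Gram matrices is
  a sum of Gram matrices. Inserting \<open>1 = (\<Sum>m. u m * e * star (u m))\<close> between \<open>a\<close> and
  \<open>star a'\<close> splits the product.\<close>

lemma conv_mult_star:
  assumes a: "a \<in> A1" "a' \<in> A1" and z: "z \<in> M"
  shows "conv (a * star a') z
    = (1/\<tau>) *\<^sub>R (\<Sum>m\<in>I. E1 (a * u m * e) * z * star (E1 (a' * u m * e)))"
proof -
  note rules = a M_A1[OF z] e_A1 A1_rules uA AA1 dual.E_in E_in A_rules
  define p where "p m = E1 (a * u m * e)" for m
  define q where "q m = star (E1 (a' * u m * e))" for m
  have p: "p m \<in> A" if "m \<in> I" for m using rules that by (simp add: p_def)
  have q: "q m = E1 (e * star (u m) * star a')" if "m \<in> I" for m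
    using dual.E_star[of "a' * u m * e"] rules that
    by (simp add: q_def star_mult star_e mult.assoc)
  have "E1 (e * (star (u i) * (a * star a')))
      = (1/\<tau>) *\<^sub>R (\<Sum>m\<in>I. E (star (u i) * p m) * q m)" if i: "i \<in> I" for i
  proof -
    have "e * (star (u i) * (a * star a'))
        = e * (star (u i) * a * (\<Sum>m\<in>I. u m * e * star (u m)) * star a')"
      unfolding sum_e by (simp add: mult.assoc)
    also have "\<dots> = (\<Sum>m\<in>I. e * (star (u i) * a * (u m * e * star (u m)) * star a'))"
      by (simp only: sum_distrib_left sum_distrib_right)
    also have "\<dots> = (\<Sum>m\<in>I. (1/\<tau>) *\<^sub>R (E (star (u i) * p m) * (e * star (u m) * star a')))"
    proof (rule sum.cong[OF refl])
      fix m assume m: "m \<in> I"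
      have "(a * u m) * e = (1/\<tau>) *\<^sub>R (p m * e)"
        unfolding p_def using rules m by (intro push_down) auto
      moreover have "e * (star (u i) * a * (u m * e * star (u m)) * star a')
          = e * star (u i) * (a * u m * e) * star (u m) * star a'"
        by (simp add: mult.assoc)
      ultimately have "e * (star (u i) * a * (u m * e * star (u m)) * star a')
          = (1/\<tau>) *\<^sub>R (e * (star (u i) * p m) * e * star (u m) * star a')"
        by (simp add: mult.assoc)
      also have "e * (star (u i) * p m) * e = E (star (u i) * p m) * e"
        using rules p m i by (intro e_compress) auto
      finally show "e * (star (u i) * a * (u m * e * star (u m)) * star a')
          = (1/\<tau>) *\<^sub>R (E (star (u i) * p m) * (e * star (u m) * star a'))"
        by (simp add: mult.assoc)
    qed
    finally have "E1 (e * (star (u i) * (a * star a')))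
        = E1 (\<Sum>m\<in>I. (1/\<tau>) *\<^sub>R (E (star (u i) * p m) * (e * star (u m) * star a')))"
      by (rule arg_cong)
    also have "\<dots> = (\<Sum>m\<in>I. E1 ((1/\<tau>) *\<^sub>R (E (star (u i) * p m) * (e * star (u m) * star a'))))"
      using rules p i BA' by (intro dual.E_sum) simp
    also have "\<dots> = (\<Sum>m\<in>I. (1/\<tau>) *\<^sub>R (E (star (u i) * p m) * q m))"
    proof (rule sum.cong[OF refl])
      fix m assume m: "m \<in> I"
      have "E (star (u i) * p m) \<in> A" using rules p[OF m] i E_in_A by simp
      then show "E1 ((1/\<tau>) *\<^sub>R (E (star (u i) * p m) * (e * star (u m) * star a')))
          = (1/\<tau>) *\<^sub>R (E (star (u i) * p m) * q m)"
        using rules m by (simp add: dual.E_scaleR dual.E_left q)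
    qed
    finally show ?thesis by (simp add: scaleR_sum_right)
  qed
  then have "conv (a * star a') z
      = (\<Sum>i\<in>I. \<Sum>m\<in>I. (1/\<tau>) *\<^sub>R (u i * z * (E (star (u i) * p m) * q m)))"
    unfolding conv_def by (intro sum.cong refl) (simp add: scaleR_sum_right sum_distrib_left)
  also have "\<dots> = (\<Sum>m\<in>I. \<Sum>i\<in>I. (1/\<tau>) *\<^sub>R (u i * E (star (u i) * p m) * (z * q m)))"
  proof (subst sum.swap, intro sum.cong refl arg_cong[where f = "scaleR _"])
    fix m i assume "m \<in> I" "i \<in> I"
    then have "E (star (u i) * p m) * z = z * E (star (u i) * p m)"
      using F.N_comm[OF z] E_in p rules by simp
    from arg_cong[OF this, of "\<lambda>x. u i * x * q m"]
    show "u i * z * (E (star (u i) * p m) * q m) = u i * E (star (u i) * p m) * (z * q m)"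
      by (simp add: mult.assoc)
  qed
  also have "\<dots> = (\<Sum>m\<in>I. (1/\<tau>) *\<^sub>R (p m * (z * q m)))"
    using basis p by (simp add: scaleR_sum_right[symmetric] sum_distrib_right[symmetric])
  finally show ?thesis by (simp add: scaleR_sum_right p_def q_def mult.assoc)
qed

text \<open>The inequality behind complete positivity. Moving \<open>star (y q)\<close> to the right by the
  trace property turns the sum into the trace of \<open>(1/\<tau>) * (\<Sum>m. G m * star (G m))\<close>.\<close>

lemma conv_positive:
  assumes P: "finite P"
    and M: "\<And>p. p \<in> P \<Longrightarrow> y p \<in> M" "\<And>p. p \<in> P \<Longrightarrow> a p \<in> M" "\<And>p. p \<in> P \<Longrightarrow> b p \<in> M"
  shows "\<exists>s\<ge>0. (\<Sum>p\<in>P. \<Sum>q\<in>P.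
    F.tr (star (y q) * y p * conv (a p * star (a q)) (b p * star (b q)))) = of_real s"
proof -
  let ?c = "\<lambda>p q. conv (a p * star (a q)) (b p * star (b q))"
  have c: "?c p q \<in> M" if "p \<in> P" "q \<in> P" for p q
    using that M M_rules by (intro conv_in_M) simp_all
  define G where "G m = (\<Sum>p\<in>P. y p * E1 (a p * u m * e) * b p)" for m
  have GA1: "G m \<in> A1" if "m \<in> I" for m
    unfolding G_def using that M M_A1 uA AA1 e_A1 A1_rules dual.E_in
    by (intro cstar_subalgebra_sum[OF A1]) simp
  let ?X = "\<Sum>p\<in>P. \<Sum>q\<in>P. star (y q) * y p * ?c p q"
  have XM: "star (y q) * y p * ?c p q \<in> M" if "p \<in> P" "q \<in> P" for p q
    using that M M_rules c by simp
  have XM': "?X \<in> M" using XM by (intro F.N_sum)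
  have yA1: "y p \<in> A1" if "p \<in> P" for p using M(1)[OF that] M_A1 by blast
  have cA1: "?c p q \<in> A1" if "p \<in> P" "q \<in> P" for p q using c[OF that] M_A1 by blast
  have XA1: "star (y q) * y p * ?c p q \<in> A1" if "p \<in> P" "q \<in> P" for p q
    using XM[OF that] M_A1 by blast
  have "F ?X = (\<Sum>p\<in>P. \<Sum>q\<in>P. F (star (y q) * y p * ?c p q))"
    using XA1 by (simp add: F.E_sum cstar_subalgebra_sum[OF A1])
  also have "\<dots> = (\<Sum>p\<in>P. \<Sum>q\<in>P. F (y p * ?c p q * star (y q)))"
  proof (intro sum.cong refl)
    fix p q assume pq: "p \<in> P" "q \<in> P"
    have "F (star (y q) * (y p * ?c p q)) = F (y p * ?c p q * star (y q))"
      using pq M M_rules yA1 cA1 A1_rules by (intro F_central) simp_all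
    then show "F (star (y q) * y p * ?c p q) = F (y p * ?c p q * star (y q))"
      by (simp add: mult.assoc)
  qed
  also have "\<dots> = F (\<Sum>p\<in>P. \<Sum>q\<in>P. y p * ?c p q * star (y q))"
    using yA1 cA1 A1_rules by (simp add: F.E_sum cstar_subalgebra_sum[OF A1])
  also have "(\<Sum>p\<in>P. \<Sum>q\<in>P. y p * ?c p q * star (y q)) = (1/\<tau>) *\<^sub>R (\<Sum>m\<in>I. G m * star (G m))"
  proof -
    have "y p * ?c p q * star (y q) = (\<Sum>m\<in>I. (1/\<tau>) *\<^sub>R
        ((y p * E1 (a p * u m * e) * b p) * star (y q * E1 (a q * u m * e) * b q)))"
      if pq: "p \<in> P" "q \<in> P" for p q
    proof -
      have "b p * star (b q) \<in> M" using pq M M_rules by simp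
      then have "?c p q = (1/\<tau>) *\<^sub>R
          (\<Sum>m\<in>I. E1 (a p * u m * e) * (b p * star (b q)) * star (E1 (a q * u m * e)))"
        using pq M M_A1 by (intro conv_mult_star) auto
      then show ?thesis
        by (simp add: scaleR_sum_right sum_distrib_left sum_distrib_right star_mult mult.assoc)
    qed
    then have "(\<Sum>p\<in>P. \<Sum>q\<in>P. y p * ?c p q * star (y q))
        = (\<Sum>p\<in>P. \<Sum>q\<in>P. \<Sum>m\<in>I. (1/\<tau>) *\<^sub>R
            ((y p * E1 (a p * u m * e) * b p) * star (y q * E1 (a q * u m * e) * b q)))"
      by simp
    also have "\<dots> = (\<Sum>m\<in>I. \<Sum>p\<in>P. \<Sum>q\<in>P. (1/\<tau>) *\<^sub>R
            ((y p * E1 (a p * u m * e) * b p) * star (y q * E1 (a q * u m * e) * b q)))"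
      by (subst sum.swap[of _ I], subst sum.swap[of _ P I]) (rule refl)
    also have "\<dots> = (1/\<tau>) *\<^sub>R (\<Sum>m\<in>I. G m * star (G m))"
      unfolding G_def star_sum sum_product scaleR_sum_right ..
    finally show ?thesis .
  qed
  finally have FX: "F ?X = F ((1/\<tau>) *\<^sub>R (\<Sum>m\<in>I. G m * star (G m)))" .
  have "pos (G m * star (G m))" for m using pos_star_mult[of "star (G m)"] by (simp add: star_star)
  moreover have "G m * star (G m) \<in> A1" if "m \<in> I" for m using GA1[OF that] A1_rules by simp
  then have "(1/\<tau>) *\<^sub>R (\<Sum>m\<in>I. G m * star (G m)) \<in> A1"
    by (intro A1_rules(8) cstar_subalgebra_sum[OF A1])
  ultimately have "pos (F ?X)"
    unfolding FX using \<tau> by (intro F.E_pos pos_scaleR pos_sum) simp_all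
  then have "pos (F.tr ?X *\<^sub>C (1::'a))" using F.E_N[OF XM'] by simp
  from pos_scalarD[OF this] have "F.tr ?X = of_real (Re (F.tr ?X))" "0 \<le> Re (F.tr ?X)"
    by (auto simp: complex_eq_iff)
  moreover have "F.tr ?X = (\<Sum>p\<in>P. \<Sum>q\<in>P. F.tr (star (y q) * y p * ?c p q))"
    using XM by (simp add: F.tr_sum F.N_sum)
  ultimately show ?thesis by (intro exI[of _ "Re (F.tr ?X)"]) simp
qed

end

section \<open>Square roots in finite-dimensional star-algebras\<close>

text \<open>The element \<open>p(d) x\<close>. Since star-algebras are not assumed to have a unit, polynomials in \<open>d\<close> are
  formed as operators.\<close>

definition poly_act :: "'b::complex_star_algebra \<Rightarrow> complex poly \<Rightarrow> 'b \<Rightarrow> 'b" where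
  "poly_act d p x = fold_coeffs (\<lambda>c w. c *\<^sub>C x + d * w) p 0"

lemma poly_act_0 [simp]: "poly_act d 0 x = 0"
  by (simp add: poly_act_def)

lemma poly_act_pCons [simp]: "poly_act d (pCons c p) x = c *\<^sub>C x + d * poly_act d p x"
  by (cases "p = 0 \<and> c = 0") (auto simp: poly_act_def)

lemma poly_act_zero: "poly_act d p 0 = 0"
  by (induction p) simp_all

lemma poly_act_add: "poly_act d (p + q) x = poly_act d p x + poly_act d q x"
proof (induction p arbitrary: q)
  case (pCons a p)
  show ?case by (cases q) (simp add: pCons.IH scaleC_add_left distrib_left)
qed simp

lemma poly_act_smult: "poly_act d (smult c p) x = c *\<^sub>C poly_act d p x"
  by (induction p) (simp_all add: scaleC_add_right scaleC_scaleC mult_scaleC_right)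

lemma poly_act_sum: "poly_act d (sum f I) x = (\<Sum>i\<in>I. poly_act d (f i) x)"
  by (induction I rule: infinite_finite_induct) (simp_all add: poly_act_add)

lemma poly_act_diff: "poly_act d (p - q) x = poly_act d p x - poly_act d q x"
  using poly_act_add[of d "p - q" q x] by (simp add: algebra_simps)

lemma poly_act_mult: "poly_act d (p * q) x = poly_act d p (poly_act d q x)"
  by (induction p) (simp_all add: poly_act_add poly_act_smult)

lemma poly_act_right: "poly_act d p (x * y) = poly_act d p x * y"
  by (induction p) (simp_all add: distrib_right mult_scaleC_left mult.assoc)

lemma poly_act_left: "poly_act d p (d * x) = d * poly_act d p x"
  by (induction p) (simp_all add: distrib_left mult_scaleC_right)

lemma star_poly_act_real:
  assumes "star d = d"
  shows "star (poly_act d (map_poly complex_of_real p) d) = poly_act d (map_poly complex_of_real p) d"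
proof (induction p)
  case (pCons a p)
  let ?w = "poly_act d (map_poly complex_of_real p) d"
  have "?w * d = d * ?w" by (simp add: poly_act_right[symmetric] poly_act_left)
  then show ?case
    using pCons assms by (simp add: map_poly_pCons star_add star_scaleC star_mult)
qed simp

lemma poly_map_of_real: "poly (map_poly complex_of_real p) (of_real x) = of_real (poly p x)"
  by (induction p) (simp_all add: map_poly_pCons)

lemma prod_linear_dvd:
  fixes q :: "complex poly"
  assumes "finite R" "\<And>z. z \<in> R \<Longrightarrow> poly q z = 0"
  shows "(\<Prod>z\<in>R. [:-z, 1:]) dvd q"
  using assms
proof (induction R arbitrary: q rule: finite_induct)
  case (insert z R)
  then have "[:-z, 1:] dvd q" by (simp add: poly_eq_0_iff_dvd)
  then obtain r where r: "q = [:-z, 1:] * r" by (rule dvdE)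
  have "poly r y = 0" if "y \<in> R" for y
  proof -
    have "y \<noteq> z" using that insert by auto
    moreover have "poly q y = 0" using insert that by simp
    ultimately show ?thesis by (simp add: r)
  qed
  then have "(\<Prod>y\<in>R. [:-y, 1:]) dvd r" by (rule insert.IH)
  then show ?case unfolding r prod.insert[OF insert.hyps] by (rule mult_dvd_mono[OF dvd_refl])
qed simp

lemma interpolation:
  fixes f :: "real \<Rightarrow> real"
  assumes "finite R" shows "\<exists>h. \<forall>m\<in>R. poly h m = f m"
  using assms
proof (induction R rule: finite_induct)
  case (insert x R)
  then obtain h where h: "\<forall>m\<in>R. poly h m = f m" by blast
  define q where "q = (\<Prod>m\<in>R. [:-m, 1:])"
  have qx: "poly q x \<noteq> 0" using insert by (simp add: q_def poly_prod)
  have qR: "poly q m = 0" if "m \<in> R" for m using insert that by (auto simp: q_def poly_prod)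
  let ?h = "h + smult ((f x - poly h x) / poly q x) q"
  have "\<forall>m\<in>insert x R. poly ?h m = f m" using h qx qR by simp
  then show ?case by blast
qed simp

text \<open>Stated for sequences instead of sets, so that the coefficients can be read as those of a
  polynomial.\<close>

lemma linear_relation_of_sequence:
  fixes v :: "nat \<Rightarrow> 'b::complex_star_algebra"
  assumes G: "finite G" and v: "\<And>i. v i \<in> complex_vector.span G"
  shows "\<exists>c. (\<exists>i\<le>card G. c i \<noteq> 0) \<and> (\<Sum>i\<le>card G. c i *\<^sub>C v i) = 0"
proof (cases "inj_on v {..card G}")
  case True
  let ?V = "v ` {..card G}"
  have "\<not> complex_vector.independent ?V"
  proof
    assume "complex_vector.independent ?V"
    then have "card ?V \<le> card G"
      using complex_vector.independent_span_bound[OF G, of ?V] v by blast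
    then show False using card_image[OF True] by simp
  qed
  then obtain c where c: "\<exists>x\<in>?V. c x \<noteq> 0" "(\<Sum>x\<in>?V. c x *\<^sub>C x) = 0"
    using complex_vector.dependent_finite[of ?V] by blast
  have "(\<Sum>i\<le>card G. c (v i) *\<^sub>C v i) = 0"
    using c(2) by (simp add: sum.reindex[OF True])
  then show ?thesis using c(1) by (intro exI[of _ "\<lambda>i. c (v i)"]) auto
next
  case False
  then obtain i j where ij: "i \<le> card G" "j \<le> card G" "i \<noteq> j" "v i = v j"
    unfolding inj_on_def by auto
  define c where "c = (\<lambda>k. if k = i then 1 else if k = j then - 1 else (0::complex))"
  have "(\<Sum>k\<le>card G. c k *\<^sub>C v k) = (\<Sum>k\<le>card G. (if k = i then v i else 0) - (if k = j then v j else 0))"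
    using ij by (intro sum.cong) (auto simp: c_def)
  also have "\<dots> = 0" using ij by (simp add: sum_subtractf)
  finally show ?thesis using ij by (intro exI[of _ c]) (auto simp: c_def)
qed

text \<open>A finite-dimensional star-algebra with a faithful positive functional \<open>t\<close>; the inner
  product of \<open>t\<close> makes it a Hilbert space on which it acts by left multiplication.\<close>

locale finite_star_algebra =
  fixes S :: "'b::complex_star_algebra set" and t :: "'b \<Rightarrow> complex"
  assumes add_in: "\<And>x y. x \<in> S \<Longrightarrow> y \<in> S \<Longrightarrow> x + y \<in> S"
    and scaleC_in: "\<And>c x. x \<in> S \<Longrightarrow> c *\<^sub>C x \<in> S"
    and mult_in: "\<And>x y. x \<in> S \<Longrightarrow> y \<in> S \<Longrightarrow> x * y \<in> S"
    and star_in: "\<And>x. x \<in> S \<Longrightarrow> star x \<in> S"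
    and zero_in: "0 \<in> S"
    and t_add: "\<And>x y. x \<in> S \<Longrightarrow> y \<in> S \<Longrightarrow> t (x + y) = t x + t y"
    and t_scaleC: "\<And>c x. x \<in> S \<Longrightarrow> t (c *\<^sub>C x) = c * t x"
    and t_star: "\<And>x. x \<in> S \<Longrightarrow> t (star x) = cnj (t x)"
    and t_pos: "\<And>x. x \<in> S \<Longrightarrow> \<exists>r\<ge>0. t (star x * x) = of_real r"
    and t_faithful: "\<And>x. x \<in> S \<Longrightarrow> t (star x * x) = 0 \<Longrightarrow> x = 0"
    and finite_dim: "\<exists>G. finite G \<and> S \<subseteq> complex_vector.span G"
begin

lemma diff_in: "x \<in> S \<Longrightarrow> y \<in> S \<Longrightarrow> x - y \<in> S"
  using add_in[of x "- y"] scaleC_in[of y "- 1"] by simp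

lemma t_minus: "x \<in> S \<Longrightarrow> t (- x) = - t x"
  using t_scaleC[of x "- 1"] by simp

lemma t_diff: "x \<in> S \<Longrightarrow> y \<in> S \<Longrightarrow> t (x - y) = t x - t y"
  using t_add[of "x - y" y] diff_in by simp

lemma t_zero: "t 0 = 0"
  using t_scaleC[OF zero_in, of 0] by simp

lemma poly_act_in: "d \<in> S \<Longrightarrow> x \<in> S \<Longrightarrow> poly_act d p x \<in> S"
  by (induction p) (simp_all add: add_in scaleC_in mult_in zero_in)

text \<open>Polarization: an element whose quadratic form vanishes is zero.\<close>

lemma quadratic_form_eq_0:
  assumes h: "h \<in> S" and q: "\<And>w. w \<in> S \<Longrightarrow> t (star w * (h * w)) = 0"
  shows "h = 0"
proof -
  have polar: "t (star w * (h * v)) = 0" if w: "w \<in> S" and v: "v \<in> S" for w v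
  proof -
    note rules = h w v add_in scaleC_in mult_in star_in
    have sum0: "t (star w * (h * v)) + t (star v * (h * w)) = 0" if "v \<in> S" for v
    proof -
      have "star (w + v) * (h * (w + v)) = star w * (h * w) + star v * (h * v)
          + (star w * (h * v) + star v * (h * w))"
        by (simp add: star_add distrib_left distrib_right)
      then have "t (star (w + v) * (h * (w + v))) = t (star w * (h * w)) + t (star v * (h * v))
          + (t (star w * (h * v)) + t (star v * (h * w)))"
        using rules that by (simp add: t_add)
      then show ?thesis using q[of "w + v"] q[OF w] q[OF that] rules that by simp
    qed
    have "\<i> * t (star w * (h * v)) - \<i> * t (star v * (h * w)) = 0"
      using sum0[of "\<i> *\<^sub>C v"] rules
      by (simp add: star_scaleC mult_scaleC_left mult_scaleC_right t_scaleC t_minus)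
    then have "t (star w * (h * v)) = t (star v * (h * w))" by simp
    then show ?thesis using sum0[OF v] by simp
  qed
  have zero: "h * v = 0" if v: "v \<in> S" for v
    using polar[of "h * v" v] h v mult_in t_faithful[of "h * v"] by simp
  have "t (star (star h) * star h) = 0" using zero[OF star_in[OF h]] by (simp add: star_star t_zero)
  then have "star h = 0" by (rule t_faithful[OF star_in[OF h]])
  then show ?thesis by (metis star_star star_zero)
qed

text \<open>An element with nonnegative quadratic form is self-adjoint, so its minimal polynomial has
  simple positive roots, and a real polynomial that interpolates \<open>1 / sqrt m\<close> at the roots
  \<open>m\<close> yields a square root. The minimal polynomial is that of the vector \<open>d\<close>, that is,
  \<open>p(d) d = 0\<close>. The vector \<open>d\<close> is orthogonal to the kernel of left multiplication by \<open>d\<close>, so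
  the eigenvalue \<open>0\<close> does not occur.\<close>

lemma square_root_of_nonneg_form:
  assumes d: "d \<in> S" and nonneg: "\<And>w. w \<in> S \<Longrightarrow> \<exists>r\<ge>0. t (star w * (d * w)) = of_real r"
  shows "\<exists>y\<in>S. star y = y \<and> d = star y * y"
proof -
  note rules = d add_in scaleC_in mult_in star_in
  have "d - star d = 0"
  proof (rule quadratic_form_eq_0)
    show "d - star d \<in> S" using rules diff_in by simp
    show "t (star w * ((d - star d) * w)) = 0" if w: "w \<in> S" for w
    proof -
      obtain r where r: "t (star w * (d * w)) = of_real r" using nonneg[OF w] by blast
      have "star (star w * (d * w)) = star w * (star d * w)"
        by (simp add: star_mult star_star mult.assoc)
      then have "t (star w * (star d * w)) = of_real r"
        using t_star[of "star w * (d * w)"] rules w r by simp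
      moreover have "star w * ((d - star d) * w) = star w * (d * w) - star w * (star d * w)"
        by (simp add: left_diff_distrib right_diff_distrib)
      ultimately show ?thesis using rules w r by (simp add: t_diff)
    qed
  qed
  then have sd: "star d = d" by simp
  obtain G where G: "finite G" "S \<subseteq> complex_vector.span G" using finite_dim by blast
  have "\<exists>p. p \<noteq> 0 \<and> poly_act d p d = 0"
  proof -
    have "poly_act d (monom 1 i) d \<in> complex_vector.span G" for i
      using poly_act_in[OF d d] G(2) by blast
    then obtain c where c: "\<exists>i\<le>card G. c i \<noteq> 0"
      "(\<Sum>i\<le>card G. c i *\<^sub>C poly_act d (monom 1 i) d) = 0"
      using linear_relation_of_sequence[OF G(1), where v = "\<lambda>i. poly_act d (monom 1 i) d"] by auto
    obtain i where i: "i \<le> card G" "c i \<noteq> 0" using c(1) by blast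
    define p where "p = (\<Sum>i\<le>card G. smult (c i) (monom 1 i))"
    have "coeff p i = c i" using i(1) by (simp add: p_def coeff_sum if_distrib sum.delta cong: if_cong)
    then have "p \<noteq> 0" using i(2) by auto
    moreover have "poly_act d p d = 0" using c(2) by (simp add: p_def poly_act_sum poly_act_smult)
    ultimately show ?thesis by blast
  qed
  then obtain p where p: "p \<noteq> 0" "poly_act d p d = 0"
    and min: "\<And>q. q \<noteq> 0 \<Longrightarrow> degree q < degree p \<Longrightarrow> poly_act d q d \<noteq> 0"
    using exists_least_iff[of "\<lambda>n. \<exists>p. p \<noteq> 0 \<and> poly_act d p d = 0 \<and> degree p = n"] by metis
  have factor: "poly_act d r d \<noteq> 0" "d * poly_act d r d = z *\<^sub>C poly_act d r d"
    if r: "p = [:-z, 1:] * r" for z r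
  proof -
    have r0: "r \<noteq> 0" using p(1) r by auto
    then have "degree p = Suc (degree r)" unfolding r by (subst degree_mult_eq) auto
    then show "poly_act d r d \<noteq> 0" using min r0 by simp
    have "poly_act d [:-z, 1:] (poly_act d r d) = 0" using p(2) by (simp only: r poly_act_mult)
    then show "d * poly_act d r d = z *\<^sub>C poly_act d r d" by simp
  qed
  \<comment> \<open>Roots are eigenvalues of the left multiplication by \<open>d\<close>, with eigenvector \<open>r(d) d\<close>.\<close>
  have root: "\<exists>m>0. z = complex_of_real m" if z: "poly p z = 0" for z
  proof -
    obtain r where r: "p = [:-z, 1:] * r" using z by (auto simp: poly_eq_0_iff_dvd elim: dvdE)
    define w where "w = poly_act d r d"
    have w: "w \<in> S" "w \<noteq> 0" "d * w = z *\<^sub>C w"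
      using factor[OF r] poly_act_in[OF d d] by (auto simp: w_def)
    obtain a where a: "a \<ge> 0" "t (star w * (d * w)) = of_real a" using nonneg w by blast
    obtain b where b: "b \<ge> 0" "t (star w * w) = of_real b" using t_pos w by blast
    have b0: "b \<noteq> 0" using t_faithful[OF w(1)] w(2) b by auto
    have "z * of_real b = of_real a"
      using a(2) b(2) rules w by (simp add: mult_scaleC_right t_scaleC)
    then have zab: "z = of_real (a / b)" using b0 by (simp add: field_simps)
    have "z \<noteq> 0"
    proof
      assume "z = 0"
      then have "star (d * w) = 0" using w(3) by simp
      then have wd: "star w * d = 0" by (simp add: star_mult sd)
      have "star w * w = 0"
      proof (cases r)
        case (pCons c r')
        then have "w = c *\<^sub>C d + d * poly_act d r' d" by (simp add: w_def)
        then have "star w * w = c *\<^sub>C (star w * d) + star w * d * poly_act d r' d"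
          by (metis distrib_left mult.assoc mult_scaleC_right)
        then show ?thesis by (simp add: wd)
      qed
      then show False using t_faithful[OF w(1)] w(2) t_zero by simp
    qed
    then have "a / b > 0" using zab a b b0 by (cases "a = 0") auto
    then show ?thesis using zab by blast
  qed
  \<comment> \<open>A double root would give a vector \<open>w \<noteq> 0\<close> in the kernel and in the range of the self-adjoint
    operator \<open>d - z\<close>.\<close>
  have simple: "r = 0" if r: "p = [:-z, 1:] * ([:-z, 1:] * r)" for z r
  proof -
    obtain m where m: "z = complex_of_real m" using root[of z] r by auto
    define v where "v = poly_act d r d"
    define w where "w = poly_act d ([:-z, 1:] * r) d"
    have w: "w \<in> S" "w \<noteq> 0" "d * w = z *\<^sub>C w"
      using factor[OF r] poly_act_in[OF d d] by (auto simp: w_def)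
    have "w = poly_act d [:-z, 1:] v" unfolding w_def v_def by (rule poly_act_mult)
    then have wv: "w = d * v - z *\<^sub>C v" by simp
    have "star w * d = z *\<^sub>C star w"
      using arg_cong[OF w(3), of star] by (simp add: star_mult star_scaleC sd m)
    then have "star w * (d * v) = z *\<^sub>C (star w * v)" by (metis mult.assoc mult_scaleC_left)
    then have "star w * w = 0" by (subst (2) wv) (simp add: right_diff_distrib mult_scaleC_right)
    then show ?thesis using t_faithful[OF w(1)] w(2) t_zero by simp
  qed
  let ?R = "{z. poly p z = 0}"
  have finR: "finite ?R" using p(1) by (rule poly_roots_finite)
  have order: "order z p = 1" if "z \<in> ?R" for z
  proof (rule ccontr)
    assume "order z p \<noteq> 1"
    moreover have "order z p \<noteq> 0" using that p(1) by (simp add: order_root)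
    ultimately have "[:-z, 1:] ^ 2 dvd p" using order_divides[of z 2 p] by simp
    then obtain r where "p = [:-z, 1:] ^ 2 * r" by (rule dvdE)
    then have "p = [:-z, 1:] * ([:-z, 1:] * r)" by (simp only: power2_eq_square mult.assoc)
    from simple[OF this] this p(1) show False by simp
  qed
  have "p = smult (lead_coeff p) (\<Prod>z\<in>?R. [:-z, 1:] ^ order z p)"
    by (rule complex_poly_decompose[symmetric])
  also have "(\<Prod>z\<in>?R. [:-z, 1:] ^ order z p) = (\<Prod>z\<in>?R. [:-z, 1:])"
    using order by (intro prod.cong) auto
  finally have pdvd: "p dvd q" if "(\<Prod>z\<in>?R. [:-z, 1:]) dvd q" for q
    using that p(1) by (metis leading_coeff_0_iff smult_dvd_iff)
  obtain h where h: "\<And>m. m \<in> Re ` ?R \<Longrightarrow> poly h m = 1 / sqrt m"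
    using interpolation[of "Re ` ?R" "\<lambda>m. 1 / sqrt m"] finR by auto
  define H where "H = map_poly complex_of_real h"
  have "poly ([:0, 1:] * H * H - 1) z = 0" if z: "z \<in> ?R" for z
  proof -
    obtain m where m: "m > 0" "z = complex_of_real m" using root z by blast
    have "m \<in> Re ` ?R" using z m by force
    then have "poly H z = of_real (1 / sqrt m)" by (simp add: H_def m(2) poly_map_of_real h)
    moreover have "m * (1 / sqrt m) * (1 / sqrt m) = 1" using m(1) by (simp add: field_simps)
    ultimately obtain c where c: "poly H z = of_real c" "m * c * c = 1" by blast
    have "poly ([:0, 1:] * H * H - 1) z = of_real (m * c * c - 1)"
      by (simp add: m(2) c(1)[unfolded m(2)])
    then show ?thesis using c(2) by simp
  qed
  then have "p dvd [:0, 1:] * H * H - 1" using finR by (intro pdvd prod_linear_dvd) auto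
  then obtain s where "[:0, 1:] * H * H - 1 = s * p" by (metis dvdE mult.commute)
  then have HH: "poly_act d ([:0, 1:] * H * H - 1) d = 0"
    by (simp only: poly_act_mult p(2) poly_act_zero)
  define y where "y = poly_act d H d"
  have sy: "star y = y" unfolding y_def H_def by (rule star_poly_act_real[OF sd])
  have "poly_act d ([:0, 1:] * H * H) d = d"
  proof -
    have "poly_act d 1 d = d" by (simp add: one_pCons scaleC_one)
    then show ?thesis using HH by (simp add: poly_act_diff)
  qed
  moreover have "poly_act d ([:0, 1:] * H * H) d = y * y"
  proof -
    have "y * y = poly_act d H (d * y)" by (simp add: y_def poly_act_right)
    also have "\<dots> = d * poly_act d H y" by (rule poly_act_left)
    also have "\<dots> = poly_act d ([:0, 1:] * H * H) d"
      by (simp only: poly_act_mult y_def) simp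
    finally show ?thesis ..
  qed
  ultimately have "d = star y * y" by (simp add: sy)
  then show ?thesis using sy poly_act_in[OF d d] by (auto simp: y_def)
qed

end

section \<open>Linear functionals on the algebraic tensor product\<close>

lemma tensor_simps:
  "(x + x') \<otimes> y = x \<otimes> y + x' \<otimes> y"
  "x \<otimes> (y + y') = x \<otimes> y + x \<otimes> y'"
  "(c *\<^sub>C x) \<otimes> y = c *\<^sub>C (x \<otimes> y)"
  "x \<otimes> (c *\<^sub>C y) = c *\<^sub>C (x \<otimes> y)"
  "(x \<otimes> y) * (x' \<otimes> y') = (x * x') \<otimes> (y * y')"
  "star (x \<otimes> y) = star x \<otimes> star y"
  by (transfer, simp add: tensor_rel_def bilinear_form_simps list_mult_def)+

lemma tensor_zero [simp]: "0 \<otimes> y = 0" "x \<otimes> 0 = 0"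
  using tensor_simps(3)[of 0 0 y] tensor_simps(4)[of x 0 0] by simp_all

lemma tensor_sum_left: "(\<Sum>i\<in>I. f i) \<otimes> y = (\<Sum>i\<in>I. f i \<otimes> y)"
  by (induction I rule: infinite_finite_induct) (simp_all add: tensor_simps)

lemma tensor_sum_right: "x \<otimes> (\<Sum>i\<in>I. f i) = (\<Sum>i\<in>I. x \<otimes> f i)"
  by (induction I rule: infinite_finite_induct) (simp_all add: tensor_simps)

definition tensor_functional ::
    "('a::complex_star_algebra \<Rightarrow> 'b::complex_star_algebra \<Rightarrow> complex) \<Rightarrow> ('a, 'b) tensor \<Rightarrow> complex"
  where "tensor_functional \<beta> u = form_sum \<beta> (rep_tensor u)"

lemma tensor_functional_abs:
  assumes "bilinear_form \<beta>"
  shows "tensor_functional \<beta> (abs_tensor us) = form_sum \<beta> us"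
proof -
  have "tensor_rel (rep_tensor (abs_tensor us)) us"
    using Quotient3_tensor unfolding Quotient3_def by (metis tensor.abs_eq_iff)
  then show ?thesis using assms by (simp add: tensor_functional_def tensor_rel_def)
qed

lemma tensor_functional_simps:
  assumes \<beta>: "bilinear_form \<beta>"
  shows "tensor_functional \<beta> (u + v) = tensor_functional \<beta> u + tensor_functional \<beta> v"
    "tensor_functional \<beta> (c *\<^sub>C u) = c * tensor_functional \<beta> u"
    "tensor_functional \<beta> (x \<otimes> y) = \<beta> x y"
proof -
  note abs = tensor_functional_abs[OF \<beta>]
  show "tensor_functional \<beta> (x \<otimes> y) = \<beta> x y" by (simp add: tensor.abs_eq abs)
  obtain us vs where u: "u = abs_tensor us" and v: "v = abs_tensor vs"
    using Quotient3_abs_rep[OF Quotient3_tensor] by metis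
  show "tensor_functional \<beta> (u + v) = tensor_functional \<beta> u + tensor_functional \<beta> v"
    by (simp add: u v plus_tensor.abs_eq abs)
  show "tensor_functional \<beta> (c *\<^sub>C u) = c * tensor_functional \<beta> u"
    using \<beta> by (simp add: u scaleC_tensor.abs_eq abs form_sum_map bilinear_form_simps form_sum_cmult)
qed

text \<open>The bilinear forms in the definition of the tensor product live on the ambient space,
  so a functional on a subspace has to be extended.\<close>

lemma functional_extension:
  fixes M :: "'a::complex_star_algebra set" and f :: "'a \<Rightarrow> complex"
  assumes M: "complex_vector.subspace M"
    and add: "\<And>x y. x \<in> M \<Longrightarrow> y \<in> M \<Longrightarrow> f (x + y) = f x + f y"
    and scale: "\<And>c x. x \<in> M \<Longrightarrow> f (c *\<^sub>C x) = c * f x"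
  obtains g where "\<And>x y. g (x + y) = g x + g y" "\<And>c x. g (c *\<^sub>C x) = c * g x"
    "\<And>x. x \<in> M \<Longrightarrow> g x = f x"
proof -
  interpret pair: vector_space_pair "scaleC :: complex \<Rightarrow> 'a \<Rightarrow> 'a" "(*) :: complex \<Rightarrow> complex \<Rightarrow> complex"
    by unfold_locales (simp_all add: algebra_simps)
  obtain K where K: "K \<subseteq> M" "complex_vector.independent K" "M \<subseteq> complex_vector.span K"
    using complex_vector.maximal_independent_subset[of M] by blast
  obtain g where g: "Vector_Spaces.linear scaleC (*) g" "\<forall>x\<in>K. g x = f x"
    using pair.linear_independent_extend[OF K(2), of f] by blast
  interpret g: Vector_Spaces.linear "scaleC :: complex \<Rightarrow> 'a \<Rightarrow> 'a" "(*)" g by (rule g(1))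
  have f0: "f 0 = 0" using scale[of 0 0] complex_vector.subspace_0[OF M] by simp
  have "x \<in> M \<and> g x = f x" if "x \<in> complex_vector.span K" for x
    using that
  proof (induction rule: complex_vector.span_induct_alt)
    case base
    then show ?case using f0 g.zero complex_vector.subspace_0[OF M] by simp
  next
    case (step c x y)
    then have "c *\<^sub>C x \<in> M" "x \<in> M" using K(1) M complex_vector.subspace_scale by blast+
    then show ?case using step g(2) M
      by (simp add: g.add g.scale add scale complex_vector.subspace_add)
  qed
  then show ?thesis using that[of g] g.add g.scale K(3) by blast
qed

section \<open>The tensor square of a finite-dimensional algebra with a trace\<close>

locale trace_algebra =
  fixes M :: "'a::complex_star_algebra set" and tr :: "'a \<Rightarrow> complex"
    and m :: nat and x :: "nat \<Rightarrow> 'a"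
  assumes add_in: "\<And>a b. a \<in> M \<Longrightarrow> b \<in> M \<Longrightarrow> a + b \<in> M"
    and scaleC_in: "\<And>c a. a \<in> M \<Longrightarrow> c *\<^sub>C a \<in> M"
    and mult_in: "\<And>a b. a \<in> M \<Longrightarrow> b \<in> M \<Longrightarrow> a * b \<in> M"
    and star_in: "\<And>a. a \<in> M \<Longrightarrow> star a \<in> M"
    and zero_in: "0 \<in> M"
    and tr_add: "\<And>a b. a \<in> M \<Longrightarrow> b \<in> M \<Longrightarrow> tr (a + b) = tr a + tr b"
    and tr_scaleC: "\<And>c a. a \<in> M \<Longrightarrow> tr (c *\<^sub>C a) = c * tr a"
    and tr_star: "\<And>a. a \<in> M \<Longrightarrow> tr (star a) = cnj (tr a)"
    and tr_comm: "\<And>a b. a \<in> M \<Longrightarrow> b \<in> M \<Longrightarrow> tr (a * b) = tr (b * a)"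
    and x_in: "\<And>j. j < m \<Longrightarrow> x j \<in> M"
    and orth: "\<And>i j. i < m \<Longrightarrow> j < m \<Longrightarrow> tr (star (x i) * x j) = (if i = j then 1 else 0)"
    and expansion: "\<And>a. a \<in> M \<Longrightarrow> a = (\<Sum>j<m. tr (star (x j) * a) *\<^sub>C x j)"
begin

lemma M_subspace: "complex_vector.subspace M"
  unfolding complex_vector.subspace_def using add_in scaleC_in zero_in by blast

lemma sum_in: "(\<And>i. i \<in> I \<Longrightarrow> f i \<in> M) \<Longrightarrow> sum f I \<in> M"
  using complex_vector.subspace_sum[OF M_subspace] by blast

lemma tr_zero: "tr 0 = 0"
  using tr_scaleC[OF zero_in, of 0] by simp

lemma tr_sum: "(\<And>i. i \<in> I \<Longrightarrow> f i \<in> M) \<Longrightarrow> tr (sum f I) = (\<Sum>i\<in>I. tr (f i))"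
  by (induction I rule: infinite_finite_induct) (simp_all add: tr_zero tr_add sum_in)

abbreviation T where "T \<equiv> tensor_prod M M"

definition ext :: "'a \<Rightarrow> complex" where
  "ext = (SOME g. (\<forall>a b. g (a + b) = g a + g b) \<and> (\<forall>c a. g (c *\<^sub>C a) = c * g a) \<and> (\<forall>a\<in>M. g a = tr a))"

lemma ext: "ext (a + b) = ext a + ext b" "ext (c *\<^sub>C a) = c * ext a" "a \<in> M \<Longrightarrow> ext a = tr a"
proof -
  obtain g where "\<And>a b. g (a + b) = g a + g b" "\<And>c a. g (c *\<^sub>C a) = c * g a" "\<And>a. a \<in> M \<Longrightarrow> g a = tr a"
    using functional_extension[OF M_subspace tr_add tr_scaleC] by blast
  then have "\<exists>g. (\<forall>a b. g (a + b) = g a + g b) \<and> (\<forall>c a. g (c *\<^sub>C a) = c * g a) \<and> (\<forall>a\<in>M. g a = tr a)"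
    by blast
  from someI_ex[OF this] show "ext (a + b) = ext a + ext b" "ext (c *\<^sub>C a) = c * ext a"
    "a \<in> M \<Longrightarrow> ext a = tr a" unfolding ext_def[symmetric] by blast+
qed

text \<open>On \<open>T\<close> this is \<open>tr \<otimes> tr\<close>, as \<open>ext\<close> is a linear extension of \<open>tr\<close> to the whole type.\<close>

definition \<omega> :: "('a, 'a) tensor \<Rightarrow> complex" where
  "\<omega> = tensor_functional (\<lambda>a b. ext a * ext b)"

lemma bilinear_ext: "bilinear_form (\<lambda>a b. ext a * ext b)"
  by (simp add: bilinear_form_def ext algebra_simps)

lemma \<omega>_add: "\<omega> (u + v) = \<omega> u + \<omega> v"
  and \<omega>_scaleC: "\<omega> (c *\<^sub>C u) = c * \<omega> u"
  by (simp_all add: \<omega>_def tensor_functional_simps[OF bilinear_ext])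

lemma \<omega>_tensor: "a \<in> M \<Longrightarrow> b \<in> M \<Longrightarrow> \<omega> (a \<otimes> b) = tr a * tr b"
  by (simp add: \<omega>_def tensor_functional_simps[OF bilinear_ext] ext)

lemma \<omega>_zero: "\<omega> 0 = 0"
  using \<omega>_scaleC[of 0 0] by simp

lemma \<omega>_sum: "\<omega> (sum f I) = (\<Sum>i\<in>I. \<omega> (f i))"
  by (induction I rule: infinite_finite_induct) (simp_all add: \<omega>_zero \<omega>_add)

lemma \<omega>_diff: "\<omega> (u - v) = \<omega> u - \<omega> v"
  using \<omega>_add[of "u - v" v] by simp

lemma T_subspace: "complex_vector.subspace T"
  unfolding tensor_prod_def by (rule complex_vector.subspace_span)

lemmas T_add = complex_vector.subspace_add[OF T_subspace]
lemmas T_diff = complex_vector.subspace_diff[OF T_subspace]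
lemmas T_scaleC = complex_vector.subspace_scale[OF T_subspace]
lemmas T_zero = complex_vector.subspace_0[OF T_subspace]
lemmas T_sum = complex_vector.subspace_sum[OF T_subspace]

lemma T_tensor: "a \<in> M \<Longrightarrow> b \<in> M \<Longrightarrow> a \<otimes> b \<in> T"
  unfolding tensor_prod_def by (intro complex_vector.span_base) blast

lemma T_induct [consumes 1, case_names zero tensor add]:
  assumes "u \<in> T" "P 0"
    and "\<And>a b. a \<in> M \<Longrightarrow> b \<in> M \<Longrightarrow> P (a \<otimes> b)"
    and "\<And>u v. u \<in> T \<Longrightarrow> v \<in> T \<Longrightarrow> P u \<Longrightarrow> P v \<Longrightarrow> P (u + v)"
  shows "P u"
proof -
  have "u \<in> T \<and> P u"
    using assms(1) unfolding tensor_prod_def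
  proof (induction rule: complex_vector.span_induct_alt)
    case base
    then show ?case using assms(2) T_zero unfolding tensor_prod_def by blast
  next
    case (step c v w)
    then obtain a b where ab: "v = a \<otimes> b" "a \<in> M" "b \<in> M" by blast
    have v: "c *\<^sub>C v = (c *\<^sub>C a) \<otimes> b" by (simp add: ab tensor_simps)
    then have "P (c *\<^sub>C v)" "c *\<^sub>C v \<in> T" using assms(3) T_tensor ab scaleC_in by simp_all
    then show ?case
      using step assms(4) T_add unfolding tensor_prod_def by blast
  qed
  then show ?thesis ..
qed

lemma T_star: "u \<in> T \<Longrightarrow> star u \<in> T"
  by (induction rule: T_induct) (simp_all add: T_zero T_tensor T_add star_add tensor_simps star_in)

lemma T_mult:
  assumes "u \<in> T" "v \<in> T" shows "u * v \<in> T"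
  using assms(1)
proof (induction rule: T_induct)
  case (tensor a b)
  from assms(2) show ?case
    by (induction rule: T_induct)
      (simp_all add: tensor T_zero T_tensor T_add distrib_left tensor_simps mult_in)
qed (simp_all add: T_zero T_add distrib_right)

lemma \<omega>_star: "u \<in> T \<Longrightarrow> \<omega> (star u) = cnj (\<omega> u)"
  by (induction rule: T_induct)
    (simp_all add: \<omega>_zero \<omega>_add star_add tensor_simps \<omega>_tensor star_in tr_star)

lemma \<omega>_comm:
  assumes "u \<in> T" "v \<in> T" shows "\<omega> (u * v) = \<omega> (v * u)"
  using assms(1)
proof (induction rule: T_induct)
  case (tensor a b)
  from assms(2) show ?case
    by (induction rule: T_induct)
      (simp_all add: tensor \<omega>_zero \<omega>_add distrib_left distrib_right tensor_simps \<omega>_tensor mult_in tr_comm)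
qed (simp_all add: \<omega>_zero \<omega>_add distrib_left distrib_right)

definition basis2 :: "nat \<Rightarrow> nat \<Rightarrow> ('a, 'a) tensor" where
  "basis2 i j = x i \<otimes> x j"

lemma basis2_in: "i < m \<Longrightarrow> j < m \<Longrightarrow> basis2 i j \<in> T"
  by (simp add: basis2_def T_tensor x_in)

lemma \<omega>_basis2:
  "a \<in> M \<Longrightarrow> b \<in> M \<Longrightarrow> i < m \<Longrightarrow> j < m \<Longrightarrow>
    \<omega> (star (basis2 i j) * (a \<otimes> b)) = tr (star (x i) * a) * tr (star (x j) * b)"
  by (simp add: basis2_def tensor_simps \<omega>_tensor mult_in star_in x_in)

lemma T_expansion:
  assumes "u \<in> T"
  shows "u = (\<Sum>i<m. \<Sum>j<m. \<omega> (star (basis2 i j) * u) *\<^sub>C basis2 i j)"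
  using assms
proof (induction rule: T_induct)
  case (tensor a b)
  have "a \<otimes> b = (\<Sum>i<m. tr (star (x i) * a) *\<^sub>C x i) \<otimes> (\<Sum>j<m. tr (star (x j) * b) *\<^sub>C x j)"
    using expansion tensor by metis
  also have "\<dots> = (\<Sum>i<m. \<Sum>j<m. \<omega> (star (basis2 i j) * (a \<otimes> b)) *\<^sub>C basis2 i j)"
    unfolding tensor_sum_left unfolding tensor_sum_right using tensor
    by (intro sum.cong refl) (simp only: tensor_simps(3,4) \<omega>_basis2 lessThan_iff scaleC_scaleC, simp add: basis2_def)
  finally show ?case .
next
  case (add u v)
  have "(\<Sum>i<m. \<Sum>j<m. \<omega> (star (basis2 i j) * (u + v)) *\<^sub>C basis2 i j)
    = (\<Sum>i<m. \<Sum>j<m. \<omega> (star (basis2 i j) * u) *\<^sub>C basis2 i j)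
      + (\<Sum>i<m. \<Sum>j<m. \<omega> (star (basis2 i j) * v) *\<^sub>C basis2 i j)"
    by (simp add: distrib_left \<omega>_add scaleC_add_left sum.distrib)
  then show ?case using add by simp
qed (simp add: \<omega>_zero)

text \<open>Parseval's identity for the orthonormal basis \<open>basis2\<close>.\<close>

lemma \<omega>_star_mult:
  assumes u: "u \<in> T"
  shows "\<omega> (star u * u) = of_real (\<Sum>i<m. \<Sum>j<m. (cmod (\<omega> (star (basis2 i j) * u)))\<^sup>2)"
proof -
  have "\<omega> (star u * u)
      = \<omega> (star u * (\<Sum>i<m. \<Sum>j<m. \<omega> (star (basis2 i j) * u) *\<^sub>C basis2 i j))"
    using T_expansion[OF u] by simp
  also have "\<dots> = (\<Sum>i<m. \<Sum>j<m. \<omega> (star (basis2 i j) * u) * \<omega> (star u * basis2 i j))"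
    by (simp add: sum_distrib_left mult_scaleC_right \<omega>_sum \<omega>_scaleC)
  also have "\<dots> = (\<Sum>i<m. \<Sum>j<m. of_real ((cmod (\<omega> (star (basis2 i j) * u)))\<^sup>2))"
  proof (intro sum.cong refl)
    fix i j assume "i \<in> {..<m}" "j \<in> {..<m}"
    then have "star (basis2 i j) * u \<in> T" using basis2_in u T_mult T_star by simp
    from \<omega>_star[OF this] have "\<omega> (star u * basis2 i j) = cnj (\<omega> (star (basis2 i j) * u))"
      by (simp add: star_mult star_star)
    then show "\<omega> (star (basis2 i j) * u) * \<omega> (star u * basis2 i j)
        = of_real ((cmod (\<omega> (star (basis2 i j) * u)))\<^sup>2)"
      by (simp add: complex_norm_square flip: of_real_power)
  qed
  finally show ?thesis by simp
qed

lemma \<omega>_pos: "u \<in> T \<Longrightarrow> \<exists>r\<ge>0. \<omega> (star u * u) = of_real r"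
  by (intro exI[of _ "\<Sum>i<m. \<Sum>j<m. (cmod (\<omega> (star (basis2 i j) * u)))\<^sup>2"] conjI
      sum_nonneg zero_le_power2 \<omega>_star_mult)

lemma T_eq_0I:
  assumes "u \<in> T" "\<And>i j. i < m \<Longrightarrow> j < m \<Longrightarrow> \<omega> (star (basis2 i j) * u) = 0"
  shows "u = 0"
  using T_expansion[OF assms(1)] assms(2) by simp

lemma T_eqI:
  assumes d: "d \<in> T" "d' \<in> T"
    and eq: "\<And>a b. a \<in> M \<Longrightarrow> b \<in> M \<Longrightarrow> \<omega> (star d * (a \<otimes> b)) = \<omega> (star d' * (a \<otimes> b))"
  shows "d = d'"
proof -
  have "d - d' = 0"
  proof (rule T_eq_0I)
    show dT: "d - d' \<in> T" using d T_diff by blast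
    show "\<omega> (star (basis2 i j) * (d - d')) = 0" if ij: "i < m" "j < m" for i j
    proof -
      have "\<omega> (star (d - d') * basis2 i j) = 0"
        using eq x_in[OF ij(1)] x_in[OF ij(2)]
        by (simp add: basis2_def star_diff left_diff_distrib \<omega>_diff)
      then show ?thesis
        using \<omega>_star[of "star (d - d') * basis2 i j"] dT basis2_in[OF ij] T_mult T_star
        by (simp add: star_mult star_star)
    qed
  qed
  then show ?thesis by simp
qed

lemma \<omega>_faithful:
  assumes u: "u \<in> T" and "\<omega> (star u * u) = 0" shows "u = 0"
proof (rule T_eq_0I[OF u])
  have "(\<Sum>i<m. \<Sum>j<m. (cmod (\<omega> (star (basis2 i j) * u)))\<^sup>2) = 0"
    using \<omega>_star_mult[OF u] assms(2) by (metis of_real_eq_0_iff)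
  then show "\<omega> (star (basis2 i j) * u) = 0" if "i < m" "j < m" for i j
    using that by (simp add: sum_nonneg_eq_0_iff sum_nonneg)
qed

lemma tensor_sum_simps [simp]: "tensor_sum [] = 0" "tensor_sum ((a, b) # us) = a \<otimes> b + tensor_sum us"
  by (simp_all add: tensor_sum_def)

lemma T_tensor_sum: "u \<in> T \<Longrightarrow> \<exists>us. set us \<subseteq> M \<times> M \<and> u = tensor_sum us"
proof (induction rule: T_induct)
  case zero
  show ?case by (rule exI[of _ "[]"]) simp
next
  case (tensor a b)
  then show ?case by (intro exI[of _ "[(a, b)]"]) simp
next
  case (add u v)
  then obtain us vs where "set us \<subseteq> M \<times> M" "u = tensor_sum us" "set vs \<subseteq> M \<times> M" "v = tensor_sum vs"
    by blast
  then show ?case by (intro exI[of _ "us @ vs"]) (auto simp: tensor_sum_def)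
qed

text \<open>The right-hand side does not refer to representations by elementary tensors, which makes the
  description in the definition unique.\<close>

lemma tensor_inner_eq:
  assumes "u \<in> T" "v \<in> T"
  shows "tensor_inner M M (\<lambda>a b. tr (star a * b)) (\<lambda>a b. tr (star a * b)) u v = \<omega> (star u * v)"
  unfolding tensor_inner_def
proof (rule the_equality)
  have inner: "(\<Sum>(c, d)\<leftarrow>vs. tr (star a * c) * tr (star b * d)) = \<omega> (star (a \<otimes> b) * tensor_sum vs)"
    if "a \<in> M" "b \<in> M" "set vs \<subseteq> M \<times> M" for a b vs
    using that by (induction vs)
      (auto simp: \<omega>_zero \<omega>_add distrib_left tensor_simps \<omega>_tensor mult_in star_in)
  have eq: "(\<Sum>(a, b)\<leftarrow>us. \<Sum>(c, d)\<leftarrow>vs. tr (star a * c) * tr (star b * d))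
      = \<omega> (star (tensor_sum us) * tensor_sum vs)"
    if "set us \<subseteq> M \<times> M" "set vs \<subseteq> M \<times> M" for us vs
    using that by (induction us) (auto simp: \<omega>_zero \<omega>_add star_add distrib_right inner)
  show "\<exists>us vs. set us \<subseteq> M \<times> M \<and> set vs \<subseteq> M \<times> M \<and> u = tensor_sum us \<and> v = tensor_sum vs \<and>
      \<omega> (star u * v) = (\<Sum>(a, b)\<leftarrow>us. \<Sum>(c, d)\<leftarrow>vs. tr (star a * c) * tr (star b * d))"
    using T_tensor_sum[OF assms(1)] T_tensor_sum[OF assms(2)] eq by metis
  show "r = \<omega> (star u * v)"
    if "\<exists>us vs. set us \<subseteq> M \<times> M \<and> set vs \<subseteq> M \<times> M \<and> u = tensor_sum us \<and> v = tensor_sum vs \<and>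
      r = (\<Sum>(a, b)\<leftarrow>us. \<Sum>(c, d)\<leftarrow>vs. tr (star a * c) * tr (star b * d))" for r
    using that eq by metis
qed

text \<open>The Riesz representation of bilinear forms; it makes the coproduct well-defined.\<close>

lemma tensor_representation:
  fixes g :: "'a \<Rightarrow> 'a \<Rightarrow> complex"
  assumes g: "\<And>a a' b. a \<in> M \<Longrightarrow> a' \<in> M \<Longrightarrow> b \<in> M \<Longrightarrow> g (a + a') b = g a b + g a' b"
    "\<And>a b b'. a \<in> M \<Longrightarrow> b \<in> M \<Longrightarrow> b' \<in> M \<Longrightarrow> g a (b + b') = g a b + g a b'"
    "\<And>c a b. a \<in> M \<Longrightarrow> b \<in> M \<Longrightarrow> g (c *\<^sub>C a) b = c * g a b"
    "\<And>c a b. a \<in> M \<Longrightarrow> b \<in> M \<Longrightarrow> g a (c *\<^sub>C b) = c * g a b"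
  shows "\<exists>!d. d \<in> T \<and> (\<forall>a\<in>M. \<forall>b\<in>M. \<omega> (star d * (a \<otimes> b)) = g a b)"
proof (rule ex_ex1I)
  have sum1: "g (\<Sum>i<m. c i *\<^sub>C x i) b = (\<Sum>i<m. c i * g (x i) b)" if b: "b \<in> M" for b c
  proof -
    have "k \<le> m \<Longrightarrow> (\<Sum>i<k. c i *\<^sub>C x i) \<in> M
        \<and> g (\<Sum>i<k. c i *\<^sub>C x i) b = (\<Sum>i<k. c i * g (x i) b)" for k
    proof (induction k)
      case 0
      have "g 0 b = 0" using g(3)[OF zero_in b, of 0] by simp
      then show ?case by (simp add: zero_in)
    next
      case (Suc k)
      then show ?case using x_in[of k] b by (simp add: add_in scaleC_in g)
    qed
    then show ?thesis by blast
  qed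
  have sum2: "g a (\<Sum>i<m. c i *\<^sub>C x i) = (\<Sum>i<m. c i * g a (x i))" if a: "a \<in> M" for a c
  proof -
    have "k \<le> m \<Longrightarrow> (\<Sum>i<k. c i *\<^sub>C x i) \<in> M
        \<and> g a (\<Sum>i<k. c i *\<^sub>C x i) = (\<Sum>i<k. c i * g a (x i))" for k
    proof (induction k)
      case 0
      have "g a 0 = 0" using g(4)[OF a zero_in, of 0] by simp
      then show ?case by (simp add: zero_in)
    next
      case (Suc k)
      then show ?case using x_in[of k] a by (simp add: add_in scaleC_in g)
    qed
    then show ?thesis by blast
  qed
  define d where "d = (\<Sum>i<m. \<Sum>j<m. cnj (g (x i) (x j)) *\<^sub>C basis2 i j)"
  have "d \<in> T" unfolding d_def by (intro T_sum T_scaleC basis2_in) auto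
  moreover have "\<omega> (star d * (a \<otimes> b)) = g a b" if a: "a \<in> M" and b: "b \<in> M" for a b
  proof -
    have "\<omega> (star d * (a \<otimes> b)) = (\<Sum>i<m. \<Sum>j<m. g (x i) (x j) * \<omega> (star (basis2 i j) * (a \<otimes> b)))"
      by (simp add: d_def star_sum star_scaleC sum_distrib_right mult_scaleC_left \<omega>_sum \<omega>_scaleC)
    also have "\<dots> = (\<Sum>i<m. tr (star (x i) * a) * (\<Sum>j<m. tr (star (x j) * b) * g (x i) (x j)))"
      unfolding sum_distrib_left using a b by (intro sum.cong refl) (simp add: \<omega>_basis2)
    also have "\<dots> = (\<Sum>i<m. tr (star (x i) * a) * g (x i) b)"
      using x_in expansion[OF b] by (intro sum.cong refl) (simp flip: sum2)
    also have "\<dots> = g a b" using sum1[OF b, of "\<lambda>i. tr (star (x i) * a)"] expansion[OF a] by simp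
    finally show ?thesis .
  qed
  ultimately show "\<exists>d. d \<in> T \<and> (\<forall>a\<in>M. \<forall>b\<in>M. \<omega> (star d * (a \<otimes> b)) = g a b)" by blast
next
  fix d d' assume dd: "d \<in> T \<and> (\<forall>a\<in>M. \<forall>b\<in>M. \<omega> (star d * (a \<otimes> b)) = g a b)"
    "d' \<in> T \<and> (\<forall>a\<in>M. \<forall>b\<in>M. \<omega> (star d' * (a \<otimes> b)) = g a b)"
  then show "d = d'" by (intro T_eqI) auto
qed

end

section \<open>Matrices over the tensor square\<close>

text \<open>Infinite matrices with finitely many nonzero entries: a star-algebra which contains the
  matrices of every finite size.\<close>

typedef (overloaded) 'b fmat =
  "{X :: nat \<Rightarrow> nat \<Rightarrow> 'b::zero. \<exists>N. \<forall>i j. N \<le> i \<or> N \<le> j \<longrightarrow> X i j = 0}"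
  morphisms entry Fmat
  by (rule exI[of _ "\<lambda>i j. 0"]) simp

setup_lifting type_definition_fmat

lemma fmat_eqI: "(\<And>i j. entry X i j = entry Y i j) \<Longrightarrow> X = Y"
  by transfer auto

lemma entry_bound: obtains N where "\<And>i j. N \<le> i \<or> N \<le> j \<Longrightarrow> entry X i j = 0"
  using entry[of X] by blast

instantiation fmat :: (complex_star_algebra) complex_star_algebra
begin

lift_definition zero_fmat :: "'a fmat" is "\<lambda>i j. 0" by simp

lift_definition plus_fmat :: "'a fmat \<Rightarrow> 'a fmat \<Rightarrow> 'a fmat" is "\<lambda>X Y i j. X i j + Y i j"
proof -
  fix X Y :: "nat \<Rightarrow> nat \<Rightarrow> 'a"
  assume "\<exists>N. \<forall>i j. N \<le> i \<or> N \<le> j \<longrightarrow> X i j = 0" "\<exists>N. \<forall>i j. N \<le> i \<or> N \<le> j \<longrightarrow> Y i j = 0"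
  then obtain N N' where "\<forall>i j. N \<le> i \<or> N \<le> j \<longrightarrow> X i j = 0" "\<forall>i j. N' \<le> i \<or> N' \<le> j \<longrightarrow> Y i j = 0"
    by blast
  then show "\<exists>N. \<forall>i j. N \<le> i \<or> N \<le> j \<longrightarrow> X i j + Y i j = 0"
    by (intro exI[of _ "max N N'"]) auto
qed

lift_definition scaleC_fmat :: "complex \<Rightarrow> 'a fmat \<Rightarrow> 'a fmat" is "\<lambda>c X i j. c *\<^sub>C X i j"
  by fastforce

lift_definition uminus_fmat :: "'a fmat \<Rightarrow> 'a fmat" is "\<lambda>X i j. - X i j"
  by simp

definition minus_fmat :: "'a fmat \<Rightarrow> 'a fmat \<Rightarrow> 'a fmat" where "minus_fmat X Y = X + (- Y)"

lift_definition star_fmat :: "'a fmat \<Rightarrow> 'a fmat" is "\<lambda>X i j. star (X j i)"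
  by (metis star_zero)

lift_definition times_fmat :: "'a fmat \<Rightarrow> 'a fmat \<Rightarrow> 'a fmat"
  is "\<lambda>X Y i j. \<Sum>k\<in>{k. X i k \<noteq> 0}. X i k * Y k j"
proof -
  fix X Y :: "nat \<Rightarrow> nat \<Rightarrow> 'a"
  assume "\<exists>N. \<forall>i j. N \<le> i \<or> N \<le> j \<longrightarrow> X i j = 0" "\<exists>N. \<forall>i j. N \<le> i \<or> N \<le> j \<longrightarrow> Y i j = 0"
  then obtain N N' where "\<forall>i j. N \<le> i \<or> N \<le> j \<longrightarrow> X i j = 0" "\<forall>i j. N' \<le> i \<or> N' \<le> j \<longrightarrow> Y i j = 0"
    by blast
  then show "\<exists>N. \<forall>i j. N \<le> i \<or> N \<le> j \<longrightarrow> (\<Sum>k\<in>{k. X i k \<noteq> 0}. X i k * Y k j) = 0"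
    by (intro exI[of _ "max N N'"]) (auto intro!: sum.neutral)
qed

lemma entry_simps:
  "entry 0 i j = 0" "entry (X + Y) i j = entry X i j + entry Y i j"
  "entry (c *\<^sub>C X) i j = c *\<^sub>C entry X i j" "entry (- X) i j = - entry X i j"
  "entry (star X) i j = star (entry X j i)"
  by (transfer, simp)+

lemma entry_mult:
  assumes "\<And>k. N \<le> k \<Longrightarrow> entry X i k = 0"
  shows "entry (X * Y) i j = (\<Sum>k<N. entry X i k * entry Y k j)"
proof -
  have "entry (X * Y) i j = (\<Sum>k\<in>{k. entry X i k \<noteq> 0}. entry X i k * entry Y k j)"
    by transfer simp
  also have "\<dots> = (\<Sum>k<N. entry X i k * entry Y k j)"
    using assms by (intro sum.mono_neutral_left) (auto simp: not_less[symmetric])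
  finally show ?thesis .
qed

instance
proof
  fix X Y Z :: "'a fmat" and c d :: complex
  obtain N1 where N1: "\<And>i j. N1 \<le> i \<or> N1 \<le> j \<Longrightarrow> entry X i j = 0" using entry_bound by blast
  obtain N2 where N2: "\<And>i j. N2 \<le> i \<or> N2 \<le> j \<Longrightarrow> entry Y i j = 0" using entry_bound by blast
  define N where "N = max N1 N2"
  have X: "entry X i j = 0" if "N \<le> i \<or> N \<le> j" for i j using N1 that by (auto simp: N_def)
  have Y: "entry Y i j = 0" if "N \<le> i \<or> N \<le> j" for i j using N2 that by (auto simp: N_def)
  have mult_X: "entry (X * W) i j = (\<Sum>k<N. entry X i k * entry W k j)" for W i j
    by (rule entry_mult) (simp add: X)
  have mult_Y: "entry (Y * W) i j = (\<Sum>k<N. entry Y i k * entry W k j)" for W i j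
    by (rule entry_mult) (simp add: Y)
  show "X + Y + Z = X + (Y + Z)" "X + Y = Y + X" "0 + X = X" "- X + X = 0"
    by (rule fmat_eqI, simp add: entry_simps add.assoc add.commute)+
  show "X - Y = X + - Y" by (rule minus_fmat_def)
  show "X * Y * Z = X * (Y * Z)"
  proof (rule fmat_eqI)
    fix i j
    have "entry (X * Y * Z) i j = (\<Sum>k<N. entry (X * Y) i k * entry Z k j)"
      by (rule entry_mult) (simp add: mult_X Y)
    also have "\<dots> = (\<Sum>k<N. \<Sum>l<N. entry X i l * (entry Y l k * entry Z k j))"
      by (simp add: mult_X sum_distrib_right mult.assoc)
    also have "\<dots> = (\<Sum>l<N. \<Sum>k<N. entry X i l * (entry Y l k * entry Z k j))" by (rule sum.swap)
    also have "\<dots> = entry (X * (Y * Z)) i j" by (simp add: mult_X mult_Y sum_distrib_left)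
    finally show "entry (X * Y * Z) i j = entry (X * (Y * Z)) i j" .
  qed
  show "(X + Y) * Z = X * Z + Y * Z"
  proof (rule fmat_eqI)
    fix i j
    have "entry ((X + Y) * Z) i j = (\<Sum>k<N. entry (X + Y) i k * entry Z k j)"
      by (rule entry_mult) (simp add: entry_simps X Y)
    then show "entry ((X + Y) * Z) i j = entry (X * Z + Y * Z) i j"
      by (simp add: entry_simps mult_X mult_Y distrib_right sum.distrib)
  qed
  show "X * (Y + Z) = X * Y + X * Z"
    by (rule fmat_eqI) (simp add: entry_simps mult_X distrib_left sum.distrib)
  show "c *\<^sub>C (X + Y) = c *\<^sub>C X + c *\<^sub>C Y" "(c + d) *\<^sub>C X = c *\<^sub>C X + d *\<^sub>C X"
    "c *\<^sub>C d *\<^sub>C X = (c * d) *\<^sub>C X" "1 *\<^sub>C X = X"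
    by (rule fmat_eqI, simp add: entry_simps scaleC_add_right scaleC_add_left scaleC_scaleC scaleC_one)+
  show "(c *\<^sub>C X) * Y = c *\<^sub>C (X * Y)"
  proof (rule fmat_eqI)
    fix i j
    have "entry ((c *\<^sub>C X) * Y) i j = (\<Sum>k<N. entry (c *\<^sub>C X) i k * entry Y k j)"
      by (rule entry_mult) (simp add: entry_simps X)
    then show "entry ((c *\<^sub>C X) * Y) i j = entry (c *\<^sub>C (X * Y)) i j"
      by (simp add: entry_simps mult_X mult_scaleC_left complex_vector.scale_sum_right)
  qed
  show "X * (c *\<^sub>C Y) = c *\<^sub>C (X * Y)"
    by (rule fmat_eqI) (simp add: entry_simps mult_X mult_scaleC_right complex_vector.scale_sum_right)
  show "star (star X) = X" "star (X + Y) = star X + star Y" "star (c *\<^sub>C X) = cnj c *\<^sub>C star X"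
    by (rule fmat_eqI, simp add: entry_simps star_star star_add star_scaleC)+
  show "star (X * Y) = star Y * star X"
  proof (rule fmat_eqI)
    fix i j
    have "entry (star Y * star X) i j = (\<Sum>k<N. entry (star Y) i k * entry (star X) k j)"
      by (rule entry_mult) (simp add: entry_simps Y)
    then show "entry (star (X * Y)) i j = entry (star Y * star X) i j"
      by (simp add: entry_simps mult_X star_sum star_mult)
  qed
qed

end

lemma entry_sum: "entry (sum f I) i j = (\<Sum>k\<in>I. entry (f k) i j)"
  by (induction I rule: infinite_finite_induct) (simp_all add: entry_simps)

lift_definition fmat_of :: "nat \<Rightarrow> (nat \<Rightarrow> nat \<Rightarrow> 'b::zero) \<Rightarrow> 'b fmat"
  is "\<lambda>n X i j. if i < n \<and> j < n then X i j else 0"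
  by (metis not_less)

lift_definition matrix_unit :: "nat \<Rightarrow> nat \<Rightarrow> 'b::zero \<Rightarrow> 'b fmat"
  is "\<lambda>i j u k l. if k = i \<and> l = j then u else 0"
proof -
  fix i j :: nat and u :: 'b
  show "\<exists>N. \<forall>k l. N \<le> k \<or> N \<le> l \<longrightarrow> (if k = i \<and> l = j then u else 0) = 0"
    by (rule exI[of _ "Suc (max i j)"]) auto
qed

lemma entry_fmat_of: "entry (fmat_of n X) i j = (if i < n \<and> j < n then X i j else 0)"
  by transfer simp

lemma entry_matrix_unit: "entry (matrix_unit i j u) k l = (if k = i \<and> l = j then u else 0)"
  by transfer simp

lemma nonneg_real_sum:
  assumes "\<And>l. l \<in> L \<Longrightarrow> \<exists>s\<ge>0. f l = complex_of_real s"
  shows "\<exists>s\<ge>0. sum f L = complex_of_real s"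
  using assms
proof (induction L rule: infinite_finite_induct)
  case (insert l L)
  obtain s where s: "s \<ge> 0" "f l = of_real s" using insert.prems by blast
  obtain s' where "s' \<ge> 0" "sum f L = of_real s'" using insert.IH insert.prems by blast
  with s show ?case using insert by (intro exI[of _ "s + s'"]) simp
qed auto

context trace_algebra
begin

definition Mat :: "nat \<Rightarrow> ('a, 'a) tensor fmat set" where
  "Mat n = {X. (\<forall>i j. entry X i j \<in> T) \<and> (\<forall>i j. n \<le> i \<or> n \<le> j \<longrightarrow> entry X i j = 0)}"

definition tr_Mat :: "nat \<Rightarrow> ('a, 'a) tensor fmat \<Rightarrow> complex" where
  "tr_Mat n X = (\<Sum>i<n. \<omega> (entry X i i))"

lemma MatD: "X \<in> Mat n \<Longrightarrow> entry X i j \<in> T" "X \<in> Mat n \<Longrightarrow> n \<le> i \<or> n \<le> j \<Longrightarrow> entry X i j = 0"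
  by (auto simp: Mat_def)

lemma entry_Mat_mult:
  assumes "X \<in> Mat n"
  shows "entry (X * Y) i j = (\<Sum>k<n. entry X i k * entry Y k j)"
  by (rule entry_mult) (use MatD(2)[OF assms] in blast)

lemma Mat_star: "X \<in> Mat n \<Longrightarrow> star X \<in> Mat n"
  by (simp add: Mat_def entry_simps T_star)

text \<open>The trace of \<open>star X * X\<close> is the sum of the numbers \<open>\<omega> (star u * u)\<close> over the entries \<open>u\<close> of \<open>X\<close>.\<close>

lemma Mat_finite_star_algebra: "finite_star_algebra (Mat n) (tr_Mat n)"
proof
  fix X Y :: "('a, 'a) tensor fmat" and c :: complex
  show "X + Y \<in> Mat n" if "X \<in> Mat n" "Y \<in> Mat n"
    using that by (simp add: Mat_def entry_simps T_add)
  show "c *\<^sub>C X \<in> Mat n" if "X \<in> Mat n"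
    using that by (simp add: Mat_def entry_simps T_scaleC)
  show "X * Y \<in> Mat n" if XY: "X \<in> Mat n" "Y \<in> Mat n"
    unfolding Mat_def
  proof (intro CollectI conjI allI impI)
    fix i j
    show "entry (X * Y) i j \<in> T"
      unfolding entry_Mat_mult[OF XY(1)] by (intro T_sum T_mult MatD(1)[OF XY(1)] MatD(1)[OF XY(2)])
    assume "n \<le> i \<or> n \<le> j"
    then have "entry X i k * entry Y k j = 0" for k
      using MatD(2)[OF XY(1), of i k] MatD(2)[OF XY(2), of k j] by auto
    then show "entry (X * Y) i j = 0"
      unfolding entry_Mat_mult[OF XY(1)] by simp
  qed
  show "star X \<in> Mat n" if "X \<in> Mat n" using that by (rule Mat_star)
  show "0 \<in> Mat n" by (simp add: Mat_def entry_simps T_zero)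
  show "tr_Mat n (X + Y) = tr_Mat n X + tr_Mat n Y" "tr_Mat n (c *\<^sub>C X) = c * tr_Mat n X"
    by (simp_all add: tr_Mat_def entry_simps \<omega>_add \<omega>_scaleC sum.distrib sum_distrib_left)
  show "tr_Mat n (star X) = cnj (tr_Mat n X)" if "X \<in> Mat n"
    using MatD(1)[OF that] by (simp add: tr_Mat_def entry_simps \<omega>_star)
  define r where "r i k = Re (\<omega> (star (entry X k i) * entry X k i))" for i k
  have r: "r i k \<ge> 0" "\<omega> (star (entry X k i) * entry X k i) = of_real (r i k)" if "X \<in> Mat n" for i k
    using \<omega>_pos[OF MatD(1)[OF that, of k i]] by (auto simp: r_def)
  have trXX: "tr_Mat n (star X * X) = of_real (\<Sum>i<n. \<Sum>k<n. r i k)" if "X \<in> Mat n"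
    by (simp add: tr_Mat_def entry_Mat_mult[OF Mat_star[OF that]] entry_simps \<omega>_sum r(2)[OF that])
  show "\<exists>r\<ge>0. tr_Mat n (star X * X) = of_real r" if "X \<in> Mat n"
    using trXX[OF that] r(1)[OF that] by (intro exI[of _ "\<Sum>i<n. \<Sum>k<n. r i k"]) (simp add: sum_nonneg)
  show "X = 0" if X: "X \<in> Mat n" and "tr_Mat n (star X * X) = 0"
  proof (rule fmat_eqI)
    fix k i
    have "(\<Sum>i<n. \<Sum>k<n. r i k) = 0" using trXX[OF X] that(2) by (metis of_real_eq_0_iff)
    then have "r i k = 0" if "i < n" "k < n"
      using that r(1)[OF X] by (simp add: sum_nonneg_eq_0_iff sum_nonneg)
    then have "entry X k i = 0" if "i < n" "k < n"
      using that r(2)[OF X, of k i] \<omega>_faithful[OF MatD(1)[OF X]] by simp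
    moreover have "entry X k i = 0" if "\<not> (i < n \<and> k < n)"
      using MatD(2)[OF X, of k i] that by auto
    ultimately show "entry X k i = entry 0 k i" by (auto simp: entry_simps)
  qed
  let ?G = "(\<lambda>(i, j, p, q). matrix_unit i j (basis2 p q)) ` ({..<n} \<times> {..<n} \<times> {..<m} \<times> {..<m})"
  have "Y \<in> complex_vector.span ?G" if Y: "Y \<in> Mat n" for Y
  proof -
    have "Y = (\<Sum>i<n. \<Sum>j<n. \<Sum>p<m. \<Sum>q<m.
        \<omega> (star (basis2 p q) * entry Y i j) *\<^sub>C matrix_unit i j (basis2 p q))" (is "Y = ?S")
    proof (rule fmat_eqI)
      fix k l
      have "entry ?S k l = (\<Sum>i<n. \<Sum>j<n. if k = i \<and> l = j then
          (\<Sum>p<m. \<Sum>q<m. \<omega> (star (basis2 p q) * entry Y i j) *\<^sub>C basis2 p q) else 0)"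
        by (auto simp: entry_sum entry_simps entry_matrix_unit intro!: sum.cong)
      also have "\<dots> = (\<Sum>i<n. \<Sum>j<n. if k = i \<and> l = j then entry Y i j else 0)"
        by (simp only: T_expansion[OF MatD(1)[OF Y], symmetric])
      also have "\<dots> = (\<Sum>i<n. if k = i then (\<Sum>j<n. if l = j then entry Y i j else 0) else 0)"
        by (intro sum.cong) auto
      also have "\<dots> = (if k < n \<and> l < n then entry Y k l else 0)" by (simp add: sum.delta')
      also have "\<dots> = entry Y k l" using MatD(2)[OF Y, of k l] by auto
      finally show "entry Y k l = entry ?S k l" ..
    qed
    also have "?S \<in> complex_vector.span ?G"
      by (intro complex_vector.span_sum complex_vector.span_scale complex_vector.span_base) force
    finally show ?thesis .
  qed
  then show "\<exists>G. finite G \<and> Mat n \<subseteq> complex_vector.span G" by (intro exI[of _ ?G]) auto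
qed

text \<open>The adjoint of a bilinear product is completely positive if the product maps pairs of
  Gram matrices to matrices which are positive in the sense of the last assumption.
  By duality the quadratic form of \<open>\<Delta> (X i j)\<close> at a matrix \<open>w\<close> is evaluated by expanding
  the entries of \<open>w\<close> in elementary tensors.\<close>

lemma adjoint_completely_positive:
  fixes conv :: "'a \<Rightarrow> 'a \<Rightarrow> 'a" and \<Delta> :: "'a \<Rightarrow> ('a, 'a) tensor"
  assumes conv_in: "\<And>a b. a \<in> M \<Longrightarrow> b \<in> M \<Longrightarrow> conv a b \<in> M"
    and \<Delta>_in: "\<And>a. a \<in> M \<Longrightarrow> \<Delta> a \<in> T"
    and \<Delta>: "\<And>c a b. c \<in> M \<Longrightarrow> a \<in> M \<Longrightarrow> b \<in> M \<Longrightarrow>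
      \<omega> (star (\<Delta> c) * (a \<otimes> b)) = tr (star c * conv a b)"
    and pos: "\<And>(P :: (nat \<times> nat \<times> nat) set) y a b. finite P \<Longrightarrow> (\<And>p. p \<in> P \<Longrightarrow> y p \<in> M) \<Longrightarrow>
      (\<And>p. p \<in> P \<Longrightarrow> a p \<in> M) \<Longrightarrow> (\<And>p. p \<in> P \<Longrightarrow> b p \<in> M) \<Longrightarrow>
      \<exists>s\<ge>0. (\<Sum>p\<in>P. \<Sum>q\<in>P. tr (star (y q) * y p * conv (a p * star (a q)) (b p * star (b q))))
        = of_real s"
  shows "completely_positive M T \<Delta>"
  unfolding completely_positive_def linear_onC_def
proof (intro conjI ballI allI impI)
  show "\<Delta> ` M \<subseteq> T" using \<Delta>_in by blast
  show "\<Delta> (c + d) = \<Delta> c + \<Delta> d" if "c \<in> M" "d \<in> M" for c d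
  proof (rule T_eqI)
    fix a b assume ab: "a \<in> M" "b \<in> M"
    have "\<omega> (star (\<Delta> (c + d)) * (a \<otimes> b)) = tr (star c * conv a b) + tr (star d * conv a b)"
      using that ab conv_in by (simp add: \<Delta> add_in star_add distrib_right tr_add mult_in star_in)
    then show "\<omega> (star (\<Delta> (c + d)) * (a \<otimes> b)) = \<omega> (star (\<Delta> c + \<Delta> d) * (a \<otimes> b))"
      using that ab by (simp add: star_add distrib_right \<omega>_add \<Delta>)
  qed (use that in \<open>auto simp: \<Delta>_in add_in T_add\<close>)
  show "\<Delta> (k *\<^sub>C c) = k *\<^sub>C \<Delta> c" if "c \<in> M" for k c
  proof (rule T_eqI)
    fix a b assume ab: "a \<in> M" "b \<in> M"
    have "\<omega> (star (\<Delta> (k *\<^sub>C c)) * (a \<otimes> b)) = cnj k * tr (star c * conv a b)"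
      using that ab conv_in
      by (simp add: \<Delta> scaleC_in star_scaleC mult_scaleC_left tr_scaleC mult_in star_in)
    then show "\<omega> (star (\<Delta> (k *\<^sub>C c)) * (a \<otimes> b)) = \<omega> (star (k *\<^sub>C \<Delta> c) * (a \<otimes> b))"
      using that ab by (simp add: star_scaleC mult_scaleC_left \<omega>_scaleC \<Delta>)
  qed (use that in \<open>auto simp: \<Delta>_in scaleC_in T_scaleC\<close>)
  fix n X assume "positive_matrix n M X"
  then obtain Y where Y: "\<And>i j. i < n \<Longrightarrow> j < n \<Longrightarrow> Y i j \<in> M"
    and X: "\<And>i j. i < n \<Longrightarrow> j < n \<Longrightarrow> X i j = (\<Sum>k<n. star (Y k i) * Y k j)"
    unfolding positive_matrix_def by blast
  have XM: "X i j \<in> M" if "i < n" "j < n" for i j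
    using that Y by (auto simp: X intro!: sum_in mult_in star_in)
  interpret Mat: finite_star_algebra "Mat n" "tr_Mat n" by (rule Mat_finite_star_algebra)
  define D where "D = fmat_of n (\<lambda>i j. \<Delta> (X i j))"
  have D: "D \<in> Mat n" unfolding Mat_def D_def using XM \<Delta>_in T_zero by (auto simp: entry_fmat_of)
  have "\<exists>r\<ge>0. tr_Mat n (star w * (D * w)) = of_real r" if w: "w \<in> Mat n" for w
  proof -
    let ?R = "{..<m} \<times> {..<m}"
    let ?P = "{..<n} \<times> ?R"
    \<comment> \<open>The diagonal entry of \<open>star w * D * w\<close> at \<open>k\<close> involves only column \<open>k\<close> of \<open>w\<close>.\<close>
    have column: "\<exists>s\<ge>0. (\<Sum>i<n. \<Sum>j<n. \<omega> (star (entry w i k) * (entry D i j * entry w j k))) = of_real s"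
      for k
    proof -
      define a where "a i r = \<omega> (star (basis2 (fst r) (snd r)) * entry w i k) *\<^sub>C x (fst r)"
        for i and r :: "nat \<times> nat"
      define b where "b r = x (snd r)" for r :: "nat \<times> nat"
      have a: "a i r \<in> M" if "r \<in> ?R" for i r using that x_in by (auto simp: a_def intro: scaleC_in)
      have b: "b r \<in> M" if "r \<in> ?R" for r using that x_in by (auto simp: b_def)
      have w_ab: "entry w i k = (\<Sum>r\<in>?R. a i r \<otimes> b r)" for i
      proof -
        have "entry w i k = (\<Sum>p<m. \<Sum>q<m. \<omega> (star (basis2 p q) * entry w i k) *\<^sub>C basis2 p q)"
          by (rule T_expansion[OF MatD(1)[OF w]])
        then show ?thesis
          by (simp add: sum.cartesian_product a_def b_def tensor_simps(3) basis2_def split_def)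
      qed
      let ?t = "\<lambda>l i j r s. tr (star (Y l j) * Y l i * conv (a i r * star (a j s)) (b r * star (b s)))"
      have entry: "\<omega> (star (entry w i k) * (entry D i j * entry w j k))
          = cnj (\<Sum>l<n. \<Sum>r\<in>?R. \<Sum>s\<in>?R. ?t l i j r s)" if ij: "i < n" "j < n" for i j
      proof -
        let ?W = "entry w i k * star (entry w j k)"
        note T_rules = MatD(1)[OF w] MatD(1)[OF D] T_mult T_star
        have D_ij: "entry D i j = \<Delta> (X i j)" using ij by (simp add: D_def entry_fmat_of)
        have cM: "conv (a i r * star (a j s)) (b r * star (b s)) \<in> M" if "r \<in> ?R" "s \<in> ?R" for r s
          using a b that by (intro conv_in mult_in star_in) auto
        have "\<omega> (star (entry w i k) * (entry D i j * entry w j k))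
            = cnj (\<omega> (star (star (entry w i k) * (entry D i j * entry w j k))))"
          using \<omega>_star T_rules by simp
        also have "star (star (entry w i k) * (entry D i j * entry w j k))
            = star (entry w j k) * (star (entry D i j) * entry w i k)"
          by (simp add: star_mult star_star mult.assoc)
        also have "\<omega> (star (entry w j k) * (star (entry D i j) * entry w i k))
            = \<omega> (star (entry D i j) * ?W)"
          using \<omega>_comm[of "star (entry w j k)" "star (entry D i j) * entry w i k"] T_rules
          by (simp add: mult.assoc)
        also have "?W = (\<Sum>r\<in>?R. \<Sum>s\<in>?R. (a i r * star (a j s)) \<otimes> (b r * star (b s)))"
          by (simp add: w_ab star_sum sum_product tensor_simps)
        also have "\<omega> (star (entry D i j) * (\<Sum>r\<in>?R. \<Sum>s\<in>?R. (a i r * star (a j s)) \<otimes> (b r * star (b s))))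
            = (\<Sum>r\<in>?R. \<Sum>s\<in>?R. tr (star (X i j) * conv (a i r * star (a j s)) (b r * star (b s))))"
          unfolding sum_distrib_left \<omega>_sum D_ij
          using ij XM a b by (intro sum.cong refl \<Delta> mult_in star_in) auto
        also have "\<dots> = (\<Sum>r\<in>?R. \<Sum>s\<in>?R. \<Sum>l<n. ?t l i j r s)"
        proof (intro sum.cong refl)
          fix r s assume rs: "r \<in> ?R" "s \<in> ?R"
          have "star (X i j) = (\<Sum>l<n. star (Y l j) * Y l i)"
            using ij by (simp add: X star_sum star_mult star_star)
          then have "tr (star (X i j) * conv (a i r * star (a j s)) (b r * star (b s)))
              = tr (\<Sum>l<n. star (Y l j) * Y l i * conv (a i r * star (a j s)) (b r * star (b s)))"
            by (simp add: sum_distrib_right)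
          also have "\<dots> = (\<Sum>l<n. ?t l i j r s)"
            using Y ij cM[OF rs] by (intro tr_sum mult_in star_in) auto
          finally show "tr (star (X i j) * conv (a i r * star (a j s)) (b r * star (b s)))
              = (\<Sum>l<n. ?t l i j r s)" .
        qed
        also have "\<dots> = (\<Sum>l<n. \<Sum>r\<in>?R. \<Sum>s\<in>?R. ?t l i j r s)"
          by (subst sum.swap[of _ _ ?R], subst sum.swap[of _ "{..<n}" ?R]) (rule refl)
        finally show ?thesis .
      qed
      have nonneg: "\<exists>s\<ge>0. (\<Sum>i<n. \<Sum>r\<in>?R. \<Sum>j<n. \<Sum>s\<in>?R. ?t l i j r s) = complex_of_real s"
        if l: "l < n" for l
      proof -
        have "\<exists>s\<ge>0. (\<Sum>p\<in>?P. \<Sum>q\<in>?P. ?t l (fst p) (fst q) (snd p) (snd q)) = complex_of_real s"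
          using Y[OF l] a b
          by (intro pos[of ?P "\<lambda>p. Y l (fst p)" "\<lambda>p. a (fst p) (snd p)" "\<lambda>p. b (snd p)"]) auto
        moreover have "(\<Sum>i<n. \<Sum>r\<in>?R. g i r) = (\<Sum>p\<in>?P. g (fst p) (snd p))"
          for g :: "nat \<Rightarrow> nat \<times> nat \<Rightarrow> complex"
          by (simp only: sum.cartesian_product split_def)
        ultimately show ?thesis by (simp only:)
      qed
      have "(\<Sum>i<n. \<Sum>j<n. \<omega> (star (entry w i k) * (entry D i j * entry w j k)))
          = cnj (\<Sum>i<n. \<Sum>j<n. \<Sum>l<n. \<Sum>r\<in>?R. \<Sum>s\<in>?R. ?t l i j r s)"
        by (simp add: entry)
      also have "(\<Sum>i<n. \<Sum>j<n. \<Sum>l<n. \<Sum>r\<in>?R. \<Sum>s\<in>?R. ?t l i j r s)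
          = (\<Sum>i<n. \<Sum>l<n. \<Sum>r\<in>?R. \<Sum>j<n. \<Sum>s\<in>?R. ?t l i j r s)"
      proof (rule sum.cong[OF refl])
        fix i
        have "(\<Sum>j<n. \<Sum>l<n. \<Sum>r\<in>?R. \<Sum>s\<in>?R. ?t l i j r s) = (\<Sum>l<n. \<Sum>j<n. \<Sum>r\<in>?R. \<Sum>s\<in>?R. ?t l i j r s)"
          by (rule sum.swap)
        also have "\<dots> = (\<Sum>l<n. \<Sum>r\<in>?R. \<Sum>j<n. \<Sum>s\<in>?R. ?t l i j r s)"
          by (intro sum.cong refl sum.swap)
        finally show "(\<Sum>j<n. \<Sum>l<n. \<Sum>r\<in>?R. \<Sum>s\<in>?R. ?t l i j r s) = \<dots>" .
      qed
      also have "\<dots> = (\<Sum>l<n. \<Sum>i<n. \<Sum>r\<in>?R. \<Sum>j<n. \<Sum>s\<in>?R. ?t l i j r s)" by (rule sum.swap)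
      finally have eq: "(\<Sum>i<n. \<Sum>j<n. \<omega> (star (entry w i k) * (entry D i j * entry w j k)))
          = cnj (\<Sum>l<n. \<Sum>i<n. \<Sum>r\<in>?R. \<Sum>j<n. \<Sum>s\<in>?R. ?t l i j r s)" .
      have "\<exists>s\<ge>0. (\<Sum>l<n. \<Sum>i<n. \<Sum>r\<in>?R. \<Sum>j<n. \<Sum>s\<in>?R. ?t l i j r s) = complex_of_real s"
        by (rule nonneg_real_sum) (simp add: nonneg)
      then show ?thesis unfolding eq by force
    qed
    have "tr_Mat n (star w * (D * w))
        = (\<Sum>k<n. \<Sum>i<n. \<Sum>j<n. \<omega> (star (entry w i k) * (entry D i j * entry w j k)))"
      by (simp add: tr_Mat_def entry_Mat_mult[OF Mat_star[OF w]] entry_Mat_mult[OF D] entry_simps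
          sum_distrib_left \<omega>_sum)
    then show ?thesis using nonneg_real_sum[OF column] by simp
  qed
  from Mat.square_root_of_nonneg_form[OF D this] obtain S where S: "S \<in> Mat n" "D = star S * S" by blast
  have "\<Delta> (X i j) = (\<Sum>k<n. star (entry S k i) * entry S k j)" if "i < n" "j < n" for i j
  proof -
    have "\<Delta> (X i j) = entry D i j" using that by (simp add: D_def entry_fmat_of)
    also have "\<dots> = (\<Sum>k<n. star (entry S k i) * entry S k j)"
      unfolding S(2) by (simp add: entry_Mat_mult[OF Mat_star[OF S(1)]] entry_simps)
    finally show ?thesis .
  qed
  then show "positive_matrix n T (\<lambda>i j. \<Delta> (X i j))"
    unfolding positive_matrix_def using MatD(1)[OF S(1)] by (intro exI[of _ "entry S"]) auto
qed

end

section \<open>Complete positivity of the coproduct\<close>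

lemma pos_sum_eq_0:
  assumes "finite I" "\<And>i. i \<in> I \<Longrightarrow> pos (f i)" "sum f I = 0" "i \<in> I"
  shows "f i = 0"
proof (rule pos_antisym)
  show "pos (f i)" using assms by blast
  have "f i + sum f (I - {i}) = 0" using assms by (simp add: sum.remove)
  then have "- f i = sum f (I - {i})" by (simp add: add_eq_0_iff)
  moreover have "pos (sum f (I - {i}))" using assms by (intro pos_sum) auto
  ultimately show "pos (- f i)" by simp
qed

text \<open>The index is a sum of positive elements \<open>u i * star (u i)\<close>. If it vanished, all of them would, and
  so would the expansion of \<open>1\<close> in the quasi-basis.\<close>

lemma (in finite_index_expectation) index_positive_scalar:
  assumes center_A: "\<And>z. z \<in> A \<Longrightarrow> (\<And>a. a \<in> A \<Longrightarrow> a * z = z * a) \<Longrightarrow> \<exists>c. z = c *\<^sub>C 1"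
  obtains k where "k > 0" "index_map 1 = k *\<^sub>R 1"
proof -
  have "\<exists>c. index_map 1 = c *\<^sub>C 1"
    using index_map_in[of 1] index_map_commutes[of 1] A_rules by (intro center_A) auto
  then obtain c where c: "index_map 1 = c *\<^sub>C 1" ..
  have uu: "pos (u i * star (u i))" for i using pos_star_mult[of "star (u i)"] by (simp add: star_star)
  have im: "index_map 1 = (\<Sum>i\<in>I. u i * star (u i))" by (simp add: index_map_def)
  then have "pos (index_map 1)" using uu by (simp add: pos_sum)
  from pos_scalarD[OF this[unfolded c]] have c_real: "c = of_real (Re c)" "Re c \<ge> 0"
    by (simp_all add: complex_eq_iff)
  have "Re c \<noteq> 0"
  proof
    assume "Re c = 0"
    then have "c = 0" using c_real(1) by simp
    then have sum0: "(\<Sum>i\<in>I. u i * star (u i)) = 0" using c im by simp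
    have "star (u i) = 0" if "i \<in> I" for i
    proof -
      have "u i * star (u i) = 0" by (rule pos_sum_eq_0[OF fin uu sum0 that])
      then show ?thesis using star_square_eq_0_iff[of "star (u i)"] by (simp add: star_star)
    qed
    then have "(1::'a) = 0" using basis_right[of 1] A_rules by simp
    then show False by simp
  qed
  then have "Re c > 0" using c_real(2) by simp
  moreover have "index_map 1 = Re c *\<^sub>R 1" using c c_real(1) scaleC_of_real by metis
  ultimately show ?thesis by (rule that)
qed

theorem theoremA:
  fixes B A A1 A2 M :: "'a::cstar_algebra set"
    and E0 E1 E2 :: "'a \<Rightarrow> 'a"
    and e1 e2 :: 'a
    and ls :: "'a list"
    and \<tau> :: real
    and tr :: "'a \<Rightarrow> complex"
    and \<Delta> :: "'a \<Rightarrow> ('a, 'a) tensor"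
  assumes "simple_cstar_subalgebra B" and "simple_cstar_subalgebra A" and "B \<subseteq> A"
    and "minimal_cond_exp A B E0" and "quasi_basis A E0 ls"
    and "\<tau> = inverse (watatani_index A E0)"
    and "basic_construction B A E0 A1 e1" and "dual_cond_exp \<tau> A A1 e1 E1"
    and "basic_construction A A1 E1 A2 e2" and "dual_cond_exp \<tau> A1 A2 e2 E2"
    and "M = rel_commutant B A1"
    and "tr = tower_tr E0 E1"
    and "\<Delta> = coproduct M (tr_inner tr) \<tau> (convolution \<tau> ls E2 e1 e2)"
  shows "completely_positive M (tensor_prod M M) \<Delta>"
proof -
  have center_A: "\<exists>c. z = c *\<^sub>C 1" if "z \<in> A" "\<And>a. a \<in> A \<Longrightarrow> a * z = z * a" for z
    using simple_central_scalar[OF assms(2) that] .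
  interpret E0: finite_index_expectation A B E0 "{..<length ls}" "(!) ls"
  proof
    show "cstar_subalgebra A" "cstar_subalgebra B"
      using assms(1,2) by (simp_all add: simple_cstar_subalgebra_def)
    show "B \<subseteq> A" by (rule assms(3))
    show "cond_exp A B E0"
      using assms(4) by (simp add: minimal_cond_exp_def index_finite_cond_exp_def)
    show "ls ! i \<in> A" if "i \<in> {..<length ls}" for i
      using assms(5) that unfolding quasi_basis_def by (simp add: subset_iff)
    show "(\<Sum>i<length ls. ls ! i * E0 (star (ls ! i) * x)) = x" if "x \<in> A" for x
      using assms(5) that unfolding quasi_basis_def sum_list_conv_sum_nth by simp
    show "\<exists>c. z = c *\<^sub>C 1" if "z \<in> B" "\<And>b. b \<in> B \<Longrightarrow> b * z = z * b" for z
      using simple_central_scalar[OF assms(1) that] .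
  qed simp
  obtain k where k: "k > 0" "E0.index_map 1 = k *\<^sub>R 1"
    using E0.index_positive_scalar center_A by blast
  have \<tau>k: "\<tau> = inverse k" using assms(6) E0.watatani_index_eq[OF k(2)] by simp
  interpret two_step_extension A B E0 ls A1 e1 E1 \<tau> A2 e2 E2
  proof
    show "0 < \<tau>" using k(1) by (simp add: \<tau>k)
    show "E0.index_map x = (1/\<tau>) *\<^sub>R E0 x" if "x \<in> rel_commutant B A" for x
      using E0.minimal_index_map[OF assms(4) k(2) center_A that] by (simp add: \<tau>k inverse_eq_divide)
    show "\<exists>c. z = c *\<^sub>C 1" if "z \<in> A" "\<And>a. a \<in> A \<Longrightarrow> a * z = z * a" for z
      using center_A[OF that] .
  qed (fact assms(7-10))+
  have tr: "tr = F.tr" by (rule ext) (simp add: assms(12) tower_tr_def F.tr_def F_def)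
  obtain m :: nat and x :: "nat \<Rightarrow> 'a" where x: "\<And>j. j < m \<Longrightarrow> x j \<in> M"
    "\<And>i j. i < m \<Longrightarrow> j < m \<Longrightarrow> tr (star (x i) * x j) = (if i = j then 1 else 0)"
    "\<And>y. y \<in> M \<Longrightarrow> y = (\<Sum>j<m. tr (star (x j) * y) *\<^sub>C x j)"
    using F.orthonormal_basis[OF F_central] unfolding assms(11) tr by blast
  have M: "M = F.N" by (rule assms(11))
  interpret T: trace_algebra M tr m x
  proof
    show "tr (a * b) = tr (b * a)" if "a \<in> M" "b \<in> M" for a b
      using that F_central[of a b] F.N_A F.N_rules F.E_N[of "b * a"]
      unfolding M tr by (intro F.tr_eqI) auto
  qed (use x F.N_rules in \<open>simp_all add: M tr F.tr_add F.tr_scaleC F.tr_star\<close>)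
  have MA1: "y \<in> A1" if "y \<in> M" for y using that F.N_A M by blast
  have repr: "\<exists>!d. d \<in> tensor_prod M M \<and>
      (\<forall>y\<in>M. \<forall>z\<in>M. T.\<omega> (star d * (y \<otimes> z)) = tr (star w * conv y z))" if w: "w \<in> M" for w
    by (rule T.tensor_representation)
      (use w MA1 conv_in_M in \<open>simp_all add: M[symmetric] conv_add_left conv_add_right conv_scaleC_left
        conv_scaleC_right distrib_left mult_scaleC_right T.tr_add T.tr_scaleC T.mult_in T.star_in\<close>)
  \<comment> \<open>The scalar \<open>\<tau> powr (1/2)\<close> in the coproduct cancels the one between \<open>conv\<close> and the convolution.\<close>
  have \<Delta>_eq: "\<Delta> w = (THE d. d \<in> tensor_prod M M \<and>
      (\<forall>y\<in>M. \<forall>z\<in>M. T.\<omega> (star d * (y \<otimes> z)) = tr (star w * conv y z)))" if w: "w \<in> M" for w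
  proof -
    have inner: "complex_of_real (\<tau> powr (1/2)) * tr_inner tr w (convolution \<tau> ls E2 e1 e2 y z)
        = tr (star w * conv y z)" if "y \<in> M" "z \<in> M" for y z
    proof -
      have wc: "star w * conv y z \<in> M"
        using w that conv_in_M T.mult_in T.star_in by (simp add: M)
      have "convolution \<tau> ls E2 e1 e2 y z = complex_of_real (1 / sqrt \<tau>) *\<^sub>C conv y z"
        using convolution_eq[of y z] that by (simp add: M scaleR_scaleC)
      then have "tr_inner tr w (convolution \<tau> ls E2 e1 e2 y z)
          = complex_of_real (1 / sqrt \<tau>) * tr (star w * conv y z)"
        using T.tr_scaleC[OF wc] by (simp add: tr_inner_def mult_scaleC_right)
      moreover have "complex_of_real (\<tau> powr (1/2)) * complex_of_real (1 / sqrt \<tau>) = 1"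
        using \<tau> by (simp add: powr_half_sqrt flip: of_real_mult)
      ultimately show ?thesis by (metis mult.assoc mult_1)
    qed
    have "(d \<in> tensor_prod M M \<and> (\<forall>y\<in>M. \<forall>z\<in>M.
        tensor_inner M M (tr_inner tr) (tr_inner tr) d (y \<otimes> z) =
          complex_of_real (\<tau> powr (1/2)) * tr_inner tr w (convolution \<tau> ls E2 e1 e2 y z)))
      \<longleftrightarrow> (d \<in> tensor_prod M M \<and>
        (\<forall>y\<in>M. \<forall>z\<in>M. T.\<omega> (star d * (y \<otimes> z)) = tr (star w * conv y z)))" for d
    proof -
      have "tensor_inner M M (tr_inner tr) (tr_inner tr) d (y \<otimes> z) = T.\<omega> (star d * (y \<otimes> z))"
        if "d \<in> tensor_prod M M" "y \<in> M" "z \<in> M" for y z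
        using T.tensor_inner_eq[OF that(1) T.T_tensor[OF that(2,3)]] by (simp add: tr_inner_def[abs_def])
      then show ?thesis using inner by auto
    qed
    then show ?thesis by (simp only: assms(13) coproduct_def)
  qed
  have \<Delta>: "\<Delta> w \<in> tensor_prod M M \<and>
      (\<forall>y\<in>M. \<forall>z\<in>M. T.\<omega> (star (\<Delta> w) * (y \<otimes> z)) = tr (star w * conv y z))" if "w \<in> M" for w
    unfolding \<Delta>_eq[OF that] by (rule theI'[OF repr[OF that]])
  show ?thesis
  proof (rule T.adjoint_completely_positive[where conv = conv])
    show "conv y z \<in> M" if "y \<in> M" "z \<in> M" for y z using that conv_in_M by (simp add: M)
    show "\<exists>s\<ge>0. (\<Sum>p\<in>P. \<Sum>q\<in>P. tr (star (y q) * y p * conv (a p * star (a q)) (b p * star (b q))))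
        = complex_of_real s"
      if "finite P" "\<And>p. p \<in> P \<Longrightarrow> y p \<in> M" "\<And>p. p \<in> P \<Longrightarrow> a p \<in> M" "\<And>p. p \<in> P \<Longrightarrow> b p \<in> M"
      for P :: "(nat \<times> nat \<times> nat) set" and y a b
      unfolding tr by (rule conv_positive) (use that in \<open>simp_all add: M\<close>)
  qed (use \<Delta> in blast)+
qed

end
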